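(* Let $s\in(0,1]$ and $p\in[1,+\infty)$ be such that $sp<N$ and $s\neq p$. Let $\Omega\subset\mathbb{R}^N$ be an open and bounded domain with Lipschitz boundary. Let $\widetilde s,\widetilde p$ satisfy $$0\le\widetilde s<s\qquad\text{and}\qquad \frac{sp}{sp-(p-1)\widetilde s}\le\widetilde p<\frac{Np}{N-(s-\widetilde s)p}.$$ Then the space $W^{s,p}(\Omega)$ is compactly embedded in $W^{\widetilde s,\widetilde p}(\Omega)$. Moreover, the curve $\gamma:[0,1]\to\mathbb{R}^2$ defined as $$\gamma(\theta):=(s_\theta,p_\theta)=\left(\theta\widetilde s+(1-\theta)s,\ \frac{p\,\widetilde p}{\widetilde p+\theta(p-\widetilde p)}\right)$$ is such that, if $0<\theta_1<\theta_2\le1$, then the space $W^{s_{\theta_1},p_{\theta_1}}(\Omega)$ is compactly embedded in $W^{s_{\theta_2},p_{\theta_2}}(\Omega)$.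
   Context: $N\ge1$ is an integer and functions are real-valued and measurable. For $s\in[0,1]$ and $p\in[1,+\infty)$ define $[u]_{W^{0,p}(\Omega)}:=\|u\|_{L^p(\Omega)}$, $[u]_{W^{1,p}(\Omega)}:=\|\nabla u\|_{L^p(\Omega)}$ (weak gradient) and, for $s\in(0,1)$, $$[u]_{W^{s,p}(\Omega)}:=\left(c_{N,s,p}\iint_{\Omega\times\Omega}\frac{|u(x)-u(y)|^p}{|x-y|^{N+sp}}\,dx\,dy\right)^{1/p},\qquad c_{N,s,p}:=\frac{s\,2^{2s-1}\,\Gamma\left(\frac{ps+p+N-2}{2}\right)}{\pi^{N/2}\,\Gamma(1-s)}.$$ Set $W^{s,p}(\Omega):=\{u\in L^p(\Omega):[u]_{W^{s,p}(\Omega)}<+\infty\}$, with norm $\|u\|_{W^{0,p}(\Omega)}:=\|u\|_{L^p(\Omega)}$ if $s=0$ and $\|u\|_{W^{s,p}(\Omega)}:=\big([u]^p_{W^{s,p}(\Omega)}+\|u\|^p_{L^p(\Omega)}\big)^{1/p}$ if $s\in(0,1]$. *)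

theory Defs
  imports "HOL-Analysis.Analysis"
begin

definition ennreal_powr :: "ennreal \<Rightarrow> real \<Rightarrow> ennreal" where
  "ennreal_powr x a = (if x = \<infinity> then \<infinity> else ennreal (enn2real x powr a))"
  \<comment> \<open>only meaningful, and only used, for exponents \<open>a > 0\<close>\<close>

definition Lp_norm ::
  "real \<Rightarrow> ('a::euclidean_space) set \<Rightarrow> ('a \<Rightarrow> 'b::real_normed_vector) \<Rightarrow> ennreal" where
  "Lp_norm p \<Omega> f =
     ennreal_powr (\<integral>\<^sup>+x. ennreal (norm (f x) powr p) \<partial>lebesgue_on \<Omega>) (1 / p)"

fun Ck_function :: "nat \<Rightarrow> ('a::euclidean_space \<Rightarrow> real) \<Rightarrow> bool" where
  "Ck_function 0 f \<longleftrightarrow> continuous_on UNIV f"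
| "Ck_function (Suc k) f \<longleftrightarrow>
     (\<forall>x. f differentiable (at x)) \<and>
     (\<forall>i\<in>Basis. Ck_function k (\<lambda>x. frechet_derivative f (at x) i))"

definition test_function :: "('a::euclidean_space) set \<Rightarrow> ('a \<Rightarrow> real) \<Rightarrow> bool" where
  "test_function \<Omega> \<phi> \<longleftrightarrow>
     (\<forall>k. Ck_function k \<phi>) \<and>
     compact (closure {x. \<phi> x \<noteq> 0}) \<and> closure {x. \<phi> x \<noteq> 0} \<subseteq> \<Omega>"

definition locally_integrable ::
  "('a::euclidean_space) set \<Rightarrow> ('a \<Rightarrow> 'b::{banach, second_countable_topology}) \<Rightarrow> bool" where
  "locally_integrable \<Omega> f \<longleftrightarrow> (\<forall>K. compact K \<and> K \<subseteq> \<Omega> \<longrightarrow> integrable (lebesgue_on K) f)"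

definition has_weak_gradient ::
  "('a::euclidean_space) set \<Rightarrow> ('a \<Rightarrow> real) \<Rightarrow> ('a \<Rightarrow> 'a) \<Rightarrow> bool" where
  "has_weak_gradient \<Omega> u g \<longleftrightarrow>
     locally_integrable \<Omega> u \<and> locally_integrable \<Omega> g \<and>
     (\<forall>\<phi>. test_function \<Omega> \<phi> \<longrightarrow>
        (\<forall>i\<in>Basis.
           (\<integral>x. u x * frechet_derivative \<phi> (at x) i \<partial>lebesgue_on \<Omega>) =
           - (\<integral>x. (g x \<bullet> i) * \<phi> x \<partial>lebesgue_on \<Omega>)))"

text \<open>
  The weak gradient is unique up to null sets, so its \<open>L\<^sup>p\<close> norm does not depend on the choice.
\<close>

definition weak_gradient ::
  "('a::euclidean_space) set \<Rightarrow> ('a \<Rightarrow> real) \<Rightarrow> 'a \<Rightarrow> 'a" where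
  "weak_gradient \<Omega> u = (SOME g. has_weak_gradient \<Omega> u g)"

definition sobolev_const :: "nat \<Rightarrow> real \<Rightarrow> real \<Rightarrow> real" where
  "sobolev_const N s p =
     s * 2 powr (2 * s - 1) * Gamma ((p * s + p + real N - 2) / 2) /
     (pi powr (real N / 2) * Gamma (1 - s))"

definition gagliardo_seminorm ::
  "real \<Rightarrow> real \<Rightarrow> ('a::euclidean_space) set \<Rightarrow> ('a \<Rightarrow> real) \<Rightarrow> ennreal" where
  "gagliardo_seminorm s p \<Omega> u =
     ennreal_powr
       (ennreal (sobolev_const DIM('a) s p) *
        (\<integral>\<^sup>+(x, y). ennreal (\<bar>u x - u y\<bar> powr p / norm (x - y) powr (real DIM('a) + s * p))
           \<partial>(lebesgue_on \<Omega> \<Otimes>\<^sub>M lebesgue_on \<Omega>)))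
       (1 / p)"

text \<open>
  The seminorm is meant for \<open>0 \<le> s \<le> 1\<close> and \<open>p \<ge> 1\<close>.
  For \<open>s = 1\<close> it is infinite if there is no weak gradient.
\<close>

definition sobolev_seminorm ::
  "real \<Rightarrow> real \<Rightarrow> ('a::euclidean_space) set \<Rightarrow> ('a \<Rightarrow> real) \<Rightarrow> ennreal" where
  "sobolev_seminorm s p \<Omega> u =
     (if s = 0 then Lp_norm p \<Omega> u
      else if s = 1 then
        (if \<exists>g. has_weak_gradient \<Omega> u g then Lp_norm p \<Omega> (weak_gradient \<Omega> u) else \<infinity>)
      else gagliardo_seminorm s p \<Omega> u)"

text \<open>
  Elements of the spaces are functions on the whole of \<open>'a\<close>, of which only the values on \<open>\<Omega>\<close>
  matter; functions that agree almost everywhere on \<open>\<Omega>\<close> are not identified but have distance \<open>0\<close>.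
\<close>

definition Lp_space :: "real \<Rightarrow> ('a::euclidean_space) set \<Rightarrow> ('a \<Rightarrow> real) set" where
  "Lp_space p \<Omega> = {u. u \<in> borel_measurable (lebesgue_on \<Omega>) \<and> Lp_norm p \<Omega> u < \<infinity>}"

definition sobolev_space ::
  "real \<Rightarrow> real \<Rightarrow> ('a::euclidean_space) set \<Rightarrow> ('a \<Rightarrow> real) set" where
  "sobolev_space s p \<Omega> = {u \<in> Lp_space p \<Omega>. sobolev_seminorm s p \<Omega> u < \<infinity>}"

definition sobolev_norm ::
  "real \<Rightarrow> real \<Rightarrow> ('a::euclidean_space) set \<Rightarrow> ('a \<Rightarrow> real) \<Rightarrow> ennreal" where
  "sobolev_norm s p \<Omega> u =
     (if s = 0 then Lp_norm p \<Omega> u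
      else ennreal_powr
             (ennreal_powr (sobolev_seminorm s p \<Omega> u) p + ennreal_powr (Lp_norm p \<Omega> u) p)
             (1 / p))"

text \<open>
  Compact embedding of a function space \<open>X\<close> with norm \<open>nX\<close> into \<open>Y\<close> with norm \<open>nY\<close>:
  inclusion, continuity of the inclusion map, and relative (sequential) compactness in \<open>Y\<close>
  of bounded subsets of \<open>X\<close>.
\<close>

definition compactly_embedded ::
  "('a \<Rightarrow> real) set \<Rightarrow> (('a \<Rightarrow> real) \<Rightarrow> ennreal) \<Rightarrow>
   ('a \<Rightarrow> real) set \<Rightarrow> (('a \<Rightarrow> real) \<Rightarrow> ennreal) \<Rightarrow> bool" where
  "compactly_embedded X nX Y nY \<longleftrightarrow>
     X \<subseteq> Y \<and>
     (\<exists>C::real. \<forall>u\<in>X. nY u \<le> ennreal C * nX u) \<and>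
     (\<forall>u :: nat \<Rightarrow> 'a \<Rightarrow> real.
        (\<forall>n. u n \<in> X) \<and> (\<exists>B::real. \<forall>n. nX (u n) \<le> ennreal B) \<longrightarrow>
        (\<exists>v\<in>Y. \<exists>r :: nat \<Rightarrow> nat. strict_mono r \<and>
           (\<lambda>n. nY (\<lambda>x. u (r n) x - v x)) \<longlonglongrightarrow> 0))"

text \<open>
  Near each boundary point, after a rotation taking the last coordinate axis to the unit
  vector \<open>e\<close>, the set is the strict epigraph of a Lipschitz function \<open>h\<close> of the
  remaining coordinates, that is, of a function on the hyperplane orthogonal to \<open>e\<close>.
\<close>

definition lipschitz_boundary :: "('a::euclidean_space) set \<Rightarrow> bool" where
  "lipschitz_boundary \<Omega> \<longleftrightarrow>
     (\<forall>x\<in>frontier \<Omega>. \<exists>r>0. \<exists>e h L.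
        norm e = 1 \<and> L-lipschitz_on {z. z \<bullet> e = 0} h \<and>
        \<Omega> \<inter> ball x r = {y \<in> ball x r. h (y - (y \<bullet> e) *\<^sub>R e) < y \<bullet> e})"

definition interpolation_curve :: "real \<Rightarrow> real \<Rightarrow> real \<Rightarrow> real \<Rightarrow> real \<Rightarrow> real \<times> real" where
  "interpolation_curve s p s' p' \<theta> =
     (\<theta> * s' + (1 - \<theta>) * s, p * p' / (p' + \<theta> * (p - p')))"

end

theory Submission
  imports Defs "HOL-Complex_Analysis.Great_Picard"
begin

text \<open>
  All embeddings in question are strictly subcritical: \<open>t < s\<close> and \<open>N / p - s < N / q - t\<close>, where
  \<open>(s, p)\<close> is the source and \<open>(t, q)\<close> the target; along the curve \<open>s\<^sub>\<theta>\<close> and \<open>N / p\<^sub>\<theta>\<close> are affine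
  in \<open>\<theta>\<close>, so the second inequality is inherited by any two of its points.

  For \<open>s < 1\<close> no extension operator is needed. The uniform cone property of a Lipschitz domain
  bounds the measure of \<open>\<Omega> \<inter> ball x r\<close> from below by a multiple of \<open>r\<^sup>N\<close>, and averaging over such balls
  turns a bound on the \<open>L\<^sup>Q\<close> norm into one on the \<open>L\<^sup>q\<close> norm with \<open>q = p * (1 + s * Q / N)\<close>; iteration
  reaches every exponent below \<open>N * p / (N - s * p)\<close>. Averaging over the balls of a finite cover also
  gives compactness in \<open>L\<^sup>1\<close>. Young's inequality, applied to the Gagliardo kernels pointwise, yields
  an Ehrling inequality: the \<open>(t, q)\<close> energy is at most a small multiple of the \<open>(s, p)\<close> energy plus
  a large multiple of the \<open>L\<^sup>1\<close> norm. Together with Fatou's lemma this gives compactness, and by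
  homogeneity continuity.

  For \<open>s = 1\<close> the weak gradient controls a Gagliardo seminorm of some order \<open>\<tau> < 1\<close>: testing with
  smooth bumps shows that \<open>u (x + v) - u x\<close> is a line integral of the gradient for almost every \<open>x\<close>,
  and in a domain with the cone property any two nearby points are joined by two segments inside it.
\<close>

section \<open>The cone property\<close>

text \<open>Source and target exponents differ, so the inequalities between energies are not
  homogeneous. They are therefore stated for integrals of powers (\<open>mass\<close>,
  \<open>gagliardo\<close>), as bounds that follow from bounds; norms return only in
  \<open>compactly_embedded_subcritical\<close>, where rescaling a function to energy 1 restores
  homogeneity. Room for compactness comes from an open condition: the weight a in Young's inequality
  may be any number slightly above \<open>t * q / (s * p)\<close>. Exceeding this value makes the
  leftover kernel \<open>norm (x - y) powr (\<eta> - N)\<close> integrable, and strict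
  subcriticality keeps the leftover power of u below the critical exponent, so that its integral is
  bounded. For order 1 the same room permits replacing 1 by some \<open>\<tau> < 1\<close> with p
  unchanged.\<close>

definition uniform_cone :: "('a::euclidean_space) set \<Rightarrow> real \<Rightarrow> real \<Rightarrow> 'a set \<Rightarrow> bool" where
  "uniform_cone \<Omega> \<rho> \<epsilon> F \<longleftrightarrow> 0 < \<rho> \<and> 0 < \<epsilon> \<and> \<epsilon> \<le> 1 \<and> finite F \<and> (\<forall>e\<in>F. norm e = 1) \<and>
     (\<forall>x\<in>\<Omega>. \<exists>e\<in>F. \<forall>y\<in>\<Omega> \<inter> ball x \<rho>. \<forall>t v.
        norm (v - t *\<^sub>R e) < \<epsilon> * t \<and> norm v < \<rho> \<longrightarrow> y + v \<in> \<Omega>)"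

text \<open>At a boundary point write \<open>v = t *\<^sub>R e + w\<close>. The height rises by at
  least \<open>t - norm w\<close>, the Lipschitz graph by at most \<open>2 * L * norm w\<close>; the
  aperture \<open>1 / (1 + 2 * L)\<close> balances the two. Halving the radius keeps
  \<open>y + v\<close> in the chart. Around a point of \<Omega> there is a whole ball, and any unit
  vector serves.\<close>

lemma local_cone:
  fixes \<Omega> :: "('a::euclidean_space) set"
  assumes "open \<Omega>" "lipschitz_boundary \<Omega>" "c \<in> closure \<Omega>"
  shows "\<exists>r \<epsilon> e. 0 < r \<and> 0 < \<epsilon> \<and> norm e = 1 \<and>
    (\<forall>y\<in>\<Omega> \<inter> ball c r. \<forall>t v. norm (v - t *\<^sub>R e) < \<epsilon> * t \<and> norm v < r \<longrightarrow> y + v \<in> \<Omega>)"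
proof (cases "c \<in> \<Omega>")
  case True
  then obtain r where r: "r > 0" "ball c r \<subseteq> \<Omega>"
    using assms(1) open_contains_ball by blast
  obtain e :: 'a where e: "e \<in> Basis" using nonempty_Basis by blast
  have "y + v \<in> \<Omega>" if "y \<in> ball c (r / 2)" "norm v < r / 2" for y v
  proof -
    have "dist c (y + v) \<le> dist c y + norm v"
      by (metis add_diff_cancel_left' dist_norm dist_triangle norm_minus_commute)
    with that r show ?thesis by (auto simp: subset_iff)
  qed
  then show ?thesis
    using r e by (intro exI[of _ "r / 2"] exI[of _ 1] exI[of _ e]) auto
next
  case False
  then have "c \<in> frontier \<Omega>"
    using assms by (simp add: frontier_def interior_open)
  then obtain r e h L where r: "r > 0" and e: "norm e = 1"
    and L: "L-lipschitz_on {z. z \<bullet> e = 0} h"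
    and eq: "\<Omega> \<inter> ball c r = {y \<in> ball c r. h (y - (y \<bullet> e) *\<^sub>R e) < y \<bullet> e}"
    using assms(2) unfolding lipschitz_boundary_def by blast
  have L0: "0 \<le> L" using L lipschitz_on_nonneg by blast
  have ee: "e \<bullet> e = 1" using e by (simp add: norm_eq_1)
  have "y + v \<in> \<Omega>" if y: "y \<in> \<Omega>" "y \<in> ball c (r / 2)"
    and v: "norm (v - t *\<^sub>R e) < 1 / (1 + 2 * L) * t" "norm v < r / 2" for y v t
  proof -
    define w where "w = v - t *\<^sub>R e"
    have vw: "v = t *\<^sub>R e + w" by (simp add: w_def)
    have "dist c (y + v) \<le> dist c y + norm v"
      by (metis add_diff_cancel_left' dist_norm dist_triangle norm_minus_commute)
    then have yv: "y + v \<in> ball c r" using that by simp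
    have y': "y \<in> ball c r" using y(2) r by simp
    have hy: "h (y - (y \<bullet> e) *\<^sub>R e) < y \<bullet> e" using eq y(1) y' by blast
    have abw: "\<bar>w \<bullet> e\<bar> \<le> norm w" using Cauchy_Schwarz_ineq2[of w e] e by simp
    have pw: "norm (w - (w \<bullet> e) *\<^sub>R e) \<le> 2 * norm w"
      using norm_triangle_ineq4[of w "(w \<bullet> e) *\<^sub>R e"] abw e by simp
    have "dist (h (y + v - ((y + v) \<bullet> e) *\<^sub>R e)) (h (y - (y \<bullet> e) *\<^sub>R e))
       \<le> L * dist (y + v - ((y + v) \<bullet> e) *\<^sub>R e) (y - (y \<bullet> e) *\<^sub>R e)"
      by (rule lipschitz_onD[OF L]) (auto simp: inner_diff_left ee)
    also have "dist (y + v - ((y + v) \<bullet> e) *\<^sub>R e) (y - (y \<bullet> e) *\<^sub>R e) = norm (w - (w \<bullet> e) *\<^sub>R e)"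
      unfolding dist_norm vw by (simp add: algebra_simps ee)
    also have "L * \<dots> \<le> L * (2 * norm w)"
      using pw L0 by (rule mult_left_mono)
    finally have "h (y + v - ((y + v) \<bullet> e) *\<^sub>R e) \<le> h (y - (y \<bullet> e) *\<^sub>R e) + 2 * L * norm w"
      by (simp add: dist_real_def)
    moreover have "(1 + 2 * L) * norm w \<le> t"
    proof -
      have "norm w < t / (1 + 2 * L)" using v(1) by (simp add: w_def)
      then show ?thesis using L0 by (simp add: pos_less_divide_eq mult.commute less_imp_le)
    qed
    moreover have "(y + v) \<bullet> e = y \<bullet> e + t + w \<bullet> e" by (simp add: vw algebra_simps ee)
    ultimately have "h (y + v - ((y + v) \<bullet> e) *\<^sub>R e) < (y + v) \<bullet> e"
      using hy abw by (simp add: algebra_simps)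
    with eq yv show ?thesis by blast
  qed
  then show ?thesis
    using r e L0 by (intro exI[of _ "r / 2"] exI[of _ "1 / (1 + 2 * L)"] exI[of _ e]) auto
qed

text \<open>Finitely many charts at half radius cover the compact closure, so the ball of radius
  \<rho> about any point of \<Omega> lies in a single full chart. Hence one direction serves every y
  near x, which later lets two nearby points be moved along the same vector. The whole closure is
  covered, so that interior points get a direction too.\<close>

lemma lipschitz_boundary_imp_uniform_cone:
  fixes \<Omega> :: "('a::euclidean_space) set"
  assumes "open \<Omega>" "bounded \<Omega>" "lipschitz_boundary \<Omega>"
  shows "\<exists>\<rho> \<epsilon> F. uniform_cone \<Omega> \<rho> \<epsilon> F"
proof -
  have "\<forall>c\<in>closure \<Omega>. \<exists>r \<epsilon> e. 0 < r \<and> 0 < \<epsilon> \<and> norm e = 1 \<and>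
    (\<forall>y\<in>\<Omega> \<inter> ball c r. \<forall>t v. norm (v - t *\<^sub>R e) < \<epsilon> * t \<and> norm v < r \<longrightarrow> y + v \<in> \<Omega>)"
    using local_cone[OF assms(1,3)] by blast
  then obtain r \<epsilon> e where H: "\<And>c. c \<in> closure \<Omega> \<Longrightarrow> 0 < r c \<and> 0 < \<epsilon> c \<and> norm (e c) = 1 \<and>
    (\<forall>y\<in>\<Omega> \<inter> ball c (r c). \<forall>t v. norm (v - t *\<^sub>R e c) < \<epsilon> c * t \<and> norm v < r c \<longrightarrow> y + v \<in> \<Omega>)"
    by metis
  have "compact (closure \<Omega>)" using assms(2) by simp
  moreover have "closure \<Omega> \<subseteq> (\<Union>c\<in>closure \<Omega>. ball c (r c / 2))"
    using H by fastforce
  ultimately obtain C where C: "C \<subseteq> closure \<Omega>" "finite C" "closure \<Omega> \<subseteq> (\<Union>c\<in>C. ball c (r c / 2))"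
    using compactE_image[of "closure \<Omega>" "closure \<Omega>" "\<lambda>c. ball c (r c / 2)"] by auto
  \<comment> \<open>The inserted 1 makes \<open>Min\<close> meaningful for an empty \<open>C\<close>
    and gives \<open>\<eta> \<le> 1\<close>, as \<open>uniform_cone\<close> demands.\<close>
  define \<rho> where "\<rho> = Min (insert 1 ((\<lambda>c. r c / 2) ` C))"
  define \<eta> where "\<eta> = Min (insert 1 (\<epsilon> ` C))"
  have \<rho>: "\<rho> > 0" "\<And>c. c \<in> C \<Longrightarrow> \<rho> \<le> r c / 2"
  proof -
    show "\<rho> > 0" unfolding \<rho>_def using C H by (auto simp: subset_iff)
    show "\<rho> \<le> r c / 2" if "c \<in> C" for c
      unfolding \<rho>_def using C that by (intro Min_le) auto
  qed
  have \<eta>: "\<eta> > 0" "\<eta> \<le> 1" "\<And>c. c \<in> C \<Longrightarrow> \<eta> \<le> \<epsilon> c"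
  proof -
    show "\<eta> > 0" unfolding \<eta>_def using C H by (auto simp: subset_iff)
    show "\<eta> \<le> 1" unfolding \<eta>_def using C by simp
    show "\<eta> \<le> \<epsilon> c" if "c \<in> C" for c
      unfolding \<eta>_def using C that by (intro Min_le) auto
  qed
  have "\<exists>e\<in>e ` C. \<forall>y\<in>\<Omega> \<inter> ball x \<rho>. \<forall>t v.
        norm (v - t *\<^sub>R e) < \<eta> * t \<and> norm v < \<rho> \<longrightarrow> y + v \<in> \<Omega>" if x: "x \<in> \<Omega>" for x
  proof -
    obtain c where c: "c \<in> C" "x \<in> ball c (r c / 2)"
      using x C closure_subset by blast
    have cc: "c \<in> closure \<Omega>" using c C by blast
    have "y + v \<in> \<Omega>" if "y \<in> \<Omega> \<inter> ball x \<rho>" "norm (v - t *\<^sub>R e c) < \<eta> * t" "norm v < \<rho>" for y t v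
    proof -
      have "dist c y \<le> dist c x + dist x y" by (rule dist_triangle)
      then have 1: "y \<in> \<Omega> \<inter> ball c (r c)" using that c \<rho>(2)[OF c(1)] by auto
      have "0 < \<eta> * t" using that(2) norm_ge_zero le_less_trans by blast
      then have "0 < t" using \<eta>(1) by (simp add: zero_less_mult_iff)
      then have "\<eta> * t \<le> \<epsilon> c * t" using \<eta>(3)[OF c(1)] by (simp add: mult_right_mono)
      then have 2: "norm (v - t *\<^sub>R e c) < \<epsilon> c * t" using that(2) by linarith
      have "norm v < r c" using that(3) \<rho>(2)[OF c(1)] \<rho>(1) by linarith
      with 1 2 H[OF cc] show ?thesis by blast
    qed
    with c show ?thesis by blast
  qed
  then have "uniform_cone \<Omega> \<rho> \<eta> (e ` C)"
    unfolding uniform_cone_def using \<rho> \<eta> C H by (auto simp: subset_iff)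
  then show ?thesis by blast
qed

text \<open>The cone at x contains the ball about \<open>x + t *\<^sub>R e\<close> of radius
  \<open>\<epsilon> * t\<close>. Taking t proportional to r places it inside
  \<open>ball x r\<close>, and its volume is a multiple of \<open>r ^ DIM('a)\<close>.\<close>

lemma uniform_cone_measure_density:
  fixes \<Omega> :: "('a::euclidean_space) set"
  assumes "uniform_cone \<Omega> \<rho> \<epsilon> F" "open \<Omega>"
  shows "\<exists>c>0. \<forall>x\<in>\<Omega>. \<forall>r. 0 < r \<and> r \<le> 1 \<longrightarrow>
     ennreal (c * r ^ DIM('a)) \<le> emeasure lborel (\<Omega> \<inter> ball x r)"
proof -
  have \<rho>: "0 < \<rho>" and \<epsilon>: "0 < \<epsilon>" "\<epsilon> \<le> 1" using assms(1) unfolding uniform_cone_def by auto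
  \<comment> \<open>Points of the inscribed ball satisfy \<open>norm v < 2 * t\<close>. With
    \<open>t = m * r\<close> and \<open>r \<le> 1\<close> this choice gives both
    \<open>norm v < r\<close> and \<open>norm v < \<rho>\<close>.\<close>
  define m where "m = min 1 \<rho> / 2"
  have m: "0 < m" "m \<le> 1 / 2" "2 * m \<le> \<rho>" using \<rho> by (auto simp: m_def)
  define c where "c = unit_ball_vol (real DIM('a)) * (\<epsilon> * m) ^ DIM('a)"
  have "c > 0" unfolding c_def using \<epsilon> m by (intro mult_pos_pos zero_less_power unit_ball_vol_pos) auto
  moreover have "ennreal (c * r ^ DIM('a)) \<le> emeasure lborel (\<Omega> \<inter> ball x r)"
    if x: "x \<in> \<Omega>" and r: "0 < r" "r \<le> 1" for x r
  proof -
    obtain e where e: "e \<in> F" "norm e = 1" and E: "\<And>t v. norm (v - t *\<^sub>R e) < \<epsilon> * t \<and> norm v < \<rho> \<Longrightarrow> x + v \<in> \<Omega>"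
      using assms(1) x \<rho> unfolding uniform_cone_def by (metis IntI centre_in_ball)
    define t where "t = m * r"
    have t: "0 < t" "2 * t \<le> r" "2 * t \<le> \<rho>"
    proof -
      show "0 < t" using m r by (simp add: t_def)
      show "2 * t \<le> r" using m r mult_right_mono[of "2 * m" 1 r] by (simp add: t_def)
      show "2 * t \<le> \<rho>" using m r mult_left_mono[of r 1 m] unfolding t_def by linarith
    qed
    have "ball (x + t *\<^sub>R e) (\<epsilon> * t) \<subseteq> \<Omega> \<inter> ball x r"
    proof
      fix z assume z: "z \<in> ball (x + t *\<^sub>R e) (\<epsilon> * t)"
      define v where "v = z - x"
      have n: "norm (v - t *\<^sub>R e) < \<epsilon> * t"
        using z by (simp add: v_def dist_norm norm_minus_commute algebra_simps)
      have "norm v \<le> norm (v - t *\<^sub>R e) + norm (t *\<^sub>R e)"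
        by (metis diff_add_cancel norm_triangle_ineq)
      also have "\<dots> < 2 * t"
      proof -
        have "\<epsilon> * t \<le> 1 * t" using \<epsilon> t by (intro mult_right_mono) auto
        with n have "norm (v - t *\<^sub>R e) < t" by linarith
        with e t show ?thesis by simp
      qed
      finally have "norm v < 2 * t" .
      then have "x + v \<in> \<Omega>" "norm v < r" using E[of v t] n t by auto
      then show "z \<in> \<Omega> \<inter> ball x r" by (simp add: v_def dist_norm norm_minus_commute)
    qed
    then have "emeasure lborel (ball (x + t *\<^sub>R e) (\<epsilon> * t)) \<le> emeasure lborel (\<Omega> \<inter> ball x r)"
      using assms(2) by (intro emeasure_mono) auto
    moreover have "emeasure lborel (ball (x + t *\<^sub>R e) (\<epsilon> * t)) = ennreal (c * r ^ DIM('a))"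
      using t \<epsilon> by (subst emeasure_ball) (auto simp: c_def t_def power_mult_distrib mult_ac)
    ultimately show ?thesis by simp
  qed
  ultimately show ?thesis by blast
qed

section \<open>Elementary inequalities and a radial integral\<close>

text \<open>Dyadic decomposition: on the shell \<open>r k / 2 \<le> norm h < r k\<close> the
  integrand is at most \<open>c k\<close>. Enlarging the shells to balls, the volumes make the sum
  geometric with ratio \<open>2 powr (- (a + DIM('a)))\<close>, which is below 1 by the assumption
  on a.\<close>

lemma radial_integral_finite:
  assumes "- real DIM('a) < a"
  shows "(\<integral>\<^sup>+h. ennreal (norm (h::'a::euclidean_space) powr a) * indicator (ball 0 R) h \<partial>lborel) < \<infinity>"
proof (cases "R > 0")
  case False
  then show ?thesis by (simp add: ball_empty)
next
  case R: True
  define r where "r k = R / 2 ^ k" for k :: nat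
  have r: "r k > 0" for k using R by (simp add: r_def)
  \<comment> \<open>The factor \<open>2 powr \<bar>a\<bar>\<close> covers both signs of
    \<open>a\<close>: for negative \<open>a\<close> the maximum on a shell sits at its inner
    radius.\<close>
  define c where "c k = 2 powr \<bar>a\<bar> * r k powr a" for k
  have bound: "ennreal (norm h powr a) * indicator (ball 0 R) h \<le> (\<Sum>k. ennreal (c k) * indicator (ball 0 (r k)) h)"
    for h :: 'a
  proof (cases "h \<noteq> 0 \<and> norm h < R")
    \<comment> \<open>At \<open>h = 0\<close> the integrand is 0 because
      \<open>0 powr a = 0\<close>.\<close>
    case False
    then show ?thesis by auto
  next
    case h: True
    have "(\<lambda>k. R * (1/2) ^ k) \<longlonglongrightarrow> R * 0"
      by (intro tendsto_intros LIMSEQ_power_zero) auto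
    then have "eventually (\<lambda>k. R * (1/2) ^ k < norm h) sequentially"
      using h by (intro order_tendstoD(2)[of _ "R * 0"]) auto
    then obtain k0 where k0: "r k0 < norm h"
      by (auto simp: eventually_sequentially r_def power_divide)
    \<comment> \<open>\<open>r k\<close> is the first radius not exceeding \<open>norm h\<close>, so
      the predecessor \<open>j\<close> satisfies \<open>r j / 2 \<le> norm h < r j\<close>; it
      exists because \<open>norm h < R = r 0\<close>.\<close>
    define k where "k = (LEAST k. r k \<le> norm h)"
    have k1: "r k \<le> norm h" unfolding k_def by (rule LeastI[of _ k0]) (use k0 in simp)
    have "k \<noteq> 0" using k1 h by (intro notI) (auto simp: r_def)
    then obtain j where j: "k = Suc j" by (cases k) auto
    have k2: "norm h < r j" using not_less_Least[of j "\<lambda>k. r k \<le> norm h"] j k_def by simp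
    have k3: "r j \<le> 2 * norm h" using k1 by (simp add: j r_def)
    have "norm h powr a \<le> c j"
    proof (cases "a \<ge> 0")
      case True
      then have "norm h powr a \<le> 1 * r j powr a" using k2 by (simp add: powr_mono2)
      also have "\<dots> \<le> c j" unfolding c_def by (intro mult_right_mono) (auto intro: ge_one_powr_ge_zero)
      finally show ?thesis .
    next
      case False
      have "norm h powr a \<le> (r j / 2) powr a" using False k3 h r[of j] by (intro powr_mono2') auto
      also have "\<dots> = c j" using False r[of j] by (simp add: c_def powr_divide powr_minus_divide)
      finally show ?thesis .
    qed
    then have "ennreal (norm h powr a) * indicator (ball 0 R) h \<le> ennreal (c j) * indicator (ball 0 (r j)) h"
      using k2 by (auto simp: indicator_def ennreal_leI)
    also have "\<dots> \<le> (\<Sum>k. ennreal (c k) * indicator (ball 0 (r k)) h)"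
    proof -
      define f where "f k = ennreal (c k) * indicator (ball 0 (r k)) h" for k
      have "sum f {j} \<le> suminf f" by (rule sum_le_suminf) auto
      then have "f j \<le> suminf f" by simp
      then show ?thesis unfolding f_def[abs_def] .
    qed
    finally show ?thesis .
  qed
  define V where "V = unit_ball_vol (real DIM('a))"
  have V: "V > 0" by (simp add: V_def)
  define q where "q = 2 powr (- (a + real DIM('a)))"
  have q: "0 < q" "q < 1" using assms by (auto simp: q_def powr_less_one)
  have I: "c k * (V * r k ^ DIM('a)) = 2 powr \<bar>a\<bar> * V * R powr (a + real DIM('a)) * q ^ k" for k
  proof -
    have "c k * (V * r k ^ DIM('a)) = 2 powr \<bar>a\<bar> * V * (r k powr (a + real DIM('a)))"
      using r[of k] by (simp add: c_def powr_add powr_realpow)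
    also have "r k powr (a + real DIM('a)) = R powr (a + real DIM('a)) * q ^ k"
    proof -
      have "r k = R * 2 powr (- real k)" by (simp add: r_def powr_minus_divide powr_realpow)
      then have "r k powr (a + real DIM('a)) = R powr (a + real DIM('a)) * (2 powr (- real k)) powr (a + real DIM('a))"
        using R by (simp add: powr_mult)
      also have "(2 powr (- real k)) powr (a + real DIM('a)) = q powr real k"
        unfolding q_def powr_powr by (simp add: algebra_simps)
      also have "\<dots> = q ^ k" using q by (simp add: powr_realpow)
      finally show ?thesis .
    qed
    finally show ?thesis by (simp add: mult_ac)
  qed
  have "(\<integral>\<^sup>+h. ennreal (norm h powr a) * indicator (ball (0::'a) R) h \<partial>lborel)
      \<le> (\<integral>\<^sup>+h. (\<Sum>k. ennreal (c k) * indicator (ball (0::'a) (r k)) h) \<partial>lborel)"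
    by (intro nn_integral_mono bound)
  also have "\<dots> = (\<Sum>k. (\<integral>\<^sup>+h. ennreal (c k) * indicator (ball (0::'a) (r k)) h \<partial>lborel))"
    by (intro nn_integral_suminf borel_measurable_times_ennreal borel_measurable_indicator) auto
  also have "\<dots> = (\<Sum>k. ennreal (c k * (V * r k ^ DIM('a))))"
  proof (rule suminf_cong)
    fix k
    have "(\<integral>\<^sup>+h. ennreal (c k) * indicator (ball (0::'a) (r k)) h \<partial>lborel) = ennreal (c k) * emeasure lborel (ball (0::'a) (r k))"
      by (rule nn_integral_cmult_indicator) simp
    also have "\<dots> = ennreal (c k) * ennreal (V * r k ^ DIM('a))"
      using r[of k] by (simp add: emeasure_ball V_def less_imp_le)
    also have "\<dots> = ennreal (c k * (V * r k ^ DIM('a)))"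
      using r[of k] V by (intro ennreal_mult[symmetric]) (auto simp: c_def less_imp_le)
    finally show "(\<integral>\<^sup>+h. ennreal (c k) * indicator (ball (0::'a) (r k)) h \<partial>lborel) = ennreal (c k * (V * r k ^ DIM('a)))" .
  qed
  also have "\<dots> < \<infinity>"
  proof -
    have "summable (\<lambda>k. c k * (V * r k ^ DIM('a)))"
      unfolding I using q by (intro summable_mult summable_geometric) auto
    then show ?thesis
      using V r by (subst suminf_ennreal2) (auto simp: c_def less_imp_le)
  qed
  finally show ?thesis .
qed

lemma abs_diff_powr_le:
  fixes a b q :: real
  assumes "0 < q"
  shows "\<bar>a - b\<bar> powr q \<le> 2 powr q * (\<bar>a\<bar> powr q + \<bar>b\<bar> powr q)"
proof -
  have "\<bar>a - b\<bar> powr q \<le> (2 * max \<bar>a\<bar> \<bar>b\<bar>) powr q"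
    using assms by (intro powr_mono2) auto
  also have "\<dots> = 2 powr q * (max \<bar>a\<bar> \<bar>b\<bar>) powr q" by (simp add: powr_mult)
  also have "\<dots> \<le> 2 powr q * (\<bar>a\<bar> powr q + \<bar>b\<bar> powr q)"
    by (intro mult_left_mono) (auto simp: max_def)
  finally show ?thesis .
qed

text \<open>Small z are paid by the constant, large z by the higher power, and in between
  \<open>z powr Q\<close> is at most a fixed multiple of z. This is the scalar source of the Ehrling
  inequalities.\<close>

lemma powr_three_terms:
  fixes Q Q1 \<epsilon> :: real
  assumes "0 < Q" "Q < Q1" "0 < \<epsilon>"
  shows "\<exists>K>0. \<forall>z\<ge>0. z powr Q \<le> \<epsilon> + \<epsilon> * z powr Q1 + K * z"
proof -
  define \<delta> where "\<delta> = \<epsilon> powr (1 / Q)"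
  define R where "R = (1 / \<epsilon>) powr (1 / (Q1 - Q))"
  have pos: "\<delta> > 0" "R > 0" using assms by (auto simp: \<delta>_def R_def)
  \<comment> \<open>\<open>Q\<close> may lie below 1, so \<open>z powr (Q - 1)\<close> between
    \<open>\<delta>\<close> and \<open>R\<close> can peak at either end.\<close>
  define K where "K = max (\<delta> powr (Q - 1)) (R powr (Q - 1)) + 1"
  have K: "K > 0" by (auto simp: K_def max_def intro!: add_nonneg_pos)
  have "z powr Q \<le> \<epsilon> + \<epsilon> * z powr Q1 + K * z" if z: "z \<ge> 0" for z
  proof -
    consider "z \<le> \<delta>" | "z > \<delta>" "z \<ge> R" | "z > \<delta>" "z < R" by linarith
    then show ?thesis
    proof cases
      case 1
      then have "z powr Q \<le> \<delta> powr Q" using z assms by (intro powr_mono2) auto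
      also have "\<dots> = \<epsilon>" using assms by (simp add: \<delta>_def powr_powr)
      finally have "z powr Q \<le> \<epsilon>" .
      moreover have "0 \<le> \<epsilon> * z powr Q1" "0 \<le> K * z" using z assms K by auto
      ultimately show ?thesis by linarith
    next
      case 2
      have "z powr Q1 = z powr (Q1 - Q) * z powr Q" using 2 pos by (simp flip: powr_add)
      moreover have "z powr (Q1 - Q) \<ge> R powr (Q1 - Q)"
        using 2 pos assms by (intro powr_mono2) auto
      moreover have "R powr (Q1 - Q) = 1 / \<epsilon>" using assms by (simp add: R_def powr_powr)
      ultimately have "1 / \<epsilon> * z powr Q \<le> z powr Q1" by (metis mult_right_mono powr_ge_zero)
      then have "z powr Q \<le> \<epsilon> * z powr Q1" using assms by (simp add: field_simps)
      moreover have "0 \<le> K * z" using z K by auto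
      ultimately show ?thesis using assms by linarith
    next
      case 3
      have zp: "z > 0" using 3 pos by simp
      have "z powr Q = z powr (Q - 1) * z" using zp by (simp add: powr_diff)
      moreover have "z powr (Q - 1) \<le> K"
      proof (cases "Q \<ge> 1")
        case True
        then have "z powr (Q - 1) \<le> R powr (Q - 1)" using 3 zp by (intro powr_mono2) auto
        then show ?thesis by (simp add: K_def)
      next
        case False
        then have "z powr (Q - 1) \<le> \<delta> powr (Q - 1)" using 3 pos by (intro powr_mono2') auto
        then show ?thesis by (simp add: K_def)
      qed
      ultimately have "z powr Q \<le> K * z" using zp by (simp add: mult_right_mono)
      moreover have "0 \<le> \<epsilon> * z powr Q1" using assms by auto
      ultimately show ?thesis using assms by linarith
    qed
  qed
  with K show ?thesis by blast
qed

section \<open>Smooth bumps on boxes\<close>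

text \<open>\<open>flat 1\<close> is the classical function e^(-1/t) extended by 0. The polynomial
  in 1/t is carried along because this larger family is closed under differentiation, so that one
  induction reaches all derivatives.\<close>

definition flat :: "real poly \<Rightarrow> real \<Rightarrow> real" where
  "flat P t = (if t > 0 then poly P (1 / t) * exp (- (1 / t)) else 0)"

lemma poly_times_exp_tendsto_0: "((\<lambda>y::real. poly P y * exp (- y)) \<longlongrightarrow> 0) at_top"
proof -
  have "((\<lambda>y::real. \<Sum>i\<le>degree P. coeff P i * (y ^ i / exp y)) \<longlongrightarrow> (\<Sum>i\<le>degree P. coeff P i * 0)) at_top"
    by (intro tendsto_sum tendsto_mult tendsto_const tendsto_power_div_exp_0)
  moreover have "(\<Sum>i\<le>degree P. coeff P i * (y ^ i / exp y)) = poly P y * exp (- y)" for y :: real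
    by (simp add: poly_altdef sum_distrib_right exp_minus divide_inverse mult.assoc)
  ultimately show ?thesis by simp
qed

text \<open>With y = 1/t, the derivative of P(y) e^(-y) in t is y^2 (P(y) - P'(y)) e^(-y), and
  \<open>[:0, 0, 1:]\<close> is y^2. At 0 the right difference quotient is y P(y) e^(-y) with y
  tending to infinity.\<close>

lemma flat_has_derivative:
  "(flat P has_real_derivative flat ([:0, 0, 1:] * (P - pderiv P)) t) (at t)"
proof -
  consider "t > 0" | "t < 0" | "t = 0" by linarith
  then show ?thesis
  proof cases
    case 1
    have "((\<lambda>t. poly P (1 / t) * exp (- (1 / t))) has_real_derivative
        flat ([:0, 0, 1:] * (P - pderiv P)) t) (at t)"
      using 1
      by (auto intro!: derivative_eq_intros simp: flat_def field_simps power2_eq_square)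
    then show ?thesis
      by (rule has_field_derivative_transform_within_open[of _ _ _ "{0<..}"])
         (use 1 in \<open>auto simp: flat_def\<close>)
  next
    case 2
    have "((\<lambda>t::real. 0) has_real_derivative flat ([:0, 0, 1:] * (P - pderiv P)) t) (at t)"
      using 2 by (auto simp: flat_def)
    then show ?thesis
      by (rule has_field_derivative_transform_within_open[of _ _ _ "{..<0}"])
         (use 2 in \<open>auto simp: flat_def\<close>)
  next
    case 3
    have r: "((\<lambda>h. flat P h / h) \<longlongrightarrow> 0) (at_right 0)"
    proof -
      have "((\<lambda>h. poly ([:0, 1:] * P) (inverse h) * exp (- inverse h)) \<longlongrightarrow> 0) (at_right (0::real))"
        by (rule filterlim_compose[OF poly_times_exp_tendsto_0 filterlim_inverse_at_top_right])
      then show ?thesis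
        by (rule tendsto_cong[THEN iffD1, rotated])
           (auto simp: eventually_at_filter flat_def divide_inverse)
    qed
    have l: "((\<lambda>h. flat P h / h) \<longlongrightarrow> 0) (at_left 0)"
      by (rule tendsto_cong[THEN iffD1, OF _ tendsto_const])
         (auto simp: eventually_at_filter flat_def)
    have "((\<lambda>h. flat P h / h) \<longlongrightarrow> 0) (at 0)"
      using l r by (simp add: filterlim_split_at)
    then show ?thesis
      using 3 by (simp add: has_field_derivative_iff flat_def)
  qed
qed

lemma flat_cont: "continuous_on UNIV (flat P)"
  using flat_has_derivative by (intro continuous_at_imp_continuous_on ballI DERIV_isCont) auto

section \<open>Closure properties of k times continuously differentiable functions\<close>

lemma Ck_function_Suc_lower: "Ck_function (Suc k) f \<Longrightarrow> Ck_function k f"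
proof (induction k arbitrary: f)
  case 0
  then show ?case
    by (auto intro!: continuous_at_imp_continuous_on differentiable_imp_continuous_within)
next
  case (Suc k)
  then show ?case by (metis Ck_function.simps(2))
qed

lemma Ck_function_const: "Ck_function k (\<lambda>x. c)"
proof (induction k arbitrary: c)
  case (Suc k)
  have "frechet_derivative (\<lambda>x::'a. c) (at x) = (\<lambda>h. 0)" for x
    by (rule frechet_derivative_at[symmetric]) simp
  then show ?case using Suc by simp
qed simp

lemma Ck_function_add: "Ck_function k f \<Longrightarrow> Ck_function k g \<Longrightarrow> Ck_function k (\<lambda>x. f x + g x)"
proof (induction k arbitrary: f g)
  case (Suc k)
  have "frechet_derivative (\<lambda>x. f x + g x) (at x) =
      (\<lambda>h. frechet_derivative f (at x) h + frechet_derivative g (at x) h)" for x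
    by (rule frechet_derivative_at[symmetric])
       (use Suc.prems in \<open>auto intro!: has_derivative_add simp: frechet_derivative_works\<close>)
  then show ?case using Suc by simp
qed (auto intro: continuous_on_add)

lemma Ck_function_mult: "Ck_function k f \<Longrightarrow> Ck_function k g \<Longrightarrow> Ck_function k (\<lambda>x. f x * g x)"
proof (induction k arbitrary: f g)
  case (Suc k)
  have "frechet_derivative (\<lambda>x. f x * g x) (at x) =
      (\<lambda>h. f x * frechet_derivative g (at x) h + frechet_derivative f (at x) h * g x)" for x
    by (rule frechet_derivative_at[symmetric])
       (use Suc.prems in \<open>auto intro!: has_derivative_mult simp: frechet_derivative_works\<close>)
  moreover have "Ck_function k f" "Ck_function k g"
    using Suc.prems Ck_function_Suc_lower by blast+
  ultimately show ?case using Suc by (auto intro!: Ck_function_add)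
qed (auto intro: continuous_on_mult)

lemma Ck_function_prod:
  "finite I \<Longrightarrow> (\<And>i. i \<in> I \<Longrightarrow> Ck_function k (f i)) \<Longrightarrow> Ck_function k (\<lambda>x. \<Prod>i\<in>I. f i x)"
  by (induction I rule: finite_induct) (auto intro: Ck_function_const Ck_function_mult)

text \<open>The polynomial is generalised in the induction on k because each derivative replaces it
  by another one.\<close>

lemma Ck_function_flat: "Ck_function k (\<lambda>x::'a::euclidean_space. flat P (c * (x \<bullet> i) + d))"
proof (induction k arbitrary: P)
  case 0
  have "continuous_on UNIV (\<lambda>x::'a. c * (x \<bullet> i) + d)" by (intro continuous_intros)
  from continuous_on_compose2[OF flat_cont this] show ?case by simp
next
  case (Suc k)
  define Q where "Q = [:0, 0, 1:] * (P - pderiv P)"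
  have D: "((\<lambda>x::'a. flat P (c * (x \<bullet> i) + d)) has_derivative
      (\<lambda>h. flat Q (c * (x \<bullet> i) + d) * (c * (h \<bullet> i)))) (at x)" for x
  proof -
    have "((\<lambda>x::'a. c * (x \<bullet> i) + d) has_derivative (\<lambda>h. c * (h \<bullet> i))) (at x)"
      by (auto intro!: derivative_eq_intros)
    from has_derivative_compose[OF this, of "flat P"]
    show ?thesis
      using flat_has_derivative[of P "c * (x \<bullet> i) + d"] unfolding Q_def has_field_derivative_def
      by blast
  qed
  have "frechet_derivative (\<lambda>x::'a. flat P (c * (x \<bullet> i) + d)) (at x) =
      (\<lambda>h. flat Q (c * (x \<bullet> i) + d) * (c * (h \<bullet> i)))" for x
    by (rule frechet_derivative_at[symmetric]) (rule D)
  moreover have "(\<lambda>x::'a. flat P (c * (x \<bullet> i) + d)) differentiable (at x)" for x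
    using D unfolding differentiable_def by blast
  ultimately show ?case
    using Suc by (auto intro!: Ck_function_mult Ck_function_const)
qed

text \<open>The parameter n steepens the profile but leaves the support in \<open>cbox a b\<close>:
  \<open>flat 1 (real n * c)\<close> tends to 1 for every \<open>c > 0\<close>, so the bumps
  converge to the indicator of the open box.\<close>

definition box_bump :: "nat \<Rightarrow> 'a \<Rightarrow> 'a \<Rightarrow> 'a::euclidean_space \<Rightarrow> real" where
  "box_bump n a b x =
     (\<Prod>i\<in>Basis. flat 1 (real n * ((x - a) \<bullet> i)) * flat 1 (real n * ((b - x) \<bullet> i)))"

lemma box_bump_Ck: "Ck_function k (box_bump n a b)"
proof -
  have "Ck_function k (\<lambda>x. \<Prod>i\<in>Basis. flat 1 (real n * (x \<bullet> i) + (- (real n * (a \<bullet> i))))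
     * flat 1 ((- real n) * (x \<bullet> i) + (real n * (b \<bullet> i))))"
    by (intro Ck_function_prod Ck_function_mult Ck_function_flat) auto
  moreover have "(\<lambda>x. \<Prod>i\<in>Basis. flat 1 (real n * (x \<bullet> i) + (- (real n * (a \<bullet> i))))
     * flat 1 ((- real n) * (x \<bullet> i) + (real n * (b \<bullet> i)))) = box_bump n a b"
    unfolding box_bump_def by (auto simp: algebra_simps intro!: ext)
  ultimately show ?thesis by simp
qed

lemma flat_1_bounds: "0 \<le> flat 1 t" "flat 1 t \<le> 1" "t \<le> 0 \<Longrightarrow> flat 1 t = 0"
  by (auto simp: flat_def)

lemma box_bump_nonneg: "0 \<le> box_bump n a b x"
  unfolding box_bump_def by (intro prod_nonneg mult_nonneg_nonneg flat_1_bounds(1))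

lemma box_bump_le_1: "box_bump n a b x \<le> 1"
  unfolding box_bump_def by (intro prod_le_1) (auto intro!: mult_le_one flat_1_bounds(1,2) mult_nonneg_nonneg)

lemma box_bump_eq_0: "x \<notin> box a b \<Longrightarrow> box_bump n a b x = 0"
proof -
  assume "x \<notin> box a b"
  then obtain i where i: "i \<in> Basis" "x \<bullet> i \<le> a \<bullet> i \<or> b \<bullet> i \<le> x \<bullet> i"
    by (auto simp: mem_box not_less)
  then have "flat 1 (real n * ((x - a) \<bullet> i)) * flat 1 (real n * ((b - x) \<bullet> i)) = 0"
    by (auto simp: inner_diff_left intro!: flat_1_bounds mult_nonneg_nonpos)
  with i(1) show ?thesis unfolding box_bump_def by (meson finite_Basis prod_zero)
qed

lemma box_bump_tendsto: "(\<lambda>n. box_bump n a b x) \<longlonglongrightarrow> indicator (box a b) x"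
proof (cases "x \<in> box a b")
  case True
  have f: "(\<lambda>n. flat 1 (real n * c)) \<longlonglongrightarrow> 1" if "c > 0" for c :: real
  proof -
    have "(\<lambda>n. exp (- (inverse (real n) * (1 / c)))) \<longlonglongrightarrow> exp (- (0 * (1 / c)))"
      by (intro tendsto_intros LIMSEQ_inverse_real_of_nat[THEN LIMSEQ_imp_Suc] lim_inverse_n)
    moreover have "eventually (\<lambda>n. exp (- (inverse (real n) * (1 / c))) = flat 1 (real n * c)) sequentially"
      using eventually_gt_at_top[of 0]
      by eventually_elim (use that in \<open>auto simp: flat_def field_simps\<close>)
    ultimately show ?thesis by (simp add: tendsto_cong)
  qed
  have "(\<lambda>n. box_bump n a b x) \<longlonglongrightarrow> (\<Prod>i\<in>(Basis::'a set). 1 * 1)"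
    unfolding box_bump_def
    by (intro tendsto_prod tendsto_mult f) (use True in \<open>auto simp: mem_box inner_diff_left\<close>)
  with True show ?thesis by simp
next
  case False
  then show ?thesis by (simp add: box_bump_eq_0)
qed

lemma box_bump_translate: "box_bump n a b (x - w) = box_bump n (a + w) (b + w) x"
proof -
  have "x - w - a = x - (a + w)" "b - (x - w) = b + w - x" by simp_all
  then show ?thesis unfolding box_bump_def by (simp only:)
qed

lemma box_bump_support: "closure {x. box_bump n a b x \<noteq> 0} \<subseteq> cbox a b"
proof (rule closure_minimal)
  show "{x. box_bump n a b x \<noteq> 0} \<subseteq> cbox a b"
    using box_bump_eq_0 box_subset_cbox by blast
qed (rule closed_cbox)

lemma box_bump_test_function:
  assumes "cbox a b \<subseteq> \<Omega>"
  shows "test_function \<Omega> (box_bump n a b)"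
proof -
  have "bounded {x. box_bump n a b x \<noteq> 0}"
    by (rule bounded_subset[OF bounded_cbox]) (rule order_trans[OF closure_subset box_bump_support])
  then show ?thesis
    unfolding test_function_def
    using box_bump_Ck[of _ n a b] order_trans[OF box_bump_support assms] by simp
qed

section \<open>Line integrals of weak gradients\<close>

lemma nn_integral_lborel_translate:
  fixes f :: "'a::euclidean_space \<Rightarrow> ennreal"
  assumes [measurable]: "f \<in> borel_measurable borel"
  shows "(\<integral>\<^sup>+x. f (x + c) \<partial>lborel) = (\<integral>\<^sup>+x. f x \<partial>lborel)"
proof -
  have "(\<integral>\<^sup>+x. f x \<partial>lborel) = (\<integral>\<^sup>+x. f x \<partial>distr lborel borel ((+) c))"
    by (simp add: lborel_distr_plus)
  also have "\<dots> = (\<integral>\<^sup>+x. f (c + x) \<partial>lborel)" by (rule nn_integral_distr) auto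
  finally show ?thesis by (simp add: add.commute)
qed

lemma integral_lborel_translate:
  fixes f :: "'a::euclidean_space \<Rightarrow> 'b::{banach, second_countable_topology}"
  assumes [measurable]: "f \<in> borel_measurable borel"
  shows "(\<integral>x. f (x + c) \<partial>lborel) = (\<integral>x. f x \<partial>lborel)"
proof -
  have "(\<integral>x. f x \<partial>lborel) = (\<integral>x. f x \<partial>distr lborel borel ((+) c))"
    by (simp add: lborel_distr_plus)
  also have "\<dots> = (\<integral>x. f (c + x) \<partial>lborel)" by (rule integral_distr) auto
  finally show ?thesis by (simp add: add.commute)
qed

lemma integrable_lborel_translate:
  fixes f :: "'a::euclidean_space \<Rightarrow> 'b::{banach, second_countable_topology}"
  assumes f: "integrable lborel f"
  shows "integrable lborel (\<lambda>x. f (x + c))"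
proof -
  have [measurable]: "f \<in> borel_measurable borel" using borel_measurable_integrable[OF f] by simp
  have "integrable (distr lborel borel ((+) c)) f" using f by (simp add: lborel_distr_plus)
  then have "integrable lborel (\<lambda>x. f (c + x))" by (subst (asm) integrable_distr_eq) auto
  then show ?thesis by (simp add: add.commute)
qed

text \<open>The complement is the set of differences of the closed set \<open>- \<Omega>\<close> and
  a compact segment, hence closed.\<close>

lemma open_segment_translates:
  fixes \<Omega> :: "('a::euclidean_space) set"
  assumes "open \<Omega>"
  shows "open {x. \<forall>s\<in>{0..1}. x + s *\<^sub>R v \<in> \<Omega>}"
proof -
  have "compact ((\<lambda>s. s *\<^sub>R v) ` {0..1::real})"
    by (intro compact_continuous_image continuous_intros) auto
  moreover have "closed (- \<Omega>)" using assms by (rule closed_Compl)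
  ultimately have "closed (\<Union>x\<in>- \<Omega>. \<Union>y\<in>(\<lambda>s. s *\<^sub>R v) ` {0..1::real}. {x - y})"
    by (rule closed_compact_differences[rotated])
  moreover have "{x. \<forall>s\<in>{0..1}. x + s *\<^sub>R v \<in> \<Omega>} = - (\<Union>x\<in>- \<Omega>. \<Union>y\<in>(\<lambda>s. s *\<^sub>R v) ` {0..1::real}. {x - y})"
  proof -
    have "(\<exists>s\<in>{0..1}. x + s *\<^sub>R v \<notin> \<Omega>) \<longleftrightarrow> (\<exists>z\<in>- \<Omega>. \<exists>s\<in>{0..1::real}. x = z - s *\<^sub>R v)" for x
      by (metis ComplD ComplI add_diff_cancel_right' diff_add_cancel)
    then show ?thesis by auto
  qed
  ultimately show ?thesis by (simp add: open_closed)
qed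

text \<open>Lebesgue differentiation: at almost every x the averages over the cubes
  \<open>cbox x (x + h *\<^sub>R One)\<close> tend to \<open>w x\<close>; for x in the open set U
  the small cubes lie in U, where the averages vanish.\<close>

lemma AE_zero_if_box_integrals_zero:
  fixes w :: "'a::euclidean_space \<Rightarrow> real"
  assumes w: "integrable lborel w" and U: "open U"
    and z: "\<And>a b. cbox a b \<subseteq> U \<Longrightarrow> (\<integral>x. indicator (box a b) x * w x \<partial>lborel) = 0"
  shows "AE x in lborel. x \<in> U \<longrightarrow> w x = 0"
proof -
  have "w integrable_on cbox a b" for a b
    using integrable_on_lborel[OF w] integrable_on_subcbox[of w UNIV] by blast
  then obtain Z where Z: "negligible Z"
    "\<And>x e. \<lbrakk>x \<notin> Z; 0 < e\<rbrakk> \<Longrightarrow> \<exists>d>0. \<forall>h. 0 < h \<and> h < d \<longrightarrow>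
       norm (integral (cbox x (x + h *\<^sub>R One)) w /\<^sub>R h ^ DIM('a) - w x) < e"
    using integrable_ccontinuous_explicit[of w] by blast
  have "AE x in lebesgue. x \<notin> Z"
    using Z(1) by (intro AE_not_in) (simp add: negligible_iff_null_sets)
  then have "AE x in lborel. x \<notin> Z" by (simp add: AE_completion_iff)
  then show ?thesis
  proof (rule AE_mp, intro AE_I2 impI)
    fix x assume x: "x \<notin> Z" "x \<in> U"
    obtain r where r: "r > 0" "cball x r \<subseteq> U" using U x(2) open_contains_cball by blast
    have int0: "integral (cbox x (x + h *\<^sub>R One)) w = 0" if h: "0 < h" "h * norm (One::'a) \<le> r" for h
    proof -
      have "cbox x (x + h *\<^sub>R One) \<subseteq> cball x r"
      proof
        fix y assume y: "y \<in> cbox x (x + h *\<^sub>R One)"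
        have "norm (y - x) \<le> norm (h *\<^sub>R (One::'a))"
        proof (rule norm_le_componentwise)
          fix b :: 'a assume b: "b \<in> Basis"
          have "x \<bullet> b \<le> y \<bullet> b" "y \<bullet> b \<le> (x + h *\<^sub>R One) \<bullet> b"
            using y b by (auto simp: mem_box)
          then show "\<bar>(y - x) \<bullet> b\<bar> \<le> \<bar>h *\<^sub>R (One::'a) \<bullet> b\<bar>"
            by (simp add: inner_diff_left inner_add_left)
        qed
        then show "y \<in> cball x r" using h by (simp add: dist_norm norm_minus_commute)
      qed
      then have "(\<integral>y. indicator (box x (x + h *\<^sub>R One)) y * w y \<partial>lborel) = 0"
        using r by (intro z) blast
      moreover have "(LINT y:box x (x + h *\<^sub>R One)|lborel. w y) = integral (box x (x + h *\<^sub>R One)) w"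
        by (rule set_borel_integral_eq_integral(2))
           (unfold set_integrable_def, rule integrable_mult_indicator[OF _ w], simp)
      ultimately show ?thesis
        by (simp add: set_lebesgue_integral_def integral_open_interval)
    qed
    show "w x = 0"
    proof (rule ccontr)
      assume "w x \<noteq> 0"
      then obtain d where d: "d > 0" "\<And>h. 0 < h \<Longrightarrow> h < d \<Longrightarrow>
          norm (integral (cbox x (x + h *\<^sub>R One)) w /\<^sub>R h ^ DIM('a) - w x) < \<bar>w x\<bar>"
        using Z(2)[OF x(1), of "\<bar>w x\<bar>"] by auto
      \<comment> \<open>Small enough for the differentiation estimate and for the diagonal of the
        cube to fit into \<open>cball x r\<close>.\<close>
      define h where "h = min (d / 2) (r / (norm (One::'a) + 1))"
      have n: "norm (One::'a) + 1 > 0" by (rule add_nonneg_pos) auto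
      have h: "0 < h" "h < d" using d(1) r(1) n by (auto simp: h_def)
      have "h \<le> r / (norm (One::'a) + 1)" by (simp add: h_def)
      then have "h * (norm (One::'a) + 1) \<le> r" using n by (simp only: pos_le_divide_eq)
      then have "h * norm (One::'a) \<le> r" using h by (simp add: distrib_left)
      with int0[OF h(1)] d(2)[OF h] show False by simp
    qed
  qed
qed

section \<open>Derivatives of the box bumps\<close>

lemma frechet_derivative_componentwise:
  fixes f :: "'a::euclidean_space \<Rightarrow> real"
  assumes "f differentiable (at x)"
  shows "frechet_derivative f (at x) v = (\<Sum>i\<in>Basis. (v \<bullet> i) * frechet_derivative f (at x) i)"
proof -
  have l: "linear (frechet_derivative f (at x))"
    using assms by (simp add: linear_frechet_derivative)
  have "frechet_derivative f (at x) v = frechet_derivative f (at x) (\<Sum>i\<in>Basis. (v \<bullet> i) *\<^sub>R i)"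
    by (simp add: euclidean_representation)
  also have "\<dots> = (\<Sum>i\<in>Basis. (v \<bullet> i) * frechet_derivative f (at x) i)"
    using l by (simp add: linear_sum linear_scale)
  finally show ?thesis .
qed

lemma box_bump_differentiable: "box_bump n a b differentiable (at x)"
  using box_bump_Ck[of "Suc 0" n a b] by simp

lemma box_bump_derivative_continuous:
  "continuous_on UNIV (\<lambda>x. frechet_derivative (box_bump n a b) (at x) v)"
proof -
  have "continuous_on UNIV (\<lambda>x. \<Sum>i\<in>Basis. (v \<bullet> i) * frechet_derivative (box_bump n a b) (at x) i)"
    using box_bump_Ck[of "Suc 0" n a b] by (intro continuous_intros) simp
  then show ?thesis
    by (simp add: frechet_derivative_componentwise[OF box_bump_differentiable, of _ _ _ _ v])
qed

lemma box_bump_derivative_bounded: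
  "\<exists>C. \<forall>x. \<bar>frechet_derivative (box_bump n a b) (at x) v\<bar> \<le> C"
proof -
  have "compact ((\<lambda>x. frechet_derivative (box_bump n a b) (at x) v) ` cbox a b)"
    by (intro compact_continuous_image continuous_on_subset[OF box_bump_derivative_continuous] compact_cbox) auto
  from compact_imp_bounded[OF this]
  obtain C where C: "\<And>x. x \<in> cbox a b \<Longrightarrow> \<bar>frechet_derivative (box_bump n a b) (at x) v\<bar> \<le> C"
    unfolding bounded_iff ball_simps real_norm_def by (elim exE) (rule that, erule bspec)
  have "\<bar>frechet_derivative (box_bump n a b) (at x) v\<bar> \<le> max C 0" for x
  proof (cases "x \<in> cbox a b")
    case True
    then show ?thesis using C[of x] by linarith
  next
    case False
    have "(box_bump n a b has_derivative (\<lambda>h. 0)) (at x)"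
    proof (rule has_derivative_transform_within_open[of "\<lambda>x. 0" _ _ _ "- cbox a b"])
      show "open (- cbox a b)" using closed_cbox by (rule open_Compl)
      show "0 = box_bump n a b y" if "y \<in> - cbox a b" for y
        using that box_subset_cbox by (intro box_bump_eq_0[symmetric]) blast
    qed (use False in auto)
    then have "frechet_derivative (box_bump n a b) (at x) = (\<lambda>h. 0)"
      by (rule frechet_derivative_at[symmetric])
    then show ?thesis by simp
  qed
  then show ?thesis by blast
qed

lemma box_bump_measurable [measurable]: "box_bump n a b \<in> borel_measurable borel"
  using box_bump_Ck[of 0 n a b] by (intro borel_measurable_continuous_onI) simp

lemma box_bump_derivative_translate:
  "frechet_derivative (box_bump n a b) (at (x - w)) =
   frechet_derivative (box_bump n (a + w) (b + w)) (at x)"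
proof -
  have "((\<lambda>y. box_bump n a b (y - w)) has_derivative frechet_derivative (box_bump n a b) (at (x - w))) (at x)"
  proof -
    have 1: "((\<lambda>y. y - w) has_derivative (\<lambda>h. h)) (at x)" by (auto intro!: derivative_eq_intros)
    have 2: "(box_bump n a b has_derivative frechet_derivative (box_bump n a b) (at (x - w))) (at (x - w))"
      using box_bump_differentiable by (simp add: frechet_derivative_works)
    show ?thesis using has_derivative_compose[OF 1 2] by simp
  qed
  then have "(box_bump n (a + w) (b + w) has_derivative frechet_derivative (box_bump n a b) (at (x - w))) (at x)"
    by (simp add: box_bump_translate)
  then show ?thesis by (rule frechet_derivative_at)
qed

text \<open>The integrability behind each use of Fubini below: for every s the integral of
  \<open>\<bar>h (x + s *\<^sub>R v)\<bar>\<close> over x is that of \<open>\<bar>h\<bar>\<close>,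
  and s runs through a bounded interval. The choice \<open>v = 0\<close> covers factors that do not
  move with s.\<close>

lemma integrable_segment_translates:
  fixes h :: "'a::euclidean_space \<Rightarrow> real"
  assumes h: "integrable lborel h"
    and F: "F \<in> borel_measurable (borel \<Otimes>\<^sub>M borel)"
    and le: "\<And>s x. \<bar>F (s, x)\<bar> \<le> C * \<bar>h (x + s *\<^sub>R v)\<bar>"
  shows "integrable (lborel \<Otimes>\<^sub>M lborel) (\<lambda>(s, x). indicator {0..1::real} s * F (s, x))"
proof -
  have [measurable]: "h \<in> borel_measurable borel" using borel_measurable_integrable[OF h] by simp
  note F[measurable]
  define H where "H = (\<lambda>(s, x). indicator {0..1::real} s * (C * \<bar>h (x + s *\<^sub>R v)\<bar>))"
  have "integrable (lborel \<Otimes>\<^sub>M lborel) H"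
  proof (rule lborel_pair.Fubini_integrable)
    show "H \<in> borel_measurable (lborel \<Otimes>\<^sub>M lborel)" unfolding H_def by measurable
    have "(\<integral>y. norm (H (x, y)) \<partial>lborel) = indicator {0..1} x * (\<bar>C\<bar> * (\<integral>y. \<bar>h y\<bar> \<partial>lborel))" for x
      using integral_lborel_translate[of "\<lambda>y. \<bar>h y\<bar>" "x *\<^sub>R v"] by (simp add: H_def abs_mult)
    then show "integrable lborel (\<lambda>x. \<integral>y. norm (H (x, y)) \<partial>lborel)"
      by (simp only:) (intro integrable_mult_left, simp add: integrable_indicator_iff)
    show "AE x in lborel. integrable lborel (\<lambda>y. H (x, y))"
      unfolding H_def using integrable_lborel_translate[OF h] by auto
  qed
  then show ?thesis
  proof (rule Bochner_Integration.integrable_bound)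
    show "(\<lambda>(s, x). indicator {0..1::real} s * F (s, x)) \<in> borel_measurable (lborel \<Otimes>\<^sub>M lborel)"
      by measurable
    show "AE z in lborel \<Otimes>\<^sub>M lborel. norm (case z of (s, x) \<Rightarrow> indicator {0..1::real} s * F (s, x)) \<le> norm (H z)"
    proof (intro AE_I2)
      fix z :: "real \<times> 'a"
      obtain s x where z: "z = (s, x)" by (cases z)
      have "\<bar>F (s, x)\<bar> \<le> \<bar>C * \<bar>h (x + s *\<^sub>R v)\<bar>\<bar>" using le[of s x] by linarith
      then show "norm (case z of (s, x) \<Rightarrow> indicator {0..1::real} s * F (s, x)) \<le> norm (H z)"
        by (simp add: z H_def indicator_def)
    qed
  qed
qed

text \<open>Tested against a bump \<phi>, the translation of u is shifted onto \<phi>. The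
  fundamental theorem of calculus writes \<open>\<phi> (x - v) - \<phi> x\<close> as an integral of
  derivatives along the segment; Fubini and integration by parts at each s turn it into the integral
  of \<open>G * \<phi>\<close>. Bumps tending to indicators of boxes then identify both sides. The
  exceptional null set depends on v, which is harmless because later x is integrated with v
  fixed.\<close>

lemma line_integral_of_weak_gradient:
  fixes u :: "'a::euclidean_space \<Rightarrow> real" and g :: "'a \<Rightarrow> 'a"
  assumes u: "integrable lborel u" and g: "integrable lborel g" and \<Omega>: "open \<Omega>"
    and ibp: "\<And>a b n i. cbox a b \<subseteq> \<Omega> \<Longrightarrow> i \<in> Basis \<Longrightarrow>
      (\<integral>x. u x * frechet_derivative (box_bump n a b) (at x) i \<partial>lborel) =
      - (\<integral>x. (g x \<bullet> i) * box_bump n a b x \<partial>lborel)"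
  shows "AE x in lborel. (\<forall>s\<in>{0..1}. x + s *\<^sub>R v \<in> \<Omega>) \<longrightarrow>
    u (x + v) - u x = (\<integral>s. indicator {0..1} s * (g (x + s *\<^sub>R v) \<bullet> v) \<partial>lborel)"
proof -
  have um[measurable]: "u \<in> borel_measurable borel" using borel_measurable_integrable[OF u] by simp
  have gm[measurable]: "g \<in> borel_measurable borel" using borel_measurable_integrable[OF g] by simp
  define f where "f x = g x \<bullet> v" for x
  have f: "integrable lborel f" unfolding f_def using g by simp
  have fm[measurable]: "f \<in> borel_measurable borel" unfolding f_def by measurable
  define G where "G x = (\<integral>s. indicator {0..1} s * f (x + s *\<^sub>R v) \<partial>lborel)" for x
  have Fint: "integrable (lborel \<Otimes>\<^sub>M lborel) (\<lambda>(s, x). indicator {0..1::real} s * f (x + s *\<^sub>R v))"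
  proof -
    have "(\<lambda>(s, x). f (x + s *\<^sub>R v)) \<in> borel_measurable (borel \<Otimes>\<^sub>M borel)" by measurable
    from integrable_segment_translates[OF f this, of 1 v] show ?thesis by simp
  qed
  have G: "integrable lborel G" unfolding G_def using lborel_pair.integrable_snd[OF Fint] by simp
  have Gm[measurable]: "G \<in> borel_measurable borel" using borel_measurable_integrable[OF G] by simp
  define w where "w x = u (x + v) - u x - G x" for x
  have w: "integrable lborel w"
    unfolding w_def using u G integrable_lborel_translate[OF u] by auto
  have wm[measurable]: "w \<in> borel_measurable borel" using borel_measurable_integrable[OF w] by simp
  define U where "U = {x. \<forall>s\<in>{0..1}. x + s *\<^sub>R v \<in> \<Omega>}"
  have U: "open U" unfolding U_def using \<Omega> by (rule open_segment_translates)
  have bounded_mult: "integrable lborel (\<lambda>x. k x * \<psi> x)"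
    if "integrable lborel k" "\<psi> \<in> borel_measurable borel" "\<And>x. \<bar>\<psi> x\<bar> \<le> C" for k \<psi> :: "'a \<Rightarrow> real" and C
  proof (rule Bochner_Integration.integrable_bound[where f = "\<lambda>x. C * k x"])
    show "integrable lborel (\<lambda>x. C * k x)" using that by simp
    show "(\<lambda>x. k x * \<psi> x) \<in> borel_measurable lborel"
      using borel_measurable_integrable[OF that(1)] that(2) by simp
    show "AE x in lborel. norm (k x * \<psi> x) \<le> norm (C * k x)"
    proof (intro AE_I2)
      fix x
      have "\<bar>k x\<bar> * \<bar>\<psi> x\<bar> \<le> \<bar>k x\<bar> * \<bar>C\<bar>"
        using that(3)[of x] by (intro mult_left_mono) auto
      then show "norm (k x * \<psi> x) \<le> norm (C * k x)" by (simp add: abs_mult mult.commute)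
    qed
  qed
  \<comment> \<open>Linearity passes from the coordinate directions to the direction
    \<open>v\<close>; the bounds on the bump and its derivative justify splitting the
    integrals.\<close>
  have ibpv: "(\<integral>x. u x * frechet_derivative (box_bump n a b) (at x) v \<partial>lborel) =
      - (\<integral>x. f x * box_bump n a b x \<partial>lborel)" if ab: "cbox a b \<subseteq> \<Omega>" for a b n
  proof -
    have I1: "integrable lborel (\<lambda>x. u x * frechet_derivative (box_bump n a b) (at x) i)" for i
    proof -
      obtain C where "\<And>x. \<bar>frechet_derivative (box_bump n a b) (at x) i\<bar> \<le> C"
        using box_bump_derivative_bounded by blast
      then show ?thesis
        by (intro bounded_mult[OF u] borel_measurable_continuous_onI box_bump_derivative_continuous) auto
    qed
    have I2: "integrable lborel (\<lambda>x. (g x \<bullet> i) * box_bump n a b x)" for i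
      by (rule bounded_mult[where C = 1])
         (use g box_bump_nonneg[of n a b] box_bump_le_1[of n a b] in \<open>auto simp: abs_of_nonneg\<close>)
    have "(\<integral>x. u x * frechet_derivative (box_bump n a b) (at x) v \<partial>lborel) =
        (\<integral>x. (\<Sum>i\<in>Basis. (v \<bullet> i) * (u x * frechet_derivative (box_bump n a b) (at x) i)) \<partial>lborel)"
      by (subst frechet_derivative_componentwise[OF box_bump_differentiable])
         (simp add: sum_distrib_left mult_ac)
    also have "\<dots> = (\<Sum>i\<in>Basis. (v \<bullet> i) * - (\<integral>x. (g x \<bullet> i) * box_bump n a b x \<partial>lborel))"
      using I1 ibp[OF ab] by (subst Bochner_Integration.integral_sum) auto
    also have "\<dots> = - (\<integral>x. (\<Sum>i\<in>Basis. (v \<bullet> i) * ((g x \<bullet> i) * box_bump n a b x)) \<partial>lborel)"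
      using I2 by (subst Bochner_Integration.integral_sum) (auto simp: sum_negf)
    also have "(\<lambda>x. \<Sum>i\<in>Basis. (v \<bullet> i) * ((g x \<bullet> i) * box_bump n a b x)) = (\<lambda>x. f x * box_bump n a b x)"
      by (simp add: f_def euclidean_inner[of "g _" v] sum_distrib_left sum_distrib_right mult_ac)
    finally show ?thesis .
  qed
  have bump: "(\<integral>x. w x * box_bump n a b x \<partial>lborel) = 0" if ab: "cbox a b \<subseteq> U" for a b n
  proof -
    define \<phi> where "\<phi> = box_bump n a b"
    define D where "D x = frechet_derivative \<phi> (at x) v" for x
    obtain C where C: "\<And>x. \<bar>D x\<bar> \<le> C" unfolding D_def \<phi>_def using box_bump_derivative_bounded by blast
    have Dc: "continuous_on UNIV D" unfolding D_def \<phi>_def by (rule box_bump_derivative_continuous)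
    have Dm[measurable]: "D \<in> borel_measurable borel"
      using Dc by (rule borel_measurable_continuous_onI)
    have \<phi>m[measurable]: "\<phi> \<in> borel_measurable borel" unfolding \<phi>_def by measurable
    have \<phi>1: "\<bar>\<phi> x\<bar> \<le> 1" for x
      unfolding \<phi>_def using box_bump_nonneg[of n a b] box_bump_le_1[of n a b] by (simp add: abs_of_nonneg)
    have FTC: "\<phi> (x - v) - \<phi> x = (\<integral>s. indicator {0..1} s * - D (x - s *\<^sub>R v) \<partial>lborel)" for x
    proof -
      have d: "((\<lambda>s. \<phi> (x - s *\<^sub>R v)) has_real_derivative - D (x - s *\<^sub>R v)) (at s)" for s
      proof -
        have 1: "((\<lambda>s. x - s *\<^sub>R v) has_derivative (\<lambda>h. h *\<^sub>R (- v))) (at s)"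
          by (auto intro!: derivative_eq_intros)
        have dd: "\<phi> differentiable (at (x - s *\<^sub>R v))" unfolding \<phi>_def by (rule box_bump_differentiable)
        then have 2: "(\<phi> has_derivative frechet_derivative \<phi> (at (x - s *\<^sub>R v))) (at (x - s *\<^sub>R v))"
          by (simp add: frechet_derivative_works)
        have l: "linear (frechet_derivative \<phi> (at (x - s *\<^sub>R v)))"
          using dd by (rule linear_frechet_derivative)
        have e: "frechet_derivative \<phi> (at (x - s *\<^sub>R v)) (h *\<^sub>R (- v)) = - D (x - s *\<^sub>R v) * h" for h
          using linear_scale[OF l, of h "- v"] linear_neg[OF l, of v] by (simp add: D_def)
        from has_derivative_compose[OF 1 2] show ?thesis
          unfolding has_field_derivative_def e .
      qed
      have "isCont (\<lambda>s. - D (x - s *\<^sub>R v)) s" for s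
      proof -
        have "continuous_on UNIV (\<lambda>s. - D (x - s *\<^sub>R v))"
          by (intro continuous_intros continuous_on_compose2[OF Dc]) auto
        then show ?thesis by (simp add: continuous_on_eq_continuous_at)
      qed
      then have "has_bochner_integral lborel (\<lambda>s. - D (x - s *\<^sub>R v) * indicator {0..1} s) (\<phi> (x - 1 *\<^sub>R v) - \<phi> (x - 0 *\<^sub>R v))"
        by (intro has_bochner_integral_FTC_Icc_real d) auto
      from has_bochner_integral_integral_eq[OF this] show ?thesis
        by (simp add: mult.commute)
    qed
    have tr: "(\<integral>x. u (x + v) * \<phi> x \<partial>lborel) = (\<integral>x. u x * \<phi> (x - v) \<partial>lborel)"
      using integral_lborel_translate[of "\<lambda>x. u x * \<phi> (x - v)" v] by simp
    have bm: "(\<integral>x. (u (x + v) - u x) * \<phi> x \<partial>lborel) = (\<integral>x. u x * (\<phi> (x - v) - \<phi> x) \<partial>lborel)"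
    proof -
      have i: "integrable lborel (\<lambda>x. u (x + v) * \<phi> x)" "integrable lborel (\<lambda>x. u x * \<phi> x)"
         "integrable lborel (\<lambda>x. u x * \<phi> (x - v))"
        using \<phi>1 by (auto intro!: bounded_mult[where C = 1] u integrable_lborel_translate)
      have "(\<integral>x. (u (x + v) - u x) * \<phi> x \<partial>lborel) = (\<integral>x. u (x + v) * \<phi> x \<partial>lborel) - (\<integral>x. u x * \<phi> x \<partial>lborel)"
        using i by (simp add: left_diff_distrib)
      also have "\<dots> = (\<integral>x. u x * (\<phi> (x - v) - \<phi> x) \<partial>lborel)"
        using i by (simp add: right_diff_distrib tr)
      finally show ?thesis .
    qed
    have i1: "integrable (lborel \<Otimes>\<^sub>M lborel) (\<lambda>(s, x). indicator {0..1::real} s * (u x * - D (x - s *\<^sub>R v)))"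
    proof -
      have "\<bar>u x * - D (x - s *\<^sub>R v)\<bar> \<le> C * \<bar>u x\<bar>" for s x
        using mult_right_mono[OF C[of "x - s *\<^sub>R v"], of "\<bar>u x\<bar>"] by (simp add: abs_mult mult.commute)
      then show ?thesis
        using integrable_segment_translates[OF u, of "\<lambda>(s, x). u x * - D (x - s *\<^sub>R v)" C 0] by simp
    qed
    have i2: "integrable (lborel \<Otimes>\<^sub>M lborel) (\<lambda>(s, x). indicator {0..1::real} s * (f (x + s *\<^sub>R v) * \<phi> x))"
    proof -
      have "\<bar>f (x + s *\<^sub>R v) * \<phi> x\<bar> \<le> 1 * \<bar>f (x + s *\<^sub>R v)\<bar>" for s x
        using mult_left_mono[OF \<phi>1[of x], of "\<bar>f (x + s *\<^sub>R v)\<bar>"] by (simp add: abs_mult)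
      then show ?thesis
        using integrable_segment_translates[OF f, of "\<lambda>(s, x). f (x + s *\<^sub>R v) * \<phi> x" 1 v] by simp
    qed
    have inner: "(\<integral>x. u x * - D (x - s *\<^sub>R v) \<partial>lborel) = (\<integral>x. f (x + s *\<^sub>R v) * \<phi> x \<partial>lborel)"
      if s: "s \<in> {0..1}" for s
    proof -
      \<comment> \<open>The shifted bump is still admissible: points of \<open>U\<close> have their
        whole segment in \<open>\<Omega>\<close>, so a box in \<open>U\<close> moved by
        \<open>s *\<^sub>R v\<close> stays in \<open>\<Omega>\<close>.\<close>
      have sub: "cbox (a + s *\<^sub>R v) (b + s *\<^sub>R v) \<subseteq> \<Omega>"
      proof
        fix y assume "y \<in> cbox (a + s *\<^sub>R v) (b + s *\<^sub>R v)"
        then have "y - s *\<^sub>R v \<in> cbox a b" by (auto simp: mem_box inner_diff_left inner_add_left algebra_simps)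
        then have "y - s *\<^sub>R v + s *\<^sub>R v \<in> \<Omega>" using ab s unfolding U_def by blast
        then show "y \<in> \<Omega>" by simp
      qed
      have "(\<integral>x. u x * - D (x - s *\<^sub>R v) \<partial>lborel) =
          - (\<integral>x. u x * frechet_derivative (box_bump n (a + s *\<^sub>R v) (b + s *\<^sub>R v)) (at x) v \<partial>lborel)"
        by (simp add: D_def \<phi>_def box_bump_derivative_translate)
      also have "\<dots> = (\<integral>x. f x * \<phi> (x - s *\<^sub>R v) \<partial>lborel)"
        using ibpv[OF sub, of n] by (simp add: \<phi>_def box_bump_translate)
      also have "\<dots> = (\<integral>x. f (x + s *\<^sub>R v) * \<phi> x \<partial>lborel)"
        using integral_lborel_translate[of "\<lambda>x. f x * \<phi> (x - s *\<^sub>R v)" "s *\<^sub>R v"] by simp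
      finally show ?thesis .
    qed
    have "(\<integral>x. (u (x + v) - u x) * \<phi> x \<partial>lborel) =
        (\<integral>x. (\<integral>s. indicator {0..1} s * (u x * - D (x - s *\<^sub>R v)) \<partial>lborel) \<partial>lborel)"
      unfolding bm FTC by (simp add: mult.left_commute[of _ "u _"] flip: integral_mult_right_zero)
    also have "\<dots> = (\<integral>s. (\<integral>x. indicator {0..1} s * (u x * - D (x - s *\<^sub>R v)) \<partial>lborel) \<partial>lborel)"
      by (rule lborel_pair.Fubini_integral[OF i1])
    also have "\<dots> = (\<integral>s. (\<integral>x. indicator {0..1} s * (f (x + s *\<^sub>R v) * \<phi> x) \<partial>lborel) \<partial>lborel)"
    proof (rule Bochner_Integration.integral_cong[OF refl])
      fix s :: real
      show "(\<integral>x. indicator {0..1} s * (u x * - D (x - s *\<^sub>R v)) \<partial>lborel) =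
         (\<integral>x. indicator {0..1} s * (f (x + s *\<^sub>R v) * \<phi> x) \<partial>lborel)"
        using inner[of s] by (cases "s \<in> {0..1}") auto
    qed
    also have "\<dots> = (\<integral>x. (\<integral>s. indicator {0..1} s * (f (x + s *\<^sub>R v) * \<phi> x) \<partial>lborel) \<partial>lborel)"
      by (rule lborel_pair.Fubini_integral[OF i2, symmetric])
    also have "\<dots> = (\<integral>x. G x * \<phi> x \<partial>lborel)"
      unfolding G_def by (simp flip: integral_mult_left_zero add: mult.assoc)
    finally have eq: "(\<integral>x. (u (x + v) - u x) * \<phi> x \<partial>lborel) = (\<integral>x. G x * \<phi> x \<partial>lborel)" .
    have "integrable lborel (\<lambda>x. (u (x + v) - u x) * \<phi> x)" "integrable lborel (\<lambda>x. G x * \<phi> x)"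
      using \<phi>1 by (auto intro!: bounded_mult[where C = 1] G Bochner_Integration.integrable_diff u integrable_lborel_translate)
    then have "(\<integral>x. (u (x + v) - u x) * \<phi> x - G x * \<phi> x \<partial>lborel) = 0" using eq by simp
    then show ?thesis by (simp add: w_def \<phi>_def left_diff_distrib)
  qed
  have "AE x in lborel. x \<in> U \<longrightarrow> w x = 0"
  proof (rule AE_zero_if_box_integrals_zero[OF w U])
    fix a b assume ab: "cbox a b \<subseteq> U"
    \<comment> \<open>The bumps lie between 0 and 1, so \<open>\<bar>w\<bar>\<close>
      dominates.\<close>
    have "(\<lambda>n. \<integral>x. w x * box_bump n a b x \<partial>lborel) \<longlonglongrightarrow> (\<integral>x. w x * indicator (box a b) x \<partial>lborel)"
    proof (rule integral_dominated_convergence[where w = "\<lambda>x. \<bar>w x\<bar>"])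
      show "AE x in lborel. (\<lambda>n. w x * box_bump n a b x) \<longlonglongrightarrow> w x * indicator (box a b) x"
        by (intro AE_I2 tendsto_intros box_bump_tendsto)
      show "AE x in lborel. norm (w x * box_bump n a b x) \<le> \<bar>w x\<bar>" for n
        using mult_left_mono[OF box_bump_le_1[of n a b], of "\<bar>w x\<bar>" for x] box_bump_nonneg[of n a b]
        by (auto simp: abs_mult)
    qed (use w in auto)
    moreover have "(\<lambda>n. \<integral>x. w x * box_bump n a b x \<partial>lborel) = (\<lambda>n. 0)" using bump[OF ab] by simp
    ultimately show "(\<integral>x. indicator (box a b) x * w x \<partial>lborel) = 0"
      by (simp add: LIMSEQ_const_iff mult.commute)
  qed
  then show ?thesis
    by eventually_elim (auto simp: U_def w_def G_def f_def)
qed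

section \<open>Gagliardo seminorms are controlled by the gradient\<close>

text \<open>Convexity gives this on the open half-line. The end point y = 0 is computed directly and
  reduces to the sign of \<open>1 - p\<close>.\<close>

lemma powr_above_tangent:
  fixes y m p :: real
  assumes "0 \<le> y" "0 < m" "1 \<le> p"
  shows "m powr p + p * m powr (p - 1) * (y - m) \<le> y powr p"
proof (cases "y = 0")
  case True
  have "m powr p = m powr (p - 1) * m" using assms by (simp add: powr_diff)
  then have "m powr p + p * m powr (p - 1) * (0 - m) = (1 - p) * (m powr (p - 1) * m)"
    by (simp add: algebra_simps)
  also have "\<dots> \<le> 0" using assms by (intro mult_nonpos_nonneg) auto
  finally show ?thesis using True assms by simp
next
  case False
  have "p * m powr (p - 1) * (y - m) \<le> y powr p - m powr p"
  proof (rule convex_on_imp_above_tangent[of "{0<..}"])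
    show "convex_on {0<..} (\<lambda>x. x powr p)" using assms by (intro powr_convex)
    show "((\<lambda>x. x powr p) has_field_derivative p * m powr (p - 1)) (at m within {0<..})"
      using assms(2) by (rule has_field_derivative_at_within[OF has_real_derivative_powr])
  qed (use assms False in \<open>auto simp: interior_open\<close>)
  then show ?thesis by simp
qed

text \<open>Integrate the tangent of \<open>y powr p\<close> at the mean m of
  \<open>\<bar>f\<bar>\<close>: since the interval has length 1, the linear term integrates to
  0.\<close>

lemma jensen_unit_interval:
  fixes f :: "real \<Rightarrow> real"
  assumes [measurable]: "f \<in> borel_measurable borel" and p: "1 \<le> p"
  shows "ennreal (\<bar>\<integral>s. indicator {0..1} s * f s \<partial>lborel\<bar> powr p)
    \<le> (\<integral>\<^sup>+s. indicator {0..1} s * ennreal (\<bar>f s\<bar> powr p) \<partial>lborel)"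
proof (cases "integrable lborel (\<lambda>s. indicator {0..1} s * f s) \<and>
    integrable lborel (\<lambda>s. indicator {0..1} s * \<bar>f s\<bar> powr p)")
  case True
  define m where "m = (\<integral>s. indicator {0..1} s * \<bar>f s\<bar> \<partial>lborel)"
  have i1: "integrable lborel (\<lambda>s. indicator {0..1} s * \<bar>f s\<bar>)"
    using integrable_norm[OF conjunct1[OF True]] by (simp add: abs_mult)
  have i2: "integrable lborel (indicator {0..1::real} :: real \<Rightarrow> real)"
    by (simp add: integrable_indicator_iff)
  have le: "\<bar>\<integral>s. indicator {0..1} s * f s \<partial>lborel\<bar> \<le> m"
    unfolding m_def using integral_norm_bound[of lborel "\<lambda>s. indicator {0..1} s * f s"] by (simp add: abs_mult)
  have eq: "(\<integral>\<^sup>+s. indicator {0..1} s * ennreal (\<bar>f s\<bar> powr p) \<partial>lborel)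
      = ennreal (\<integral>s. indicator {0..1} s * \<bar>f s\<bar> powr p \<partial>lborel)"
    using True by (subst nn_integral_eq_integral[symmetric])
      (auto intro!: nn_integral_cong simp: indicator_def)
  have "m powr p \<le> (\<integral>s. indicator {0..1} s * \<bar>f s\<bar> powr p \<partial>lborel)"
  proof (cases "m > 0")
    case False
    then have "m = 0" using le by linarith
    then show ?thesis using p by (auto intro!: Bochner_Integration.integral_nonneg)
  next
    case m: True
    have "(\<integral>s. indicator {0..1} s * (m powr p + p * m powr (p - 1) * (\<bar>f s\<bar> - m)) \<partial>lborel) =
      (\<integral>s. (m powr p - p * m powr (p - 1) * m) * indicator {0..1::real} s +
         p * m powr (p - 1) * (indicator {0..1} s * \<bar>f s\<bar>) \<partial>lborel)"
      by (simp add: algebra_simps)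
    also have "\<dots> = (m powr p - p * m powr (p - 1) * m) * 1 + p * m powr (p - 1) * m"
    proof -
      have "(\<integral>s. (indicator {0..1::real} s :: real) \<partial>lborel) = 1" by simp
      then show ?thesis using i1 i2 by (simp add: m_def del: integral_indicator)
    qed
    finally have e: "(\<integral>s. indicator {0..1} s * (m powr p + p * m powr (p - 1) * (\<bar>f s\<bar> - m)) \<partial>lborel) = m powr p"
      by simp
    have "(\<integral>s. indicator {0..1} s * (m powr p + p * m powr (p - 1) * (\<bar>f s\<bar> - m)) \<partial>lborel)
       \<le> (\<integral>s. indicator {0..1} s * \<bar>f s\<bar> powr p \<partial>lborel)"
    proof (rule integral_mono)
      have "integrable lborel (\<lambda>s. (m powr p - p * m powr (p - 1) * m) * indicator {0..1::real} s +
         p * m powr (p - 1) * (indicator {0..1} s * \<bar>f s\<bar>))"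
        using i1 i2 by (intro Bochner_Integration.integrable_add integrable_mult_right) auto
      then show "integrable lborel (\<lambda>s. indicator {0..1} s * (m powr p + p * m powr (p - 1) * (\<bar>f s\<bar> - m)))"
        by (simp add: algebra_simps)
      show "indicator {0..1} s * (m powr p + p * m powr (p - 1) * (\<bar>f s\<bar> - m)) \<le> indicator {0..1} s * \<bar>f s\<bar> powr p" for s
        using powr_above_tangent[of "\<bar>f s\<bar>" m p] m p by (intro mult_left_mono) auto
    qed (use True in blast)
    then show ?thesis unfolding e .
  qed
  moreover have "\<bar>\<integral>s. indicator {0..1} s * f s \<partial>lborel\<bar> powr p \<le> m powr p"
    using le p by (intro powr_mono2) auto
  ultimately show ?thesis unfolding eq by (intro ennreal_leI) linarith
next
  case False
  then consider "\<not> integrable lborel (\<lambda>s. indicator {0..1} s * f s)"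
    | "\<not> integrable lborel (\<lambda>s. indicator {0..1} s * \<bar>f s\<bar> powr p)" by blast
  then show ?thesis
  proof cases
    case 1
    \<comment> \<open>The Bochner integral of a non-integrable function is 0 by convention, so the
      left-hand side is 0.\<close>
    then show ?thesis using p by (simp add: not_integrable_integral_eq)
  next
    case 2
    have "(\<integral>\<^sup>+s. indicator {0..1} s * ennreal (\<bar>f s\<bar> powr p) \<partial>lborel) =
       (\<integral>\<^sup>+s. ennreal (indicator {0..1} s * \<bar>f s\<bar> powr p) \<partial>lborel)"
      by (intro nn_integral_cong) (auto simp: indicator_def)
    also have "\<dots> = \<infinity>"
    proof (rule ccontr)
      assume "\<not> ?thesis"
      then have "integrable lborel (\<lambda>s. indicator {0..1} s * \<bar>f s\<bar> powr p)"
        by (intro integrableI_nonneg) (auto simp: top.not_eq_extremum)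
      with 2 show False by simp
    qed
    finally show ?thesis by simp
  qed
qed

text \<open>The functions \<open>u\<close> and \<open>g\<close> are meant to be Borel representatives, extended by \<open>0\<close> outside \<open>\<Omega>\<close>.\<close>

definition weak_gradient_on :: "'a::euclidean_space set \<Rightarrow> ('a \<Rightarrow> real) \<Rightarrow> ('a \<Rightarrow> 'a) \<Rightarrow> bool" where
  "weak_gradient_on \<Omega> u g \<longleftrightarrow> integrable lborel u \<and> integrable lborel g \<and>
     (\<forall>a b n. \<forall>i\<in>Basis. cbox a b \<subseteq> \<Omega> \<longrightarrow>
      (\<integral>x. u x * frechet_derivative (box_bump n a b) (at x) i \<partial>lborel) =
      - (\<integral>x. (g x \<bullet> i) * box_bump n a b x \<partial>lborel))"

text \<open>Jensen and Cauchy-Schwarz bound the line integral by an average over s of translates of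
  \<open>norm (g x) powr p\<close>. After Tonelli every translate has the same integral, so the
  segment enters only through \<open>norm v\<close>.\<close>

lemma translate_difference_le_gradient:
  fixes u :: "'a::euclidean_space \<Rightarrow> real"
  assumes wg: "weak_gradient_on \<Omega> u g" and \<Omega>: "open \<Omega>" and p: "1 \<le> p"
  shows "(\<integral>\<^sup>+x. ennreal (\<bar>u (x + v) - u x\<bar> powr p) * indicator {x. \<forall>s\<in>{0..1}. x + s *\<^sub>R v \<in> \<Omega>} x \<partial>lborel)
    \<le> ennreal (norm v powr p) * (\<integral>\<^sup>+x. ennreal (norm (g x) powr p) \<partial>lborel)"
proof -
  have u: "integrable lborel u" and g: "integrable lborel g" using wg by (auto simp: weak_gradient_on_def)
  have um[measurable]: "u \<in> borel_measurable borel" using borel_measurable_integrable[OF u] by simp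
  have gm[measurable]: "g \<in> borel_measurable borel" using borel_measurable_integrable[OF g] by simp
  define U where "U = {x. \<forall>s\<in>{0..1}. x + s *\<^sub>R v \<in> \<Omega>}"
  have AE: "AE x in lborel. x \<in> U \<longrightarrow>
    u (x + v) - u x = (\<integral>s. indicator {0..1} s * (g (x + s *\<^sub>R v) \<bullet> v) \<partial>lborel)"
    unfolding U_def mem_Collect_eq
    by (rule line_integral_of_weak_gradient[OF u g \<Omega>]) (use wg in \<open>auto simp: weak_gradient_on_def\<close>)
  have "(\<integral>\<^sup>+x. ennreal (\<bar>u (x + v) - u x\<bar> powr p) * indicator U x \<partial>lborel)
    \<le> (\<integral>\<^sup>+x. (\<integral>\<^sup>+s. indicator {0..1} s * (ennreal (norm v powr p) * ennreal (norm (g (x + s *\<^sub>R v)) powr p)) \<partial>lborel) \<partial>lborel)"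
  proof (rule nn_integral_mono_AE)
    show "AE x in lborel. ennreal (\<bar>u (x + v) - u x\<bar> powr p) * indicator U x
      \<le> (\<integral>\<^sup>+s. indicator {0..1} s * (ennreal (norm v powr p) * ennreal (norm (g (x + s *\<^sub>R v)) powr p)) \<partial>lborel)"
      using AE
    proof eventually_elim
      fix x assume x: "x \<in> U \<longrightarrow> u (x + v) - u x = (\<integral>s. indicator {0..1} s * (g (x + s *\<^sub>R v) \<bullet> v) \<partial>lborel)"
      show "ennreal (\<bar>u (x + v) - u x\<bar> powr p) * indicator U x
        \<le> (\<integral>\<^sup>+s. indicator {0..1} s * (ennreal (norm v powr p) * ennreal (norm (g (x + s *\<^sub>R v)) powr p)) \<partial>lborel)"
      proof (cases "x \<in> U")
        case True
        have "ennreal (\<bar>u (x + v) - u x\<bar> powr p) \<le>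
            (\<integral>\<^sup>+s. indicator {0..1} s * ennreal (\<bar>g (x + s *\<^sub>R v) \<bullet> v\<bar> powr p) \<partial>lborel)"
          using x True jensen_unit_interval[of "\<lambda>s. g (x + s *\<^sub>R v) \<bullet> v" p] p by simp
        also have "\<dots> \<le> (\<integral>\<^sup>+s. indicator {0..1} s * (ennreal (norm v powr p) * ennreal (norm (g (x + s *\<^sub>R v)) powr p)) \<partial>lborel)"
        proof (intro nn_integral_mono mult_left_mono)
          fix s
          have "\<bar>g (x + s *\<^sub>R v) \<bullet> v\<bar> powr p \<le> (norm (g (x + s *\<^sub>R v)) * norm v) powr p"
            using p by (intro powr_mono2 Cauchy_Schwarz_ineq2) auto
          then show "ennreal (\<bar>g (x + s *\<^sub>R v) \<bullet> v\<bar> powr p) \<le> ennreal (norm v powr p) * ennreal (norm (g (x + s *\<^sub>R v)) powr p)"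
            by (simp add: powr_mult mult.commute ennreal_leI flip: ennreal_mult)
        qed simp
        finally show ?thesis using True by simp
      qed simp
    qed
  qed
  also have "\<dots> = (\<integral>\<^sup>+s. (\<integral>\<^sup>+x. indicator {0..1::real} s * (ennreal (norm v powr p) * ennreal (norm (g (x + s *\<^sub>R v)) powr p)) \<partial>lborel) \<partial>lborel)"
    by (rule lborel_pair.Fubini') measurable
  also have "\<dots> = (\<integral>\<^sup>+s. indicator {0..1::real} s * (ennreal (norm v powr p) * (\<integral>\<^sup>+x. ennreal (norm (g x) powr p) \<partial>lborel)) \<partial>lborel)"
  proof (rule nn_integral_cong)
    fix s :: real
    show "(\<integral>\<^sup>+x. indicator {0..1} s * (ennreal (norm v powr p) * ennreal (norm (g (x + s *\<^sub>R v)) powr p)) \<partial>lborel)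
      = indicator {0..1::real} s * (ennreal (norm v powr p) * (\<integral>\<^sup>+x. ennreal (norm (g x) powr p) \<partial>lborel))"
      using nn_integral_lborel_translate[of "\<lambda>x. ennreal (norm (g x) powr p)" "s *\<^sub>R v"]
      by (simp add: nn_integral_cmult)
  qed
  also have "\<dots> = ennreal (norm v powr p) * (\<integral>\<^sup>+x. ennreal (norm (g x) powr p) \<partial>lborel)"
    by (simp add: nn_integral_multc)
  finally show ?thesis unfolding U_def .
qed

text \<open>The segment from x to \<open>x + h\<close> may leave \<Omega>. Both points are joined
  instead to \<open>x + h + t *\<^sub>R e\<close>, with e the cone direction at x, which serves the
  nearby point \<open>x + h\<close> as well. The constant collects 2 for the two segments,
  \<open>2 powr p\<close> for splitting the difference, \<open>3 / \<epsilon>\<close> for their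
  length, and \<open>card F\<close> because e varies with x and all directions are summed.\<close>

lemma difference_le_gradient:
  fixes u :: "'a::euclidean_space \<Rightarrow> real"
  assumes wg: "weak_gradient_on \<Omega> u g" and \<Omega>: "open \<Omega>" and p: "1 \<le> p"
    and cone: "uniform_cone \<Omega> \<rho> \<epsilon> F" and h: "norm h < \<epsilon> * \<rho> / 3"
  shows "(\<integral>\<^sup>+x. ennreal (\<bar>u (x + h) - u x\<bar> powr p) * (indicator \<Omega> x * indicator \<Omega> (x + h)) \<partial>lborel)
    \<le> ennreal (2 * 2 powr p * real (card F) * (3 / \<epsilon>) powr p * norm h powr p) *
      (\<integral>\<^sup>+x. ennreal (norm (g x) powr p) \<partial>lborel)"
proof (cases "h = 0")
  case True
  then show ?thesis using p by simp
next
  case False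
  have u: "integrable lborel u" and g: "integrable lborel g" using wg by (auto simp: weak_gradient_on_def)
  have um[measurable]: "u \<in> borel_measurable borel" using borel_measurable_integrable[OF u] by simp
  have \<rho>: "0 < \<rho>" and \<epsilon>: "0 < \<epsilon>" "\<epsilon> \<le> 1" and F: "finite F" "\<And>e. e \<in> F \<Longrightarrow> norm e = 1"
    using cone unfolding uniform_cone_def by auto
  define G where "G = (\<integral>\<^sup>+x. ennreal (norm (g x) powr p) \<partial>lborel)"
  define U where "U v = {x. \<forall>s\<in>{0..1}. x + s *\<^sub>R v \<in> \<Omega>}" for v
  have Um[measurable]: "U v \<in> sets borel" for v
    unfolding U_def using open_segment_translates[OF \<Omega>] by (rule borel_open)
  \<comment> \<open>Now \<open>norm h\<close> is half of \<open>\<epsilon> * t\<close>, so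
    \<open>h + t *\<^sub>R e\<close> lies strictly inside the cone about \<open>e\<close>. Both
    segments have length at most \<open>3 * norm h / \<epsilon>\<close>, which is below
    \<open>\<rho>\<close> by the assumption on \<open>norm h\<close>.\<close>
  define t where "t = 2 * norm h / \<epsilon>"
  have t: "0 < t" "\<epsilon> * t = 2 * norm h" using \<epsilon> False by (auto simp: t_def)
  have ht: "norm h \<le> norm h / \<epsilon>" using \<epsilon> mult_right_mono[of \<epsilon> 1 "norm h"] by (simp add: pos_le_divide_eq mult.commute)
  have hr: "3 * norm h / \<epsilon> < \<rho>" using h \<epsilon> by (simp add: field_simps)
  define A where "A e x = ennreal (\<bar>u (x + (h + t *\<^sub>R e)) - u x\<bar> powr p) * indicator (U (h + t *\<^sub>R e)) x" for e x
  define B where "B e x = ennreal (\<bar>u (x + t *\<^sub>R e) - u x\<bar> powr p) * indicator (U (t *\<^sub>R e)) x" for e x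
  have Am[measurable]: "A e \<in> borel_measurable borel" for e unfolding A_def by measurable
  have Bm[measurable]: "B e \<in> borel_measurable borel" for e unfolding B_def by measurable
  have norms: "norm (h + t *\<^sub>R e) \<le> 3 / \<epsilon> * norm h" "norm (t *\<^sub>R e) \<le> 3 / \<epsilon> * norm h" if "e \<in> F" for e
  proof -
    have "norm (t *\<^sub>R e) = 2 * norm h / \<epsilon>" using t(1) F(2)[OF that] \<epsilon> by (simp add: t_def)
    then show "norm (h + t *\<^sub>R e) \<le> 3 / \<epsilon> * norm h"
      using norm_triangle_ineq[of h "t *\<^sub>R e"] ht by simp
    show "norm (t *\<^sub>R e) \<le> 3 / \<epsilon> * norm h"
      using \<open>norm (t *\<^sub>R e) = 2 * norm h / \<epsilon>\<close> \<epsilon> by (simp add: divide_right_mono)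
  qed
  have pw: "ennreal (\<bar>u (x + h) - u x\<bar> powr p) * (indicator \<Omega> x * indicator \<Omega> (x + h))
     \<le> (\<Sum>e\<in>F. ennreal (2 powr p) * (A e x + B e (x + h)))" for x
  proof (cases "x \<in> \<Omega> \<and> x + h \<in> \<Omega>")
    case False
    then show ?thesis by auto
  next
    case x: True
    then obtain e where e: "e \<in> F" and E: "\<And>y t v. y \<in> \<Omega> \<inter> ball x \<rho> \<Longrightarrow>
        norm (v - t *\<^sub>R e) < \<epsilon> * t \<Longrightarrow> norm v < \<rho> \<Longrightarrow> y + v \<in> \<Omega>"
      using cone unfolding uniform_cone_def by metis
    have "x \<in> U (h + t *\<^sub>R e)"
      unfolding U_def
    proof (intro CollectI ballI)
      fix s :: real assume s: "s \<in> {0..1}"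
      show "x + s *\<^sub>R (h + t *\<^sub>R e) \<in> \<Omega>"
      \<comment> \<open>The cone does not contain its apex, so the starting point of the segment is
        treated apart.\<close>
      proof (cases "s = 0")
        case True
        then show ?thesis using x by simp
      next
        case False
        have "norm (s *\<^sub>R (h + t *\<^sub>R e) - (s * t) *\<^sub>R e) = s * norm h"
          using s by (simp add: scaleR_add_right)
        also have "\<dots> < s * (\<epsilon> * t)" using False s t \<open>h \<noteq> 0\<close> by simp
        finally have 1: "norm (s *\<^sub>R (h + t *\<^sub>R e) - (s * t) *\<^sub>R e) < \<epsilon> * (s * t)" by (simp add: mult_ac)
        have "norm (s *\<^sub>R (h + t *\<^sub>R e)) \<le> 1 * norm (h + t *\<^sub>R e)"
          using s unfolding norm_scaleR by (intro mult_right_mono) auto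
        then have 2: "norm (s *\<^sub>R (h + t *\<^sub>R e)) < \<rho>" using norms(1)[OF e] hr by simp
        show ?thesis by (rule E[OF _ 1 2]) (use x \<rho> in auto)
      qed
    qed
    moreover have "x + h \<in> U (t *\<^sub>R e)"
      unfolding U_def
    proof (intro CollectI ballI)
      fix s :: real assume s: "s \<in> {0..1}"
      show "x + h + s *\<^sub>R (t *\<^sub>R e) \<in> \<Omega>"
      proof (cases "s = 0")
        case True
        then show ?thesis using x by simp
      next
        case False
        have 1: "norm (s *\<^sub>R (t *\<^sub>R e) - (s * t) *\<^sub>R e) < \<epsilon> * (s * t)"
          using False s t \<epsilon> by simp
        have "norm (s *\<^sub>R (t *\<^sub>R e)) \<le> 1 * norm (t *\<^sub>R e)"
          using s unfolding norm_scaleR[of s] by (intro mult_right_mono) auto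
        then have 2: "norm (s *\<^sub>R (t *\<^sub>R e)) < \<rho>" using norms(2)[OF e] hr by simp
        have "0 \<le> norm h / \<epsilon>" using \<epsilon> by simp
        then have "norm h < \<rho>" using hr ht by linarith
        then show ?thesis by (intro E[OF _ 1 2]) (use x in \<open>auto simp: dist_norm\<close>)
      qed
    qed
    moreover have "\<bar>u (x + h) - u x\<bar> powr p \<le>
       2 powr p * (\<bar>u (x + (h + t *\<^sub>R e)) - u x\<bar> powr p + \<bar>u (x + h + t *\<^sub>R e) - u (x + h)\<bar> powr p)"
      using abs_diff_powr_le[of p "u (x + (h + t *\<^sub>R e)) - u x" "u (x + h + t *\<^sub>R e) - u (x + h)"] p
      by (simp add: add.assoc)
    ultimately have "ennreal (\<bar>u (x + h) - u x\<bar> powr p) \<le> ennreal (2 powr p) * (A e x + B e (x + h))"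
      unfolding A_def B_def by (simp add: ennreal_leI flip: ennreal_plus ennreal_mult')
    also have "\<dots> \<le> (\<Sum>e\<in>F. ennreal (2 powr p) * (A e x + B e (x + h)))"
      using F(1) e by (intro member_le_sum) auto
    finally show ?thesis using x by simp
  qed
  have bnd: "(\<integral>\<^sup>+x. ennreal (2 powr p) * (A e x + B e (x + h)) \<partial>lborel)
    \<le> ennreal (2 * 2 powr p * (3 / \<epsilon>) powr p * norm h powr p) * G" if e: "e \<in> F" for e
  proof -
    have nb: "ennreal (norm v powr p) * G \<le> ennreal ((3 / \<epsilon>) powr p * norm h powr p) * G"
      if "norm v \<le> 3 / \<epsilon> * norm h" for v :: 'a
    proof -
      have "norm v powr p \<le> (3 / \<epsilon> * norm h) powr p" using that p by (intro powr_mono2) auto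
      also have "\<dots> = (3 / \<epsilon>) powr p * norm h powr p" using \<epsilon> by (intro powr_mult)
      finally show ?thesis by (intro mult_right_mono ennreal_leI) auto
    qed
    have a: "(\<integral>\<^sup>+x. A e x \<partial>lborel) \<le> ennreal ((3 / \<epsilon>) powr p * norm h powr p) * G"
      using translate_difference_le_gradient[OF wg \<Omega> p, of "h + t *\<^sub>R e"] nb[OF norms(1)[OF e]]
      unfolding A_def U_def G_def by (rule order_trans)
    have b: "(\<integral>\<^sup>+x. B e (x + h) \<partial>lborel) \<le> ennreal ((3 / \<epsilon>) powr p * norm h powr p) * G"
      using translate_difference_le_gradient[OF wg \<Omega> p, of "t *\<^sub>R e"] nb[OF norms(2)[OF e]]
      unfolding nn_integral_lborel_translate[OF Bm] unfolding B_def U_def G_def by (rule order_trans)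
    have "(\<integral>\<^sup>+x. ennreal (2 powr p) * (A e x + B e (x + h)) \<partial>lborel)
       = ennreal (2 powr p) * ((\<integral>\<^sup>+x. A e x \<partial>lborel) + (\<integral>\<^sup>+x. B e (x + h) \<partial>lborel))"
      by (subst nn_integral_cmult, measurable) (subst nn_integral_add, auto)
    also have "\<dots> \<le> ennreal (2 powr p) * (ennreal ((3 / \<epsilon>) powr p * norm h powr p) * G + ennreal ((3 / \<epsilon>) powr p * norm h powr p) * G)"
      by (intro mult_left_mono add_mono a b) auto
    also have "\<dots> = ennreal (2 powr p) * (ennreal ((3 / \<epsilon>) powr p * norm h powr p + (3 / \<epsilon>) powr p * norm h powr p) * G)"
      by (subst ennreal_plus) (auto simp only: distrib_right powr_ge_zero mult_nonneg_nonneg)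
    also have "\<dots> = ennreal (2 * 2 powr p * (3 / \<epsilon>) powr p * norm h powr p) * G"
    proof -
      have "2 * 2 powr p * (3 / \<epsilon>) powr p * norm h powr p = 2 powr p * ((3 / \<epsilon>) powr p * norm h powr p + (3 / \<epsilon>) powr p * norm h powr p)"
        by (simp add: algebra_simps)
      then show ?thesis by (simp add: ennreal_mult mult_ac)
    qed
    finally show ?thesis .
  qed
  have "(\<integral>\<^sup>+x. ennreal (\<bar>u (x + h) - u x\<bar> powr p) * (indicator \<Omega> x * indicator \<Omega> (x + h)) \<partial>lborel)
     \<le> (\<integral>\<^sup>+x. (\<Sum>e\<in>F. ennreal (2 powr p) * (A e x + B e (x + h))) \<partial>lborel)"
    by (intro nn_integral_mono pw)
  also have "\<dots> = (\<Sum>e\<in>F. (\<integral>\<^sup>+x. ennreal (2 powr p) * (A e x + B e (x + h)) \<partial>lborel))"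
    by (intro nn_integral_sum) measurable
  also have "\<dots> \<le> (\<Sum>e\<in>F. ennreal (2 * 2 powr p * (3 / \<epsilon>) powr p * norm h powr p) * G)"
    by (intro sum_mono bnd)
  also have "\<dots> = ennreal (2 * 2 powr p * real (card F) * (3 / \<epsilon>) powr p * norm h powr p) * G"
  proof -
    have "2 * 2 powr p * real (card F) * (3 / \<epsilon>) powr p * norm h powr p = real (card F) * (2 * 2 powr p * (3 / \<epsilon>) powr p * norm h powr p)"
      by simp
    then show ?thesis by (simp add: ennreal_mult ennreal_of_nat_eq_real_of_nat mult_ac)
  qed
  finally show ?thesis unfolding G_def .
qed

text \<open>In the variable \<open>h = y - x\<close>, small h are handled by
  \<open>difference_le_gradient\<close>; the remaining weight
  \<open>norm h powr (p - \<beta>)\<close> is integrable at 0 because \<open>\<tau> < 1\<close>. For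
  larger h the kernel is bounded and the L^p norm of u suffices.\<close>

lemma gradient_bounds_gagliardo:
  fixes \<Omega> :: "'a::euclidean_space set"
  assumes \<Omega>: "open \<Omega>" "bounded \<Omega>" and cone: "uniform_cone \<Omega> \<rho> \<epsilon> F"
    and p: "1 \<le> p" and \<tau>: "0 < \<tau>" "\<tau> < 1"
  shows "\<exists>K. \<forall>u g. weak_gradient_on \<Omega> u g \<longrightarrow>
    (\<integral>\<^sup>+x. (\<integral>\<^sup>+y. ennreal (\<bar>u x - u y\<bar> powr p / norm (x - y) powr (real DIM('a) + \<tau> * p)) *
       (indicator \<Omega> x * indicator \<Omega> y) \<partial>lborel) \<partial>lborel)
    \<le> ennreal K * ((\<integral>\<^sup>+x. ennreal (norm (g x) powr p) \<partial>lborel) +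
         (\<integral>\<^sup>+x. ennreal (\<bar>u x\<bar> powr p) * indicator \<Omega> x \<partial>lborel))"
proof -
  have \<rho>: "0 < \<rho>" and \<epsilon>: "0 < \<epsilon>"
    using cone unfolding uniform_cone_def by auto
  define \<delta> where "\<delta> = \<epsilon> * \<rho> / 3"
  have \<delta>: "\<delta> > 0" using \<rho> \<epsilon> by (simp add: \<delta>_def)
  define \<beta> where "\<beta> = real DIM('a) + \<tau> * p"
  have \<beta>: "\<beta> > 0" using p \<tau> by (auto simp: \<beta>_def intro!: add_pos_pos)
  obtain R where R: "\<And>x. x \<in> \<Omega> \<Longrightarrow> norm x < R"
    using \<Omega>(2) unfolding bounded_pos_less by blast
  define K1 where "K1 = 2 * 2 powr p * real (card F) * (3 / \<epsilon>) powr p"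
  define K2 where "K2 = \<delta> powr (- \<beta>) * 2 powr p * 2"
  define I1 where "I1 = (\<integral>\<^sup>+h. ennreal (norm (h::'a) powr (p - \<beta>)) * indicator (ball 0 \<delta>) h \<partial>lborel)"
  \<comment> \<open>Differences of points of \<open>\<Omega>\<close> lie in this ball, so the region
    of large \<open>h\<close> has finite measure.\<close>
  define I2 where "I2 = emeasure lborel (ball (0::'a) (2 * R))"
  have "\<tau> * p < p" using p \<tau> by simp
  then have I1: "I1 < \<infinity>" unfolding I1_def by (intro radial_integral_finite) (simp add: \<beta>_def)
  have I2: "I2 < \<infinity>" unfolding I2_def using emeasure_bounded_finite[OF bounded_ball] by simp
  define K where "K = K1 * enn2real I1 + K2 * enn2real I2"
  have K12: "K1 \<ge> 0" "K2 \<ge> 0" by (auto simp: K1_def K2_def)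
  have "(\<integral>\<^sup>+x. (\<integral>\<^sup>+y. ennreal (\<bar>u x - u y\<bar> powr p / norm (x - y) powr (real DIM('a) + \<tau> * p)) *
       (indicator \<Omega> x * indicator \<Omega> y) \<partial>lborel) \<partial>lborel)
    \<le> ennreal K * ((\<integral>\<^sup>+x. ennreal (norm (g x) powr p) \<partial>lborel) +
         (\<integral>\<^sup>+x. ennreal (\<bar>u x\<bar> powr p) * indicator \<Omega> x \<partial>lborel))"
    if wg: "weak_gradient_on \<Omega> u g" for u g
  proof -
    have u: "integrable lborel u" using wg by (auto simp: weak_gradient_on_def)
    have um[measurable]: "u \<in> borel_measurable borel" using borel_measurable_integrable[OF u] by simp
    have \<Omega>m[measurable]: "\<Omega> \<in> sets borel" using \<Omega>(1) by (rule borel_open)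
    define G where "G = (\<integral>\<^sup>+x. ennreal (norm (g x) powr p) \<partial>lborel)"
    define M where "M = (\<integral>\<^sup>+x. ennreal (\<bar>u x\<bar> powr p) * indicator \<Omega> x \<partial>lborel)"
    define k where "k x h = ennreal (\<bar>u (x + h) - u x\<bar> powr p / norm h powr \<beta>) * (indicator \<Omega> x * indicator \<Omega> (x + h))" for x h
    have km[measurable]: "(\<lambda>(x, h). k x h) \<in> borel_measurable (borel \<Otimes>\<^sub>M borel)"
      unfolding k_def by measurable
    have J: "(\<integral>\<^sup>+x. k x h \<partial>lborel) \<le> ennreal (norm h powr (p - \<beta>)) * indicator (ball 0 \<delta>) h * (ennreal K1 * G) +
       indicator (ball 0 (2 * R)) h * (ennreal K2 * M)" for h
    proof (cases "norm h < \<delta>")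
      case True
      have "(\<integral>\<^sup>+x. k x h \<partial>lborel) = (\<integral>\<^sup>+x. ennreal (norm h powr (- \<beta>)) *
         (ennreal (\<bar>u (x + h) - u x\<bar> powr p) * (indicator \<Omega> x * indicator \<Omega> (x + h))) \<partial>lborel)"
        unfolding k_def by (simp add: powr_minus divide_inverse mult_ac flip: ennreal_mult)
      also have "\<dots> = ennreal (norm h powr (- \<beta>)) *
         (\<integral>\<^sup>+x. ennreal (\<bar>u (x + h) - u x\<bar> powr p) * (indicator \<Omega> x * indicator \<Omega> (x + h)) \<partial>lborel)"
        by (intro nn_integral_cmult) measurable
      also have "\<dots> \<le> ennreal (norm h powr (- \<beta>)) * (ennreal (K1 * norm h powr p) * G)"
        using difference_le_gradient[OF wg \<Omega>(1) p cone True[unfolded \<delta>_def]]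
        unfolding K1_def G_def by (intro mult_left_mono) auto
      also have "\<dots> = ennreal (norm h powr (p - \<beta>)) * (ennreal K1 * G)"
      proof -
        have "norm h powr (- \<beta>) * (K1 * norm h powr p) = norm h powr (p - \<beta>) * K1"
          by (simp add: powr_diff powr_minus divide_inverse)
        then have "ennreal (norm h powr (- \<beta>)) * ennreal (K1 * norm h powr p) = ennreal (norm h powr (p - \<beta>)) * ennreal K1"
          using K12 by (simp flip: ennreal_mult)
        then show ?thesis by (simp flip: mult.assoc)
      qed
      finally show ?thesis using True by (simp add: add_increasing2)
    next
      case False
      have "k x h \<le> indicator (ball 0 (2 * R)) h * (ennreal (\<delta> powr (- \<beta>) * 2 powr p) *
         (ennreal (\<bar>u (x + h)\<bar> powr p) * indicator \<Omega> (x + h) + ennreal (\<bar>u x\<bar> powr p) * indicator \<Omega> x))" for x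
      proof (cases "x \<in> \<Omega> \<and> x + h \<in> \<Omega>")
        case x: True
        have "norm h \<le> norm (x + h) + norm x" using norm_triangle_ineq4[of "x + h" x] by simp
        then have h2: "h \<in> ball 0 (2 * R)" using x R[of x] R[of "x + h"] by simp
        have "inverse (norm h powr \<beta>) \<le> \<delta> powr (- \<beta>)"
          using False \<delta> \<beta> powr_mono2[of \<beta> \<delta> "norm h"] by (simp add: powr_minus le_imp_inverse_le)
        then have "\<bar>u (x + h) - u x\<bar> powr p * inverse (norm h powr \<beta>) \<le>
            (2 powr p * (\<bar>u (x + h)\<bar> powr p + \<bar>u x\<bar> powr p)) * \<delta> powr (- \<beta>)"
          using p by (intro mult_mono abs_diff_powr_le) auto
        then have "\<bar>u (x + h) - u x\<bar> powr p / norm h powr \<beta> \<le>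
            (\<delta> powr (- \<beta>) * 2 powr p) * (\<bar>u (x + h)\<bar> powr p + \<bar>u x\<bar> powr p)"
          by (simp add: divide_inverse mult_ac)
        then show ?thesis
          using x h2 by (simp add: k_def ennreal_leI flip: ennreal_plus ennreal_mult')
      qed (auto simp: k_def)
      then have "(\<integral>\<^sup>+x. k x h \<partial>lborel) \<le> (\<integral>\<^sup>+x. indicator (ball 0 (2 * R)) h * (ennreal (\<delta> powr (- \<beta>) * 2 powr p) *
         (ennreal (\<bar>u (x + h)\<bar> powr p) * indicator \<Omega> (x + h) + ennreal (\<bar>u x\<bar> powr p) * indicator \<Omega> x)) \<partial>lborel)"
        by (intro nn_integral_mono)
      also have "\<dots> = indicator (ball 0 (2 * R)) h * (ennreal (\<delta> powr (- \<beta>) * 2 powr p) *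
         (\<integral>\<^sup>+x. (ennreal (\<bar>u (x + h)\<bar> powr p) * indicator \<Omega> (x + h) + ennreal (\<bar>u x\<bar> powr p) * indicator \<Omega> x) \<partial>lborel))"
        by (simp add: nn_integral_cmult)
      also have "(\<integral>\<^sup>+x. (ennreal (\<bar>u (x + h)\<bar> powr p) * indicator \<Omega> (x + h) + ennreal (\<bar>u x\<bar> powr p) * indicator \<Omega> x) \<partial>lborel)
         = M + M"
        using nn_integral_lborel_translate[of "\<lambda>x. ennreal (\<bar>u x\<bar> powr p) * indicator \<Omega> x" h]
        by (subst nn_integral_add) (auto simp: M_def)
      also have "ennreal (\<delta> powr (- \<beta>) * 2 powr p) * (M + M) = ennreal K2 * M"
      proof -
        have "K2 = \<delta> powr (- \<beta>) * 2 powr p + \<delta> powr (- \<beta>) * 2 powr p" by (simp add: K2_def)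
        then have "ennreal K2 = ennreal (\<delta> powr (- \<beta>) * 2 powr p) + ennreal (\<delta> powr (- \<beta>) * 2 powr p)"
          by (simp only:) (rule ennreal_plus, auto)
        then show ?thesis by (simp only: distrib_left distrib_right)
      qed
      finally show ?thesis by (simp add: add_increasing)
    qed
    have "(\<integral>\<^sup>+x. (\<integral>\<^sup>+y. ennreal (\<bar>u x - u y\<bar> powr p / norm (x - y) powr (real DIM('a) + \<tau> * p)) *
       (indicator \<Omega> x * indicator \<Omega> y) \<partial>lborel) \<partial>lborel) = (\<integral>\<^sup>+x. (\<integral>\<^sup>+h. k x h \<partial>lborel) \<partial>lborel)"
    proof (rule nn_integral_cong)
      fix x
      show "(\<integral>\<^sup>+y. ennreal (\<bar>u x - u y\<bar> powr p / norm (x - y) powr (real DIM('a) + \<tau> * p)) *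
       (indicator \<Omega> x * indicator \<Omega> y) \<partial>lborel) = (\<integral>\<^sup>+h. k x h \<partial>lborel)"
        by (subst nn_integral_lborel_translate[of _ x, symmetric])
           (auto simp: k_def[abs_def] \<beta>_def add.commute[of _ x] abs_minus_commute[of "u x"])
    qed
    also have "\<dots> = (\<integral>\<^sup>+h. (\<integral>\<^sup>+x. k x h \<partial>lborel) \<partial>lborel)"
      by (rule lborel_pair.Fubini'[symmetric]) simp
    also have "\<dots> \<le> (\<integral>\<^sup>+(h::'a). ennreal (norm h powr (p - \<beta>)) * indicator (ball 0 \<delta>) h * (ennreal K1 * G) +
       indicator (ball 0 (2 * R)) h * (ennreal K2 * M) \<partial>lborel)"
      by (intro nn_integral_mono J)
    also have "\<dots> = I1 * (ennreal K1 * G) + I2 * (ennreal K2 * M)"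
    proof -
      have [measurable]: "ball (0::'a) r \<in> sets borel" for r by simp
      have 1: "(\<lambda>h::'a. ennreal (norm h powr (p - \<beta>)) * indicator (ball 0 \<delta>) h) \<in> borel_measurable lborel"
        by (intro borel_measurable_times_ennreal borel_measurable_indicator) auto
      have 2: "(indicator (ball 0 (2 * R)) :: 'a \<Rightarrow> ennreal) \<in> borel_measurable lborel"
        by (intro borel_measurable_indicator) auto
      have "(\<integral>\<^sup>+h. ennreal (norm h powr (p - \<beta>)) * indicator (ball 0 \<delta>) h * (ennreal K1 * G) +
          indicator (ball (0::'a) (2 * R)) h * (ennreal K2 * M) \<partial>lborel) =
         (\<integral>\<^sup>+h. ennreal (norm (h::'a) powr (p - \<beta>)) * indicator (ball 0 \<delta>) h * (ennreal K1 * G) \<partial>lborel) +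
         (\<integral>\<^sup>+h. indicator (ball (0::'a) (2 * R)) h * (ennreal K2 * M) \<partial>lborel)"
        using 1 2 by (intro nn_integral_add borel_measurable_times_ennreal borel_measurable_const) auto
      then show ?thesis unfolding I1_def I2_def nn_integral_multc[OF 1] nn_integral_multc[OF 2] by simp
    qed
    also have "\<dots> = ennreal (K1 * enn2real I1) * G + ennreal (K2 * enn2real I2) * M"
      using I1 I2 K12 by (simp add: ennreal_mult mult_ac)
    also have "\<dots> \<le> ennreal K * G + ennreal K * M"
      using K12 by (intro add_mono mult_right_mono ennreal_leI) (auto simp: K_def)
    finally show ?thesis by (simp add: G_def M_def distrib_left)
  qed
  then show ?thesis by blast
qed

section \<open>Gain of integrability\<close>

text \<open>For orders below 1 the domain acts only through its measure: a lower bound on balls and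
  a uniform bound on weakly singular potentials. Measurability of the identity is stated because the
  intended measure \<open>lebesgue_on \<Omega>\<close> lives on Lebesgue sets rather than on Borel
  sets.\<close>

locale regular_measure = finite_measure M for M :: "'a::euclidean_space measure" +
  fixes \<kappa> :: real
  assumes measurable_ident_borel [measurable]: "(\<lambda>x. x) \<in> borel_measurable M"
    and bounded_space: "bounded (space M)"
    and \<kappa>: "0 < \<kappa>"
    and ball_lower: "x \<in> space M \<Longrightarrow> 0 < r \<Longrightarrow> r \<le> 1 \<Longrightarrow>
       ennreal (\<kappa> * r ^ DIM('a)) \<le> emeasure M (space M \<inter> ball x r)"
    and radial_bound: "0 < \<eta> \<Longrightarrow>
       \<exists>K\<ge>0. \<forall>x\<in>space M. (\<integral>\<^sup>+y. ennreal (norm (x - y) powr (\<eta> - real DIM('a))) \<partial>M) \<le> ennreal K"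
begin

definition mass :: "real \<Rightarrow> ('a \<Rightarrow> real) \<Rightarrow> ennreal" where
  "mass q u = (\<integral>\<^sup>+x. ennreal (\<bar>u x\<bar> powr q) \<partial>M)"

text \<open>The p-th power of the seminorm without its normalising constant, iterated so that the
  inner integral can be estimated at fixed x. On the diagonal the quotient is 0 / 0, which is
  0.\<close>

definition gagliardo :: "real \<Rightarrow> real \<Rightarrow> ('a \<Rightarrow> real) \<Rightarrow> ennreal" where
  "gagliardo s p u = (\<integral>\<^sup>+x. (\<integral>\<^sup>+y. ennreal (\<bar>u x - u y\<bar> powr p / norm (x - y) powr (real DIM('a) + s * p)) \<partial>M) \<partial>M)"

lemma measurable_ball [measurable]: "space M \<inter> ball x r \<in> sets M"
proof -
  have "{y \<in> space M. dist x y < r} \<in> sets M" by measurable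
  moreover have "{y \<in> space M. dist x y < r} = space M \<inter> ball x r" by auto
  ultimately show ?thesis by simp
qed

lemma mass_le_mass:
  assumes "u \<in> borel_measurable M" "0 < q" "q \<le> Q"
  shows "mass q u \<le> mass Q u + emeasure M (space M)"
proof -
  note assms(1)[measurable]
  have "mass q u \<le> (\<integral>\<^sup>+x. ennreal (\<bar>u x\<bar> powr Q) + 1 \<partial>M)"
    unfolding mass_def
  proof (rule nn_integral_mono)
    fix x
    have "\<bar>u x\<bar> powr q \<le> \<bar>u x\<bar> powr Q + 1"
    proof (cases "\<bar>u x\<bar> \<le> 1")
      case True
      then have "\<bar>u x\<bar> powr q \<le> 1" using assms by (intro powr_le1) auto
      then show ?thesis using powr_ge_zero[of "\<bar>u x\<bar>" Q] by linarith
    next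
      case False
      then have "\<bar>u x\<bar> powr q \<le> \<bar>u x\<bar> powr Q" using assms by (intro powr_mono) auto
      then show ?thesis by linarith
    qed
    then show "ennreal (\<bar>u x\<bar> powr q) \<le> ennreal (\<bar>u x\<bar> powr Q) + 1"
      using ennreal_leI by fastforce
  qed
  also have "\<dots> = mass Q u + emeasure M (space M)"
    unfolding mass_def by (subst nn_integral_add) auto
  finally show ?thesis .
qed

lemma gagliardo_kernel_measurable:
  assumes [measurable]: "u \<in> borel_measurable M"
  shows "(\<lambda>(x, y). ennreal (\<bar>u x - u y\<bar> powr p / norm (x - y) powr \<beta>)) \<in> borel_measurable (M \<Otimes>\<^sub>M M)"
  by measurable

text \<open>The points \<open>y\<close> of a small ball around \<open>x\<close> where \<open>\<bar>u y\<bar> \<le> \<bar>u x\<bar> / 2\<close> are controlled by the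
  difference quotient and the others by \<open>mass Q u\<close>; the radius is chosen such that the latter
  fill at most half of the lower bound \<open>\<kappa> * r ^ DIM('a)\<close>.\<close>

lemma pointwise_gain:
  assumes u [measurable]: "u \<in> borel_measurable M" and x: "x \<in> space M"
    and s: "0 < s" and p: "0 < p" and Q: "0 < Q" and B: "0 < B" "mass Q u \<le> ennreal B"
  shows "ennreal (\<bar>u x\<bar> powr (p * (1 + s * Q / real DIM('a)))) \<le>
     ennreal ((2 * (2 * B / \<kappa>) powr (1 / Q)) powr (p * (1 + s * Q / real DIM('a)))) +
     ennreal (2 powr (p * (1 + s * Q / real DIM('a))) * (2 / \<kappa>) * (2 * B / \<kappa>) powr (s * p / real DIM('a))) *
     (\<integral>\<^sup>+y. ennreal (\<bar>u x - u y\<bar> powr p / norm (x - y) powr (real DIM('a) + s * p)) \<partial>M)"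
proof -
  define N where "N = real DIM('a)"
  have N: "N > 0" by (simp add: N_def)
  define g where "g = (\<integral>\<^sup>+y. ennreal (\<bar>u x - u y\<bar> powr p / norm (x - y) powr (N + s * p)) \<partial>M)"
  define a where "a = \<bar>u x\<bar>"
  define L where "L = 2 * B / \<kappa>"
  have L: "L > 0" using B \<kappa> by (simp add: L_def)
  define \<alpha> where "\<alpha> = p * (1 + s * Q / N)"
  have \<alpha>: "\<alpha> > 0" unfolding \<alpha>_def using s p Q N by (intro mult_pos_pos add_pos_pos divide_pos_pos) auto
  have "ennreal (a powr \<alpha>) \<le> ennreal ((2 * L powr (1 / Q)) powr \<alpha>) +
     ennreal (2 powr \<alpha> * (2 / \<kappa>) * L powr (s * p / N)) * g"
  \<comment> \<open>Below the threshold the first summand pays. Above it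
    \<open>L * b powr (- Q) \<le> 1\<close>, so the radius \<open>r\<close> is at most 1 and
    \<open>ball_lower\<close> applies.\<close>
  proof (cases "a \<le> 2 * L powr (1 / Q)")
    case True
    then have "a powr \<alpha> \<le> (2 * L powr (1 / Q)) powr \<alpha>"
      using \<alpha> by (intro powr_mono2) (auto simp: a_def)
    then show ?thesis by (intro add_increasing2) (auto intro: ennreal_leI)
  next
    case False
    have a: "a > 0" using False L by (smt (verit) powr_ge_zero)
    define b where "b = a / 2"
    have b: "b > 0" "L powr (1 / Q) < b" using a False by (auto simp: b_def)
    define r where "r = (L * b powr (- Q)) powr (1 / N)"
    have r0: "r > 0" using L b by (simp add: r_def)
    have "L < b powr Q"
    proof -
      have "(L powr (1 / Q)) powr Q < b powr Q" using b Q L by (intro powr_less_mono2) auto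
      then show ?thesis using L Q by (simp add: powr_powr)
    qed
    then have "L * b powr (- Q) \<le> 1" using b by (simp add: powr_minus field_simps)
    then have r1: "r \<le> 1" unfolding r_def using N L b by (intro powr_le1) auto
    have rN: "r powr N = L * b powr (- Q)" using L b N by (simp add: r_def powr_powr)
    have rN': "r ^ DIM('a) = r powr N" using r0 by (simp add: N_def powr_realpow)
    have half: "b powr (- Q) * B = \<kappa> * r powr N / 2" using \<kappa> by (simp add: rN L_def)
    have "ennreal (\<kappa> * r powr N) \<le> emeasure M (space M \<inter> ball x r)"
      using ball_lower[OF x r0 r1] by (simp add: rN')
    also have "\<dots> = (\<integral>\<^sup>+y. indicator (space M \<inter> ball x r) y \<partial>M)" by simp
    also have "\<dots> \<le> (\<integral>\<^sup>+y. ennreal (b powr (- p) * r powr (N + s * p)) * ennreal (\<bar>u x - u y\<bar> powr p / norm (x - y) powr (N + s * p))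
        + ennreal (b powr (- Q)) * ennreal (\<bar>u y\<bar> powr Q) \<partial>M)"
    proof (rule nn_integral_mono)
      fix y
      show "indicator (space M \<inter> ball x r) y \<le> ennreal (b powr (- p) * r powr (N + s * p)) * ennreal (\<bar>u x - u y\<bar> powr p / norm (x - y) powr (N + s * p))
        + ennreal (b powr (- Q)) * ennreal (\<bar>u y\<bar> powr Q)"
      proof (cases "y \<in> space M \<inter> ball x r")
        case y: True
        consider "\<bar>u y\<bar> \<ge> b" | "\<bar>u y\<bar> < b" by linarith
        then have "1 \<le> b powr (- p) * r powr (N + s * p) * (\<bar>u x - u y\<bar> powr p / norm (x - y) powr (N + s * p)) \<or>
           1 \<le> b powr (- Q) * \<bar>u y\<bar> powr Q"
        proof cases
          case 1
          have "b powr Q \<le> \<bar>u y\<bar> powr Q" using 1 b Q by (intro powr_mono2) auto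
          then show ?thesis using b by (simp add: powr_minus field_simps)
        next
          case 2
          then have "b \<le> \<bar>u x - u y\<bar>"
            using abs_triangle_ineq2[of "u x" "u y"] by (simp add: b_def a_def)
          then have 3: "b powr p \<le> \<bar>u x - u y\<bar> powr p" using b p by (intro powr_mono2) auto
          have ne: "x \<noteq> y" using 2 a by (auto simp: b_def a_def)
          have 4: "norm (x - y) powr (N + s * p) \<le> r powr (N + s * p)"
            using y N s p by (intro powr_mono2) (auto simp: dist_norm)
          have "1 = b powr (- p) * norm (x - y) powr (N + s * p) * (b powr p / norm (x - y) powr (N + s * p))"
            using b ne by (simp add: powr_minus field_simps)
          also have "\<dots> \<le> b powr (- p) * r powr (N + s * p) * (\<bar>u x - u y\<bar> powr p / norm (x - y) powr (N + s * p))"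
            by (intro mult_mono mult_left_mono 4 divide_right_mono 3) auto
          finally show ?thesis by blast
        qed
        then have "1 \<le> b powr (- p) * r powr (N + s * p) * (\<bar>u x - u y\<bar> powr p / norm (x - y) powr (N + s * p)) +
           b powr (- Q) * \<bar>u y\<bar> powr Q"
        proof
          assume h: "1 \<le> b powr (- Q) * \<bar>u y\<bar> powr Q"
          have "0 \<le> b powr (- p) * r powr (N + s * p) * (\<bar>u x - u y\<bar> powr p / norm (x - y) powr (N + s * p))"
            by (intro mult_nonneg_nonneg divide_nonneg_nonneg) auto
          with h show ?thesis by linarith
        next
          assume h: "1 \<le> b powr (- p) * r powr (N + s * p) * (\<bar>u x - u y\<bar> powr p / norm (x - y) powr (N + s * p))"
          have "0 \<le> b powr (- Q) * \<bar>u y\<bar> powr Q" by (intro mult_nonneg_nonneg) auto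
          with h show ?thesis by linarith
        qed
        moreover define k where "k = \<bar>u x - u y\<bar> powr p / norm (x - y) powr (N + s * p)"
        moreover have "0 \<le> k" by (simp add: k_def)
        ultimately have "ennreal 1 \<le> ennreal (b powr (- p) * r powr (N + s * p) * k + b powr (- Q) * \<bar>u y\<bar> powr Q)"
          by (simp only: ennreal_leI)
        also have "\<dots> = ennreal (b powr (- p) * r powr (N + s * p)) * ennreal k + ennreal (b powr (- Q)) * ennreal (\<bar>u y\<bar> powr Q)"
          using \<open>0 \<le> k\<close> by (simp add: ennreal_plus ennreal_mult)
        finally show ?thesis using y by (simp add: k_def)
      qed simp
    qed
    also have "\<dots> = ennreal (b powr (- p) * r powr (N + s * p)) * g + ennreal (b powr (- Q)) * mass Q u"
      unfolding g_def mass_def by (subst nn_integral_add) (auto simp: nn_integral_cmult)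
    also have "\<dots> \<le> ennreal (b powr (- p) * r powr (N + s * p)) * g + ennreal (b powr (- Q)) * ennreal B"
      by (intro add_left_mono mult_left_mono B) auto
    also have "ennreal (b powr (- Q)) * ennreal B = ennreal (\<kappa> * r powr N / 2)"
      unfolding half[symmetric] using B by (intro ennreal_mult[symmetric]) auto
    finally have main: "ennreal (\<kappa> * r powr N) \<le> ennreal (b powr (- p) * r powr (N + s * p)) * g + ennreal (\<kappa> * r powr N / 2)" .
    have "ennreal (a powr \<alpha>) \<le> ennreal (2 powr \<alpha> * (2 / \<kappa>) * L powr (s * p / N)) * g"
    proof (cases "g = \<infinity>")
      case True
      have "2 powr \<alpha> * (2 / \<kappa>) * L powr (s * p / N) > 0" using L \<kappa> by simp
      then show ?thesis using True L \<kappa> by (simp add: ennreal_mult_top)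
    next
      case False
      then obtain \<gamma> where \<gamma>: "g = ennreal \<gamma>" "\<gamma> \<ge> 0" by (cases g) auto
      have "\<kappa> * r powr N \<le> b powr (- p) * r powr (N + s * p) * \<gamma> + \<kappa> * r powr N / 2"
        using main \<gamma> \<kappa> by (simp flip: ennreal_mult ennreal_plus)
      then have "\<kappa> / 2 * r powr N \<le> (b powr (- p) * r powr (s * p) * \<gamma>) * r powr N"
        by (simp add: powr_add mult_ac)
      \<comment> \<open>With \<open>r powr N\<close> cancelled, inserting \<open>r\<close> turns
        \<open>b powr (- p) * r powr (s * p)\<close> into a constant times
        \<open>b powr (- \<alpha>)\<close>; this is the origin of the exponent
        \<open>p * (1 + s * Q / N)\<close>.\<close>
      then have k: "\<kappa> / 2 \<le> b powr (- p) * r powr (s * p) * \<gamma>"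
        by (rule mult_right_le_imp_le) (use r0 in simp)
      have "r powr (s * p) = L powr (s * p / N) * b powr (- (Q * s * p / N))"
        using L b by (simp add: r_def powr_powr powr_mult mult_ac)
      moreover have "b powr (- \<alpha>) = b powr (- p) * b powr (- (Q * s * p / N))"
        unfolding powr_add[symmetric] by (simp add: \<alpha>_def algebra_simps)
      ultimately have "\<kappa> / 2 \<le> b powr (- \<alpha>) * (L powr (s * p / N) * \<gamma>)"
        using k by (simp add: mult_ac)
      then have "b powr \<alpha> \<le> 2 / \<kappa> * L powr (s * p / N) * \<gamma>"
        using \<kappa> b by (simp add: powr_minus field_simps)
      moreover have "a powr \<alpha> = 2 powr \<alpha> * b powr \<alpha>"
        using b by (simp add: b_def flip: powr_mult)
      ultimately have "a powr \<alpha> \<le> 2 powr \<alpha> * (2 / \<kappa> * L powr (s * p / N) * \<gamma>)"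
        by (simp only:) (rule mult_left_mono, auto)
      then have "a powr \<alpha> \<le> 2 powr \<alpha> * (2 / \<kappa>) * L powr (s * p / N) * \<gamma>"
        by (simp only: mult.assoc)
      from ennreal_leI[OF this] show ?thesis
        unfolding \<gamma>(1) by (subst (asm) ennreal_mult) (use \<gamma> \<kappa> in auto)
    qed
    then show ?thesis by (intro add_increasing) auto
  qed
  then show ?thesis unfolding a_def \<alpha>_def L_def N_def g_def .
qed

lemma mass_gain:
  assumes s: "0 < s" and p: "0 < p" and Q: "0 < Q"
  shows "\<exists>C. \<forall>u\<in>borel_measurable M. mass Q u \<le> ennreal B \<and> gagliardo s p u \<le> ennreal B' \<longrightarrow>
    mass (p * (1 + s * Q / real DIM('a))) u \<le> ennreal C"
proof -
  define \<alpha> where "\<alpha> = p * (1 + s * Q / real DIM('a))"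
  \<comment> \<open>\<open>pointwise_gain\<close> needs a positive bound, whereas \<open>B\<close>
    is an arbitrary real.\<close>
  define D where "D = max B 1"
  define A where "A = (2 * (2 * D / \<kappa>) powr (1 / Q)) powr \<alpha>"
  define K where "K = 2 powr \<alpha> * (2 / \<kappa>) * (2 * D / \<kappa>) powr (s * p / real DIM('a))"
  have "mass \<alpha> u \<le> ennreal (A * measure M (space M) + K * \<bar>B'\<bar>)"
    if u: "u \<in> borel_measurable M" "mass Q u \<le> ennreal B" "gagliardo s p u \<le> ennreal B'" for u
  proof -
    note u(1)[measurable]
    have K: "K \<ge> 0" "A \<ge> 0" using \<kappa> by (auto simp: K_def A_def)
    have D: "0 < D" "mass Q u \<le> ennreal D"
      using u(2) by (auto simp: D_def intro: order_trans ennreal_leI)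
    have "mass \<alpha> u \<le> (\<integral>\<^sup>+x. ennreal A + ennreal K *
      (\<integral>\<^sup>+y. ennreal (\<bar>u x - u y\<bar> powr p / norm (x - y) powr (real DIM('a) + s * p)) \<partial>M) \<partial>M)"
      unfolding mass_def
      by (intro nn_integral_mono) (use pointwise_gain[OF u(1) _ s p Q D] in \<open>simp add: A_def K_def \<alpha>_def\<close>)
    also have "\<dots> = ennreal A * emeasure M (space M) + ennreal K * gagliardo s p u"
      unfolding gagliardo_def
      using gagliardo_kernel_measurable[OF u(1), of p "real DIM('a) + s * p"]
      by (subst nn_integral_add) (auto simp: nn_integral_cmult intro!: borel_measurable_nn_integral)
    also have "\<dots> \<le> ennreal A * ennreal (measure M (space M)) + ennreal K * ennreal \<bar>B'\<bar>"
      using u(3) by (intro add_mono mult_left_mono) (auto simp: emeasure_eq_measure intro: order_trans ennreal_leI)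
    also have "\<dots> = ennreal (A * measure M (space M) + K * \<bar>B'\<bar>)"
      using K by (simp add: ennreal_plus ennreal_mult)
    finally show ?thesis .
  qed
  then show ?thesis unfolding \<alpha>_def by blast
qed

text \<open>The map taking Q to \<open>p * (1 + s * Q / N)\<close> is affine with slope
  \<open>\<theta> = s * p / N < 1\<close>, and its fixed point is the critical exponent P. Started
  at p, its iterates are \<open>P - \<theta> ^ n * (P - p)\<close> and tend to P, so finitely many
  applications of \<open>mass_gain\<close> pass any \<open>q < P\<close>.\<close>

lemma subcritical_mass_bound:
  assumes s: "0 < s" and p: "0 < p" and sp: "s * p < real DIM('a)"
    and q: "0 < q" "q < real DIM('a) * p / (real DIM('a) - s * p)"
  shows "\<exists>C. \<forall>u\<in>borel_measurable M. mass p u \<le> ennreal B \<and> gagliardo s p u \<le> ennreal B \<longrightarrow>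
    mass q u \<le> ennreal C"
proof -
  define N where "N = real DIM('a)"
  have N: "N > 0" by (simp add: N_def)
  define P where "P = N * p / (N - s * p)"
  define \<theta> where "\<theta> = s * p / N"
  have \<theta>: "0 < \<theta>" "\<theta> < 1" using s p sp N by (auto simp: \<theta>_def N_def)
  have Pp: "P = p + \<theta> * P"
    using sp N by (simp add: P_def \<theta>_def N_def field_simps)
  have PP: "P \<ge> p" using N s p sp by (simp add: P_def N_def field_simps)
  define Q where "Q n = P - \<theta> ^ n * (P - p)" for n :: nat
  have Q0: "Q n > 0" for n
  proof -
    have "\<theta> ^ n * (P - p) \<le> 1 * (P - p)" using PP \<theta> by (intro mult_right_mono power_le_one) auto
    then show ?thesis using p by (simp add: Q_def)
  qed
  have QS: "Q (Suc n) = p * (1 + s * Q n / N)" for n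
  proof -
    have "p * (1 + s * Q n / N) = p + \<theta> * Q n" by (simp add: \<theta>_def algebra_simps)
    also have "\<dots> = (p + \<theta> * P) - \<theta> ^ Suc n * (P - p)" by (simp add: Q_def algebra_simps)
    finally show ?thesis using Pp by (simp add: Q_def)
  qed
  have ind: "\<exists>C. \<forall>u\<in>borel_measurable M. mass p u \<le> ennreal B \<and> gagliardo s p u \<le> ennreal B \<longrightarrow>
    mass (Q n) u \<le> ennreal C" for n
  proof (induction n)
    case 0
    then show ?case by (auto simp: Q_def)
  next
    case (Suc n)
    then obtain C where C: "\<And>u. u \<in> borel_measurable M \<Longrightarrow> mass p u \<le> ennreal B \<Longrightarrow> gagliardo s p u \<le> ennreal B \<Longrightarrow>
      mass (Q n) u \<le> ennreal C" by blast
    from mass_gain[OF s p Q0[of n], of C B] obtain C' where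
      "\<And>u. u \<in> borel_measurable M \<Longrightarrow> mass (Q n) u \<le> ennreal C \<Longrightarrow> gagliardo s p u \<le> ennreal B \<Longrightarrow>
        mass (Q (Suc n)) u \<le> ennreal C'" unfolding QS N_def by blast
    with C show ?case by blast
  qed
  have "Q \<longlonglongrightarrow> P - 0 * (P - p)"
    unfolding Q_def using \<theta> by (intro tendsto_intros LIMSEQ_power_zero) auto
  then have "eventually (\<lambda>n. q < Q n) sequentially"
    using q by (intro order_tendstoD(1)[of _ "P - 0 * (P - p)"]) (auto simp: P_def N_def)
  then obtain n where n: "q < Q n" by (auto simp: eventually_sequentially)
  obtain C where C: "\<And>u. u \<in> borel_measurable M \<Longrightarrow> mass p u \<le> ennreal B \<Longrightarrow> gagliardo s p u \<le> ennreal B \<Longrightarrow>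
      mass (Q n) u \<le> ennreal C" using ind[of n] by blast
  have "mass q u \<le> ennreal (\<bar>C\<bar> + measure M (space M))"
    if "u \<in> borel_measurable M" "mass p u \<le> ennreal B" "gagliardo s p u \<le> ennreal B" for u
  proof -
    have "mass q u \<le> mass (Q n) u + emeasure M (space M)" using that n q by (intro mass_le_mass) auto
    also have "\<dots> \<le> ennreal \<bar>C\<bar> + ennreal (measure M (space M))"
      using C[OF that] by (intro add_mono) (auto simp: emeasure_eq_measure intro: order_trans ennreal_leI)
    finally show ?thesis by (simp add: ennreal_plus)
  qed
  then show ?thesis by blast
qed

end

section \<open>Compactness in the space of integrable functions\<close>

lemma nn_integral_le_liminf_AE:
  fixes F :: "nat \<Rightarrow> 'a \<Rightarrow> ennreal"
  assumes [measurable]: "\<And>m. F m \<in> borel_measurable M" and "AE x in M. (\<lambda>m. F m x) \<longlonglongrightarrow> G x"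
  shows "(\<integral>\<^sup>+x. G x \<partial>M) \<le> liminf (\<lambda>m. \<integral>\<^sup>+x. F m x \<partial>M)"
proof -
  have "(\<integral>\<^sup>+x. G x \<partial>M) = (\<integral>\<^sup>+x. liminf (\<lambda>m. F m x) \<partial>M)"
    using assms(2) by (intro nn_integral_cong_AE) (auto elim!: eventually_mono simp: lim_imp_Liminf)
  also have "\<dots> \<le> liminf (\<lambda>m. \<integral>\<^sup>+x. F m x \<partial>M)" by (rule nn_integral_liminf) simp
  finally show ?thesis .
qed

lemma liminf_le_const:
  fixes X :: "nat \<Rightarrow> ennreal"
  assumes "eventually (\<lambda>m. X m \<le> C) sequentially"
  shows "liminf X \<le> C"
proof -
  have "liminf X \<le> liminf (\<lambda>m. C)" using assms by (rule Liminf_mono)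
  then show ?thesis by (simp add: Liminf_const)
qed

context regular_measure
begin

lemma mass_diff_le:
  assumes [measurable]: "u \<in> borel_measurable M" "v \<in> borel_measurable M" and q: "0 < q"
  shows "mass q (\<lambda>x. u x - v x) \<le> ennreal (2 powr q) * (mass q u + mass q v)"
proof -
  have "mass q (\<lambda>x. u x - v x) \<le> (\<integral>\<^sup>+x. ennreal (2 powr q) * (ennreal (\<bar>u x\<bar> powr q) + ennreal (\<bar>v x\<bar> powr q)) \<partial>M)"
    unfolding mass_def
  proof (rule nn_integral_mono)
    fix x
    show "ennreal (\<bar>u x - v x\<bar> powr q) \<le> ennreal (2 powr q) * (ennreal (\<bar>u x\<bar> powr q) + ennreal (\<bar>v x\<bar> powr q))"
      using ennreal_leI[OF abs_diff_powr_le[OF q, of "u x" "v x"]] by (simp add: ennreal_mult)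
  qed
  also have "\<dots> = ennreal (2 powr q) * (mass q u + mass q v)"
    unfolding mass_def by (simp add: nn_integral_cmult nn_integral_add)
  finally show ?thesis .
qed

lemma gagliardo_inner_measurable:
  assumes [measurable]: "u \<in> borel_measurable M"
  shows "(\<lambda>x. \<integral>\<^sup>+y. ennreal (\<bar>u x - u y\<bar> powr p / norm (x - y) powr \<beta>) \<partial>M) \<in> borel_measurable M"
  by (rule borel_measurable_nn_integral[OF gagliardo_kernel_measurable[OF assms, of p \<beta>]])

lemma gagliardo_diff_le:
  assumes u[measurable]: "u \<in> borel_measurable M" and v[measurable]: "v \<in> borel_measurable M" and p: "0 < p"
  shows "gagliardo s p (\<lambda>x. u x - v x) \<le> ennreal (2 powr p) * (gagliardo s p u + gagliardo s p v)"
proof -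
  define \<beta> where "\<beta> = real DIM('a) + s * p"
  define k where "k w x y = ennreal (\<bar>w x - w y\<bar> powr p / norm (x - y) powr \<beta>)" for w :: "'a \<Rightarrow> real" and x y
  have km: "(\<lambda>y. k w x y) \<in> borel_measurable M" if [measurable]: "w \<in> borel_measurable M" for w x
    unfolding k_def by measurable
  have kI: "(\<lambda>x. \<integral>\<^sup>+y. k w x y \<partial>M) \<in> borel_measurable M" if "w \<in> borel_measurable M" for w
    unfolding k_def by (rule gagliardo_inner_measurable[OF that])
  have "k (\<lambda>x. u x - v x) x y \<le> ennreal (2 powr p) * (k u x y + k v x y)" for x y
  proof -
    have "\<bar>(u x - v x) - (u y - v y)\<bar> powr p \<le> 2 powr p * (\<bar>u x - u y\<bar> powr p + \<bar>v x - v y\<bar> powr p)"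
      using abs_diff_powr_le[OF p, of "u x - u y" "v x - v y"] by (simp add: algebra_simps)
    then have "\<bar>(u x - v x) - (u y - v y)\<bar> powr p / norm (x - y) powr \<beta> \<le>
      2 powr p * (\<bar>u x - u y\<bar> powr p / norm (x - y) powr \<beta> + \<bar>v x - v y\<bar> powr p / norm (x - y) powr \<beta>)"
      by (simp add: divide_right_mono flip: add_divide_distrib)
    from ennreal_leI[OF this] show ?thesis
      unfolding k_def by (subst (asm) ennreal_mult) (auto simp: ennreal_plus)
  qed
  then have "gagliardo s p (\<lambda>x. u x - v x) \<le> (\<integral>\<^sup>+x. (\<integral>\<^sup>+y. ennreal (2 powr p) * (k u x y + k v x y) \<partial>M) \<partial>M)"
    unfolding gagliardo_def \<beta>_def[symmetric] k_def by (intro nn_integral_mono)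
  also have "\<dots> = (\<integral>\<^sup>+x. ennreal (2 powr p) * ((\<integral>\<^sup>+y. k u x y \<partial>M) + (\<integral>\<^sup>+y. k v x y \<partial>M)) \<partial>M)"
    using km[OF u] km[OF v] by (simp add: nn_integral_cmult nn_integral_add)
  also have "\<dots> = ennreal (2 powr p) * ((\<integral>\<^sup>+x. (\<integral>\<^sup>+y. k u x y \<partial>M) \<partial>M) + (\<integral>\<^sup>+x. (\<integral>\<^sup>+y. k v x y \<partial>M) \<partial>M))"
    using kI[OF u] kI[OF v] by (simp add: nn_integral_cmult nn_integral_add)
  finally show ?thesis unfolding gagliardo_def \<beta>_def[symmetric] k_def .
qed

lemma finite_ball_cover:
  assumes "0 < d"
  shows "\<exists>P. finite P \<and> P \<subseteq> space M \<and> space M \<subseteq> (\<Union>c\<in>P. ball c d)"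
proof -
  have "compact (closure (space M))" using bounded_space by simp
  moreover have "closure (space M) \<subseteq> (\<Union>c\<in>space M. ball c d)"
  proof
    fix x assume "x \<in> closure (space M)"
    then obtain c where "c \<in> space M" "dist c x < d" using assms by (auto simp: closure_approachable)
    then show "x \<in> (\<Union>c\<in>space M. ball c d)" by auto
  qed
  ultimately obtain P where "P \<subseteq> space M" "finite P" "closure (space M) \<subseteq> (\<Union>c\<in>P. ball c d)"
    using compactE_image[of "closure (space M)" "space M" "\<lambda>c. ball c d"] by auto
  with order_trans[OF closure_subset this(3)] show ?thesis by (intro exI[of _ P] conjI)
qed

text \<open>Write \<open>D = r powr s * z\<close> and use \<open>z \<le> 1 + z powr p\<close>: the
  first summand becomes a weakly singular kernel, the second the Gagliardo kernel. The shift by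
  \<open>s / 2\<close> keeps the former integrable and still leaves
  \<open>R powr (N + s / 2)\<close>, which is small compared with the volume of a ball of radius
  R.\<close>

lemma abs_le_gagliardo_kernel:
  fixes D r R s p N :: real
  assumes "0 < s" "1 \<le> p" "0 < N" "0 < r" "r \<le> R" "0 \<le> D"
  shows "D \<le> R powr (N + s / 2) * r powr (s / 2 - N) + R powr (N + s) * (D powr p / r powr (N + s * p))"
proof -
  define z where "z = D / r powr s"
  have z: "z \<ge> 0" "D = r powr s * z" using assms by (auto simp: z_def)
  have "z \<le> 1 + z powr p"
  proof (cases "z \<le> 1")
    case True
    then show ?thesis using powr_ge_zero[of z p] by linarith
  next
    case False
    then have "z powr 1 \<le> z powr p" using assms by (intro powr_mono) auto
    then show ?thesis using False by simp
  qed
  then have "D \<le> r powr s * (1 + z powr p)" unfolding z(2) by (intro mult_left_mono) auto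
  also have "\<dots> = r powr (N + s / 2) * r powr (s / 2 - N) + r powr (N + s) * (D powr p / r powr (N + s * p))"
  proof -
    have 1: "r powr (N + s / 2) * r powr (s / 2 - N) = r powr s" unfolding powr_add[symmetric] by simp
    have 2: "r powr (N + s) / r powr (N + s * p) = r powr s / r powr (s * p)"
      unfolding powr_diff[symmetric] by simp
    have "z powr p = D powr p / r powr (s * p)" using assms by (simp add: z_def powr_divide powr_powr)
    moreover have "r powr (N + s) * (D powr p / r powr (N + s * p)) = (r powr (N + s) / r powr (N + s * p)) * D powr p"
      by simp
    ultimately show ?thesis using 1 2 by (simp add: distrib_left)
  qed
  also have "\<dots> \<le> R powr (N + s / 2) * r powr (s / 2 - N) + R powr (N + s) * (D powr p / r powr (N + s * p))"
    using assms by (intro add_mono mult_right_mono powr_mono2) auto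
  finally show ?thesis .
qed

text \<open>On each ball of a fine cover, \<open>w x\<close> is compared with the average of w over
  that ball. The energy makes the deviation small with d, so that up to \<epsilon> the L^1 norm is
  governed by finitely many linear functionals.\<close>

lemma L1_bound_by_averages:
  assumes s: "0 < s" and p: "1 \<le> p" and \<epsilon>: "0 < \<epsilon>" and B: "0 \<le> B"
  shows "\<exists>P d K. finite P \<and> 0 \<le> K \<and> (\<forall>w. integrable M w \<and> gagliardo s p w \<le> ennreal B \<longrightarrow>
    (\<integral>\<^sup>+x. ennreal \<bar>w x\<bar> \<partial>M) \<le> ennreal \<epsilon> +
      ennreal K * (\<Sum>c\<in>P. ennreal \<bar>\<integral>x. indicator (space M \<inter> ball c d) x * w x \<partial>M\<bar>))"
proof -
  define N where "N = real DIM('a)"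
  have N: "0 < N" by (simp add: N_def)
  define \<mu> where "\<mu> = measure M (space M)"
  have \<mu>: "\<mu> \<ge> 0" by (simp add: \<mu>_def)
  obtain K0 where K0: "K0 \<ge> 0" "\<And>x. x \<in> space M \<Longrightarrow>
      (\<integral>\<^sup>+y. ennreal (norm (x - y) powr (s / 2 - N)) \<partial>M) \<le> ennreal K0"
    using radial_bound[of "s / 2"] s unfolding N_def by auto
  \<comment> \<open>\<open>C * d powr (s / 2)\<close> will bound the integrated deviation, and
    \<open>d\<close> is chosen to make it at most \<open>\<epsilon>\<close>; there
    \<open>C + 1\<close> avoids a division by 0.\<close>
  define C where "C = (2 powr (N + s / 2) * K0 * \<mu> + 2 powr (N + s) * B) / \<kappa>"
  have C: "C \<ge> 0" using K0 \<mu> B \<kappa> by (simp add: C_def)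
  define d where "d = min 1 ((\<epsilon> / (C + 1)) powr (2 / s))"
  have d: "0 < d" "d \<le> 1" using \<epsilon> C by (auto simp: d_def)
  have Cd: "C * d powr (s / 2) \<le> \<epsilon>"
  proof -
    have "d powr (s / 2) \<le> ((\<epsilon> / (C + 1)) powr (2 / s)) powr (s / 2)"
      using d s by (intro powr_mono2) (auto simp: d_def)
    also have "\<dots> = \<epsilon> / (C + 1)" using s \<epsilon> C by (simp add: powr_powr)
    finally have "d powr (s / 2) * (C + 1) \<le> \<epsilon>" using C by (simp add: pos_le_divide_eq)
    moreover have "C * d powr (s / 2) \<le> d powr (s / 2) * (C + 1)" by (simp add: algebra_simps)
    ultimately show ?thesis by linarith
  qed
  obtain P where P: "finite P" "P \<subseteq> space M" "space M \<subseteq> (\<Union>c\<in>P. ball c d)"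
    using finite_ball_cover[OF d(1)] by blast
  define h where "h = 1 / (\<kappa> * d powr N)"
  have h: "h > 0" using \<kappa> d by (simp add: h_def)
  define R where "R = 2 * d"
  have main: "(\<integral>\<^sup>+x. ennreal \<bar>w x\<bar> \<partial>M) \<le> ennreal \<epsilon> +
      ennreal (h * \<mu>) * (\<Sum>c\<in>P. ennreal \<bar>\<integral>x. indicator (space M \<inter> ball c d) x * w x \<partial>M\<bar>)"
    if w: "integrable M w" and G: "gagliardo s p w \<le> ennreal B" for w
  proof -
    have wm[measurable]: "w \<in> borel_measurable M" using w by simp
    define S where "S = (\<Sum>c\<in>P. ennreal \<bar>\<integral>x. indicator (space M \<inter> ball c d) x * w x \<partial>M\<bar>)"
    define g where "g x = (\<integral>\<^sup>+y. ennreal (\<bar>w x - w y\<bar> powr p / norm (x - y) powr (N + s * p)) \<partial>M)" for x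
    have gm: "g \<in> borel_measurable M" unfolding g_def by (rule gagliardo_inner_measurable) simp
    have pw: "ennreal \<bar>w x\<bar> \<le> ennreal h * (ennreal (R powr (N + s / 2) * K0) + ennreal (R powr (N + s)) * g x + S)"
      if x: "x \<in> space M" for x
    proof -
      obtain c where c: "c \<in> P" "x \<in> ball c d" using P x by blast
      define E where "E = space M \<inter> ball c d"
      have E[measurable]: "E \<in> sets M" unfolding E_def by measurable
      have iE: "integrable M (\<lambda>y. indicator E y * w y)"
        using integrable_mult_indicator[OF E w] by simp
      have iEc: "integrable M (\<lambda>y. indicator E y * w x)"
        by (intro integrable_mult_left) (simp add: integrable_indicator_iff emeasure_eq_measure)
      have "\<kappa> * d powr N \<le> measure M E"
        using ball_lower[of c d] c P d by (auto simp: E_def N_def powr_realpow emeasure_eq_measure)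
      then have "(\<kappa> * d powr N) * \<bar>w x\<bar> \<le> measure M E * \<bar>w x\<bar>" by (intro mult_right_mono) auto
      also have "\<dots> = \<bar>\<integral>y. indicator E y * w x \<partial>M\<bar>"
        by (simp add: abs_mult)
      also have "(\<integral>y. indicator E y * w x \<partial>M) = (\<integral>y. indicator E y * (w x - w y) \<partial>M) + (\<integral>y. indicator E y * w y \<partial>M)"
        using iE iEc by (simp add: right_diff_distrib)
      finally have "(\<kappa> * d powr N) * \<bar>w x\<bar> \<le> \<bar>\<integral>y. indicator E y * (w x - w y) \<partial>M\<bar> + \<bar>\<integral>y. indicator E y * w y \<partial>M\<bar>"
        using abs_triangle_ineq by (meson order_trans)
      from ennreal_leI[OF this]
      have "ennreal (\<kappa> * d powr N) * ennreal \<bar>w x\<bar> \<le> ennreal \<bar>\<integral>y. indicator E y * (w x - w y) \<partial>M\<bar> + ennreal \<bar>\<integral>y. indicator E y * w y \<partial>M\<bar>"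
        using \<kappa> by (simp add: ennreal_mult)
      also have "\<dots> \<le> (ennreal (R powr (N + s / 2) * K0) + ennreal (R powr (N + s)) * g x) + S"
      proof (rule add_mono)
        have "integrable M (\<lambda>y. indicator E y * (w x - w y))" using iE iEc by (simp add: right_diff_distrib)
        then have "ennreal (norm (\<integral>y. indicator E y * (w x - w y) \<partial>M)) \<le> (\<integral>\<^sup>+y. norm (indicator E y * (w x - w y)) \<partial>M)"
          by (rule integral_norm_bound_ennreal)
        also have "\<dots> \<le> (\<integral>\<^sup>+y. ennreal (R powr (N + s / 2)) * ennreal (norm (x - y) powr (s / 2 - N)) +
            ennreal (R powr (N + s)) * ennreal (\<bar>w x - w y\<bar> powr p / norm (x - y) powr (N + s * p)) \<partial>M)"
        proof (rule nn_integral_mono)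
          fix y
          have "\<bar>indicator E y * (w x - w y)\<bar> \<le> R powr (N + s / 2) * norm (x - y) powr (s / 2 - N) +
             R powr (N + s) * (\<bar>w x - w y\<bar> powr p / norm (x - y) powr (N + s * p))"
          proof (cases "y \<in> E \<and> x \<noteq> y")
            case True
            have "norm (x - y) \<le> R"
              using True c dist_triangle2[of x y c] by (auto simp: E_def R_def dist_norm norm_minus_commute)
            with abs_le_gagliardo_kernel[OF s p N, of "norm (x - y)" R "\<bar>w x - w y\<bar>"] True
            show ?thesis by simp
          next
            case False
            then have "indicator E y * (w x - w y) = 0" by auto
            moreover have "0 \<le> R powr (N + s / 2) * norm (x - y) powr (s / 2 - N) +
               R powr (N + s) * (\<bar>w x - w y\<bar> powr p / norm (x - y) powr (N + s * p))"
              by (intro add_nonneg_nonneg mult_nonneg_nonneg divide_nonneg_nonneg) auto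
            ultimately show ?thesis by (simp only: abs_zero)
          qed
          from ennreal_leI[OF this] show "ennreal (norm (indicator E y * (w x - w y))) \<le>
            ennreal (R powr (N + s / 2)) * ennreal (norm (x - y) powr (s / 2 - N)) +
            ennreal (R powr (N + s)) * ennreal (\<bar>w x - w y\<bar> powr p / norm (x - y) powr (N + s * p))"
            by (subst ennreal_mult[symmetric], simp, simp, subst ennreal_mult[symmetric], simp, simp,
                subst ennreal_plus[symmetric]) auto
        qed
        also have "\<dots> = ennreal (R powr (N + s / 2)) * (\<integral>\<^sup>+y. ennreal (norm (x - y) powr (s / 2 - N)) \<partial>M) + ennreal (R powr (N + s)) * g x"
          unfolding g_def by (subst nn_integral_add) (auto simp: nn_integral_cmult)
        also have "\<dots> \<le> ennreal (R powr (N + s / 2)) * ennreal K0 + ennreal (R powr (N + s)) * g x"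
          by (intro add_right_mono mult_left_mono K0 x) auto
        finally show "ennreal \<bar>\<integral>y. indicator E y * (w x - w y) \<partial>M\<bar> \<le> ennreal (R powr (N + s / 2) * K0) + ennreal (R powr (N + s)) * g x"
          using K0 by (simp add: ennreal_mult)
        show "ennreal \<bar>\<integral>y. indicator E y * w y \<partial>M\<bar> \<le> S"
          unfolding S_def E_def using P(1) c(1) by (intro member_le_sum) auto
      qed
      finally have "ennreal h * (ennreal (\<kappa> * d powr N) * ennreal \<bar>w x\<bar>) \<le>
          ennreal h * (ennreal (R powr (N + s / 2) * K0) + ennreal (R powr (N + s)) * g x + S)"
        by (rule mult_left_mono) simp
      moreover have "ennreal h * (ennreal (\<kappa> * d powr N) * ennreal \<bar>w x\<bar>) = ennreal \<bar>w x\<bar>"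
      proof -
        have "h * (\<kappa> * d powr N) = 1" using \<kappa> d by (simp add: h_def)
        then have "ennreal h * ennreal (\<kappa> * d powr N) = 1"
          using h \<kappa> by (subst ennreal_mult[symmetric]) auto
        then show ?thesis by (simp flip: mult.assoc)
      qed
      ultimately show ?thesis by simp
    qed
    have "(\<integral>\<^sup>+x. ennreal \<bar>w x\<bar> \<partial>M) \<le>
      (\<integral>\<^sup>+x. ennreal h * (ennreal (R powr (N + s / 2) * K0) + ennreal (R powr (N + s)) * g x + S) \<partial>M)"
      by (intro nn_integral_mono pw)
    also have "\<dots> = ennreal h * (ennreal (R powr (N + s / 2) * K0) * ennreal \<mu> + ennreal (R powr (N + s)) * gagliardo s p w + S * ennreal \<mu>)"
    proof -
      have "gagliardo s p w = (\<integral>\<^sup>+x. g x \<partial>M)" by (simp add: gagliardo_def g_def N_def)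
      then show ?thesis using gm by (simp add: nn_integral_cmult nn_integral_add \<mu>_def emeasure_eq_measure)
    qed
    also have "\<dots> \<le> ennreal h * (ennreal (R powr (N + s / 2) * K0) * ennreal \<mu> + ennreal (R powr (N + s)) * ennreal B + S * ennreal \<mu>)"
      by (intro mult_left_mono add_mono G order_refl) auto
    also have "\<dots> = ennreal (h * (R powr (N + s / 2) * K0 * \<mu> + R powr (N + s) * B)) + ennreal (h * \<mu>) * S"
      using h K0 \<mu> B by (simp add: ennreal_mult ennreal_plus distrib_left mult_ac)
    also have "h * (R powr (N + s / 2) * K0 * \<mu> + R powr (N + s) * B) \<le> \<epsilon>"
    proof -
      have 1: "h * R powr (N + s / 2) = 2 powr (N + s / 2) / \<kappa> * d powr (s / 2)"
        using d by (simp add: h_def R_def powr_mult powr_add)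
      have "h * R powr (N + s) = 2 powr (N + s) / \<kappa> * d powr s"
        using d by (simp add: h_def R_def powr_mult powr_add)
      \<comment> \<open>\<open>d \<le> 1\<close> brings both terms to the common power
        \<open>d powr (s / 2)\<close>.\<close>
      also have "\<dots> \<le> 2 powr (N + s) / \<kappa> * d powr (s / 2)"
        using d s \<kappa> by (intro mult_left_mono powr_mono') auto
      finally have "h * R powr (N + s) * B \<le> 2 powr (N + s) / \<kappa> * d powr (s / 2) * B"
        using B by (rule mult_right_mono)
      then have "h * (R powr (N + s / 2) * K0 * \<mu> + R powr (N + s) * B) \<le>
         2 powr (N + s / 2) / \<kappa> * d powr (s / 2) * K0 * \<mu> + 2 powr (N + s) / \<kappa> * d powr (s / 2) * B"
        using 1 by (simp add: distrib_left mult.assoc[symmetric])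
      also have "\<dots> = C * d powr (s / 2)" by (simp add: C_def add_divide_distrib algebra_simps)
      finally show ?thesis using Cd by linarith
    qed
    finally show ?thesis by (simp add: S_def ennreal_leI add_right_mono)
  qed
  have "0 \<le> h * \<mu>" using h \<mu> by simp
  with main P(1) show ?thesis by blast
qed

text \<open>The integrals over countably many balls are bounded scalar sequences, so a diagonal
  subsequence makes all of them converge. Applied to differences,
  \<open>L1_bound_by_averages\<close> makes this subsequence Cauchy in L^1. A further subsequence
  converges almost everywhere, and Fatou's lemma gives L^1 convergence to its limit.\<close>

lemma L1_compactness:
  fixes u :: "nat \<Rightarrow> 'a \<Rightarrow> real"
  assumes s: "0 < s" and p: "1 \<le> p" and B: "0 \<le> B"
    and um[measurable]: "\<And>n. u n \<in> borel_measurable M"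
    and ub: "\<And>n. mass p (u n) \<le> ennreal B" "\<And>n. gagliardo s p (u n) \<le> ennreal B"
  shows "\<exists>v\<in>borel_measurable M. \<exists>r. strict_mono r \<and> (AE x in M. (\<lambda>n. u (r n) x) \<longlonglongrightarrow> v x) \<and>
    (\<lambda>n. \<integral>\<^sup>+x. ennreal \<bar>u (r n) x - v x\<bar> \<partial>M) \<longlonglongrightarrow> 0"
proof -
  define B1 where "B1 = B + measure M (space M)"
  have B1: "(\<integral>\<^sup>+x. ennreal \<bar>u n x\<bar> \<partial>M) \<le> ennreal B1" for n
  proof -
    have "mass 1 (u n) \<le> mass p (u n) + emeasure M (space M)" using p by (intro mass_le_mass) auto
    also have "\<dots> \<le> ennreal B + ennreal (measure M (space M))"
      using ub by (intro add_mono) (auto simp: emeasure_eq_measure)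
    finally show ?thesis using B by (simp add: mass_def B1_def ennreal_plus)
  qed
  have ui: "integrable M (u n)" for n
    using B1[of n] by (intro integrableI_bounded) (auto simp: le_less_trans)
  define B2 where "B2 = 2 powr p * (B + B)"
  have B2: "0 \<le> B2" using B by (simp add: B2_def)
  \<comment> \<open>The averages are applied to differences of members of the sequence, whose energy
    is bounded by \<open>B2\<close> uniformly.\<close>
  have gd: "gagliardo s p (\<lambda>x. u n x - u m x) \<le> ennreal B2" for n m
  proof -
    have "gagliardo s p (\<lambda>x. u n x - u m x) \<le> ennreal (2 powr p) * (gagliardo s p (u n) + gagliardo s p (u m))"
      using p by (intro gagliardo_diff_le) auto
    also have "\<dots> \<le> ennreal (2 powr p) * (ennreal B + ennreal B)"
      by (intro mult_left_mono add_mono ub) auto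
    finally show ?thesis
      unfolding B2_def by (simp only: ennreal_mult ennreal_plus B powr_ge_zero add_nonneg_nonneg)
  qed
  \<comment> \<open>\<open>\<Phi>\<close> packs the estimate at accuracy \<open>1 / Suc j\<close>,
    so that covers, radii and constants can be chosen for all \<open>j\<close> at once.\<close>
  define \<Phi> where "\<Phi> j P d K \<longleftrightarrow> finite P \<and> 0 \<le> K \<and> (\<forall>w. integrable M w \<and> gagliardo s p w \<le> ennreal B2 \<longrightarrow>
    (\<integral>\<^sup>+x. ennreal \<bar>w x\<bar> \<partial>M) \<le> ennreal (1 / real (Suc j)) +
      ennreal K * (\<Sum>c\<in>P. ennreal \<bar>\<integral>x. indicator (space M \<inter> ball c d) x * w x \<partial>M\<bar>))"
    for j P d K
  have "\<exists>P d K. \<Phi> j P d K" for j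
  proof -
    have "0 < 1 / real (Suc j)" by simp
    from L1_bound_by_averages[OF s p this B2] show ?thesis unfolding \<Phi>_def .
  qed
  then obtain P d K where PdK: "\<And>j. \<Phi> j (P j) (d j) (K j)" by metis
  have PK: "finite (P j)" "0 \<le> K j" for j using PdK[of j] by (auto simp: \<Phi>_def)
  have bnd: "(\<integral>\<^sup>+x. ennreal \<bar>w x\<bar> \<partial>M) \<le> ennreal (1 / real (Suc j)) +
      ennreal (K j) * (\<Sum>c\<in>P j. ennreal \<bar>\<integral>x. indicator (space M \<inter> ball c (d j)) x * w x \<partial>M\<bar>)"
    if "integrable M w" "gagliardo s p w \<le> ennreal B2" for j w
    using PdK[of j] that by (simp add: \<Phi>_def)
  \<comment> \<open>A ball is coded by centre and radius, which makes \<open>f n\<close> a function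
    on a countable set of codes, as the diagonal argument expects.\<close>
  define f where "f n z = (\<integral>x. indicator (space M \<inter> ball (fst z) (snd z)) x * u n x \<partial>M)" for n :: nat and z :: "'a \<times> real"
  have fi: "integrable M (\<lambda>x. indicator (space M \<inter> ball c r) x * u n x)" for c r n
    using integrable_mult_indicator[OF measurable_ball ui] by simp
  have fb: "norm (f n z) \<le> B1" for n z
  proof -
    have "ennreal (norm (f n z)) \<le> (\<integral>\<^sup>+x. norm (indicator (space M \<inter> ball (fst z) (snd z)) x * u n x) \<partial>M)"
      unfolding f_def by (intro integral_norm_bound_ennreal fi)
    also have "\<dots> \<le> (\<integral>\<^sup>+x. ennreal \<bar>u n x\<bar> \<partial>M)"
      by (intro nn_integral_mono ennreal_leI) (auto simp: indicator_def)
    also have "\<dots> \<le> ennreal B1" by (rule B1)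
    finally show ?thesis using B by (subst (asm) ennreal_le_iff) (auto simp: B1_def)
  qed
  have cnt: "countable (\<Union>j. P j \<times> {d j})" by (rule countable_UN, simp, rule countable_finite, simp add: PK(1))
  obtain k where k: "strict_mono k" and kl: "\<And>z. z \<in> (\<Union>j. P j \<times> {d j}) \<Longrightarrow> \<exists>l. (\<lambda>n. f (k n) z) \<longlonglongrightarrow> l"
  proof (rule function_convergent_subsequence[OF cnt])
    show "norm (f n z) \<le> B1" for n z by (rule fb)
  qed (rule that)
  have cauchy: "\<exists>n0. \<forall>n\<ge>n0. \<forall>m\<ge>n0. (\<integral>\<^sup>+x. ennreal \<bar>u (k n) x - u (k m) x\<bar> \<partial>M) \<le> ennreal e" if e: "e > 0" for e
  proof -
    obtain j where j: "1 / real (Suc j) < e / 2" using e nat_approx_posE[of "e / 2"] by auto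
    \<comment> \<open>Each of the \<open>card (P j)\<close> averages contributes at most
      \<open>2 * \<eta>\<close>; weighted by \<open>K j\<close>, their sum is at most
      \<open>e / 2\<close>. The added 1 keeps the denominator positive.\<close>
    define \<eta> where "\<eta> = e / (4 * (K j * real (card (P j)) + 1))"
    have pos: "K j * real (card (P j)) + 1 > 0" using PK(2)[of j] by (simp add: add_nonneg_pos)
    have \<eta>: "\<eta> > 0" using e pos by (simp add: \<eta>_def)
    have "\<forall>c\<in>P j. \<exists>l. (\<lambda>n. f (k n) (c, d j)) \<longlonglongrightarrow> l" using kl by blast
    then obtain l where l: "\<And>c. c \<in> P j \<Longrightarrow> (\<lambda>n. f (k n) (c, d j)) \<longlonglongrightarrow> l c" by metis
    have "\<forall>c\<in>P j. eventually (\<lambda>n. dist (f (k n) (c, d j)) (l c) < \<eta>) sequentially"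
      using l \<eta> by (auto intro: tendstoD)
    then have "eventually (\<lambda>n. \<forall>c\<in>P j. dist (f (k n) (c, d j)) (l c) < \<eta>) sequentially"
      using PK(1) by (simp add: eventually_ball_finite)
    then obtain n0 where n0: "\<And>n c. n \<ge> n0 \<Longrightarrow> c \<in> P j \<Longrightarrow> \<bar>f (k n) (c, d j) - l c\<bar> < \<eta>"
      by (auto simp: eventually_sequentially dist_real_def)
    have "(\<integral>\<^sup>+x. ennreal \<bar>u (k n) x - u (k m) x\<bar> \<partial>M) \<le> ennreal e" if nm: "n \<ge> n0" "m \<ge> n0" for n m
    proof -
      define w where "w x = u (k n) x - u (k m) x" for x
      have wi: "integrable M w" unfolding w_def using ui by auto
      have wf: "(\<integral>x. indicator (space M \<inter> ball c (d j)) x * w x \<partial>M) = f (k n) (c, d j) - f (k m) (c, d j)" for c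
        unfolding w_def f_def using fi by (simp add: right_diff_distrib)
      have "(\<integral>\<^sup>+x. ennreal \<bar>w x\<bar> \<partial>M) \<le> ennreal (1 / real (Suc j)) +
         ennreal (K j) * (\<Sum>c\<in>P j. ennreal \<bar>\<integral>x. indicator (space M \<inter> ball c (d j)) x * w x \<partial>M\<bar>)"
        using bnd[OF wi] gd[of "k n" "k m"] unfolding w_def by blast
      also have "\<dots> \<le> ennreal (e / 2) + ennreal (K j) * (\<Sum>c\<in>P j. ennreal (2 * \<eta>))"
      proof (intro add_mono mult_left_mono sum_mono ennreal_leI)
        show "\<bar>\<integral>x. indicator (space M \<inter> ball c (d j)) x * w x \<partial>M\<bar> \<le> 2 * \<eta>" if "c \<in> P j" for c
          using n0[OF nm(1) that] n0[OF nm(2) that] unfolding wf by linarith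
      qed (use j in auto)
      also have "\<dots> = ennreal (e / 2 + K j * (real (card (P j)) * (2 * \<eta>)))"
        using e \<eta> PK(2)[of j] by (simp add: ennreal_plus ennreal_mult ennreal_of_nat_eq_real_of_nat)
      also have "\<dots> \<le> ennreal e"
      proof (rule ennreal_leI)
        have "K j * (real (card (P j)) * (2 * \<eta>)) \<le> (K j * real (card (P j)) + 1) * (2 * \<eta>)"
          using \<eta> by (simp add: algebra_simps)
        also have "\<dots> = e / 2" using pos by (simp add: \<eta>_def field_simps)
        finally show "e / 2 + K j * (real (card (P j)) * (2 * \<eta>)) \<le> e" by simp
      qed
      finally show ?thesis unfolding w_def .
    qed
    then show ?thesis by blast
  qed
  obtain r where r: "strict_mono r" "AE x in M. Cauchy (\<lambda>i. u (k (r i)) x)"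
  proof (rule cauchy_L1_AE_cauchy_subseq[of M "\<lambda>n. u (k n)"])
    show "integrable M (u (k n))" for n by (rule ui)
    fix e :: real assume e: "e > 0"
    then obtain n0 where n0: "\<And>n m. n \<ge> n0 \<Longrightarrow> m \<ge> n0 \<Longrightarrow> (\<integral>\<^sup>+x. ennreal \<bar>u (k n) x - u (k m) x\<bar> \<partial>M) \<le> ennreal (e / 2)"
      using cauchy[of "e / 2"] by auto
    have "(LINT x|M. norm (u (k i) x - u (k j) x)) < e" if "i \<ge> n0" "j \<ge> n0" for i j
    proof -
      have "ennreal (LINT x|M. norm (u (k i) x - u (k j) x)) = (\<integral>\<^sup>+x. ennreal (norm (u (k i) x - u (k j) x)) \<partial>M)"
        using ui by (intro nn_integral_eq_integral[symmetric]) auto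
      also have "\<dots> \<le> ennreal (e / 2)" using n0[OF that] by simp
      finally show ?thesis using e by (subst (asm) ennreal_le_iff) auto
    qed
    then show "\<exists>N. \<forall>i\<ge>N. \<forall>j\<ge>N. (LINT x|M. norm (u (k i) x - u (k j) x)) < e" by blast
  qed
  define v where "v x = lim (\<lambda>n. u (k (r n)) x)" for x
  have vm[measurable]: "v \<in> borel_measurable M" unfolding v_def by measurable
  have AE: "AE x in M. (\<lambda>n. u (k (r n)) x) \<longlonglongrightarrow> v x"
    using r(2) by eventually_elim (simp add: v_def Cauchy_convergent_iff convergent_LIMSEQ_iff)
  have "(\<lambda>n. \<integral>\<^sup>+x. ennreal \<bar>u (k (r n)) x - v x\<bar> \<partial>M) \<longlonglongrightarrow> 0"
  proof (rule order_tendstoI)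
    fix a :: ennreal assume a: "0 < a"
    then obtain b where b: "0 < b" "b < a" using dense by blast
    then obtain e where "b = ennreal e" by (cases b) auto
    with b have e: "e > 0" "ennreal e < a" by auto
    obtain n0 where n0: "\<And>n m. n \<ge> n0 \<Longrightarrow> m \<ge> n0 \<Longrightarrow> (\<integral>\<^sup>+x. ennreal \<bar>u (k n) x - u (k m) x\<bar> \<partial>M) \<le> ennreal e"
      using cauchy[OF e(1)] by auto
    have "(\<integral>\<^sup>+x. ennreal \<bar>u (k (r n)) x - v x\<bar> \<partial>M) < a" if n: "n \<ge> n0" for n
    proof -
      have ri: "n0 \<le> r m" if "n0 \<le> m" for m using seq_suble[OF r(1), of m] that by linarith
      have "(\<integral>\<^sup>+x. ennreal \<bar>u (k (r n)) x - v x\<bar> \<partial>M) \<le> liminf (\<lambda>m. \<integral>\<^sup>+x. ennreal \<bar>u (k (r n)) x - u (k (r m)) x\<bar> \<partial>M)"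
      proof (rule nn_integral_le_liminf_AE)
        show "AE x in M. (\<lambda>m. ennreal \<bar>u (k (r n)) x - u (k (r m)) x\<bar>) \<longlonglongrightarrow> ennreal \<bar>u (k (r n)) x - v x\<bar>"
          using AE by eventually_elim (intro tendsto_intros tendsto_ennrealI)
      qed simp
      also have "\<dots> \<le> ennreal e"
        using n0 ri n by (intro liminf_le_const) (auto simp: eventually_sequentially)
      finally show ?thesis using e(2) by (rule le_less_trans)
    qed
    then show "eventually (\<lambda>n. (\<integral>\<^sup>+x. ennreal \<bar>u (k (r n)) x - v x\<bar> \<partial>M) < a) sequentially"
      by (auto simp: eventually_sequentially)
  qed simp
  moreover have "strict_mono (k \<circ> r)" using k r(1) by (rule strict_mono_o)
  ultimately show ?thesis using vm AE by (intro bexI[of _ v] exI[of _ "k \<circ> r"]) auto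
qed

end

section \<open>Ehrling inequalities\<close>

text \<open>A weighted geometric mean is at most the maximum, hence at most the sum; the factor of Y
  is the one for which the powers of \<epsilon> cancel.\<close>

lemma weighted_young:
  fixes X Y a \<epsilon> :: real
  assumes "0 < X" "0 < Y" "0 < a" "a < 1" "0 < \<epsilon>"
  shows "X powr a * Y powr (1 - a) \<le> \<epsilon> * X + \<epsilon> powr (- a / (1 - a)) * Y"
proof -
  define Z where "Z = \<epsilon> powr (- a / (1 - a)) * Y"
  define m where "m = max (\<epsilon> * X) Z"
  have Z: "Z > 0" using assms by (simp add: Z_def)
  have "Z powr (1 - a) = \<epsilon> powr (- a) * Y powr (1 - a)"
    using assms by (simp add: Z_def powr_mult powr_powr)
  moreover have "(\<epsilon> * X) powr a = \<epsilon> powr a * X powr a" using assms by (simp add: powr_mult)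
  ultimately have "X powr a * Y powr (1 - a) = (\<epsilon> * X) powr a * Z powr (1 - a)"
    using assms by (simp add: powr_minus)
  also have "\<dots> \<le> m powr a * m powr (1 - a)"
    using assms Z by (intro mult_mono powr_mono2) (auto simp: m_def)
  also have "\<dots> = m" using Z by (simp add: m_def flip: powr_add)
  also have "\<dots> \<le> \<epsilon> * X + Z" using Z assms by (auto simp: m_def)
  finally show ?thesis by (simp add: Z_def)
qed

text \<open>Multiplied out, the last condition is \<open>q < P - a * (P - p)\<close>, with P the
  critical exponent. At \<open>a0 = t * q / (s * p)\<close> it amounts to the strict subcriticality
  hypothesis; being open, it persists for a slightly above a0. The strict excess over a0 is what
  makes \<open>\<eta>\<close> positive in the next lemma.\<close>

lemma subcritical_interpolation_weight:
  fixes N s p t q :: real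
  assumes "0 < N" "0 < s" "0 < p" "s * p < N" "0 \<le> t" "t < s" "0 < q" "N / p - s < N / q - t"
  shows "\<exists>a. 0 < a \<and> a < 1 \<and> t * q < a * (s * p) \<and> a * p < q \<and> (q - a * p) / (1 - a) < N * p / (N - s * p)"
proof -
  define P where "P = N * p / (N - s * p)"
  define a0 where "a0 = t * q / (s * p)"
  have pos: "N - s * p > 0" "s * p > 0" "P > 0" using assms by (auto simp: P_def)
  have key: "q * (N - s * p + t * p) < N * p"
  proof -
    have "(N / p - s + t) * (p * q) < N / q * (p * q)" using assms by (intro mult_strict_right_mono) auto
    then show ?thesis using assms by (simp add: field_simps)
  qed
  have den: "N - s * p + t * p > 0" using pos assms by (simp add: add_pos_nonneg)
  have a0: "0 \<le> a0" "a0 * p < q" using assms by (auto simp: a0_def field_simps)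
  have "t * q < s * p"
  proof (cases "t = 0")
    case False
    then have "t > 0" using assms by simp
    have "t * q * (N - s * p + t * p) < t * (N * p)"
      using mult_strict_left_mono[OF key \<open>t > 0\<close>] by (simp add: mult.assoc)
    also have "\<dots> \<le> s * p * (N - s * p + t * p)"
    proof -
      have "0 \<le> (s - t) * p * (N - s * p)" using assms pos by simp
      then show ?thesis by (simp add: algebra_simps)
    qed
    finally show ?thesis using den by (simp add: mult_less_cancel_right)
  qed (use pos in simp)
  then have a1: "a0 < 1" using pos by (simp add: a0_def)
  have "q < P - a0 * (P - p)"
  proof -
    have "P - p = P * (s * p) / N" using pos assms by (simp add: P_def field_simps)
    then have "P - a0 * (P - p) = P - t * q * P / N" using pos assms by (simp add: a0_def)
    moreover have "q * N < P * (N - t * q)"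
    proof -
      have "q * N * (N - s * p) < N * p * (N - t * q)"
        using mult_strict_left_mono[OF key assms(1)] by (simp add: algebra_simps)
      then show ?thesis using pos by (simp add: P_def field_simps)
    qed
    then have "q < P - t * q * P / N" using assms by (simp add: field_simps)
    ultimately show ?thesis by simp
  qed
  then have "eventually (\<lambda>a. q < P - a * (P - p)) (at_right a0)"
    by (intro order_tendstoD(1)[of "\<lambda>a. P - a * (P - p)" "P - a0 * (P - p)"] tendsto_intros)
  moreover have "eventually (\<lambda>a. a * p < q) (at_right a0)"
    by (intro order_tendstoD(2)[of "\<lambda>a. a * p" "a0 * p"] tendsto_intros a0)
  moreover have "eventually (\<lambda>a. a < 1) (at_right a0)"
    by (intro order_tendstoD(2)[of "\<lambda>a. a" a0] tendsto_intros a1)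
  moreover have "eventually (\<lambda>a. a0 < a) (at_right a0)" by (rule eventually_at_right_less)
  ultimately have "eventually (\<lambda>a. q < P - a * (P - p) \<and> a * p < q \<and> a < 1 \<and> a0 < a) (at_right a0)"
    by eventually_elim auto
  then obtain a where a: "q < P - a * (P - p)" "a * p < q" "a < 1" "a0 < a"
    using eventually_happens'[OF trivial_limit_at_right_real] by blast
  have "(q - a * p) / (1 - a) < P" using a by (simp add: pos_divide_less_eq algebra_simps)
  moreover have "t * q < a * (s * p)" using a(4) pos by (simp add: a0_def pos_divide_less_eq)
  ultimately show ?thesis using a a0 unfolding P_def by (intro exI[of _ a]) auto
qed

text \<open>Apart from the common factor \<open>d powr (- N)\<close>, the left-hand side is
  \<open>X powr a * Y powr (1 - a)\<close>, with \<open>X\<close> the Gagliardo quotient and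
  \<open>Y = D powr Q0 * d powr \<eta>\<close>; matching the powers of D and d forces
  \<open>Q0\<close> and \<open>\<eta>\<close>. Young's inequality separates the factors, and
  \<open>powr_three_terms\<close> trades \<open>D powr Q0\<close> for a small multiple of a higher
  power and a large multiple of D. The exponents \<open>\<eta>\<close> and Q are fixed before
  \<epsilon>.\<close>

lemma gagliardo_kernel_young:
  fixes N s p t q :: real
  assumes "0 < N" "0 < s" "0 < p" "s * p < N" "0 \<le> t" "t < s" "0 < q" "N / p - s < N / q - t"
  shows "\<exists>\<eta> Q. 0 < \<eta> \<and> 0 < Q \<and> Q < N * p / (N - s * p) \<and> (\<forall>\<epsilon>>0. \<exists>K\<ge>0. \<forall>D\<ge>0. \<forall>d>0.
    D powr q / d powr (N + t * q) \<le> \<epsilon> * (D powr p / d powr (N + s * p)) +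
      (\<epsilon> + \<epsilon> * D powr Q + K * D) * d powr (\<eta> - N))"
proof -
  define P where "P = N * p / (N - s * p)"
  obtain a where a: "0 < a" "a < 1" "t * q < a * (s * p)" "a * p < q" "(q - a * p) / (1 - a) < P"
    using subcritical_interpolation_weight[OF assms] unfolding P_def by blast
  define Q0 where "Q0 = (q - a * p) / (1 - a)"
  define \<eta> where "\<eta> = (a * (s * p) - t * q) / (1 - a)"
  \<comment> \<open>Strictly between: above \<open>Q0\<close> for the three-term bound, below
    \<open>P\<close> so that \<open>mass Q u\<close> can be bounded.\<close>
  define Q where "Q = (Q0 + P) / 2"
  have Q0: "0 < Q0" using a by (simp add: Q0_def)
  have "Q0 < P" using a by (simp add: Q0_def)
  then have Q: "Q0 < Q" "Q < P" by (auto simp: Q_def)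
  have \<eta>: "0 < \<eta>" using a by (simp add: \<eta>_def)
  have "\<exists>K\<ge>0. \<forall>D\<ge>0. \<forall>d>0. D powr q / d powr (N + t * q) \<le> \<epsilon> * (D powr p / d powr (N + s * p)) +
      (\<epsilon> + \<epsilon> * D powr Q + K * D) * d powr (\<eta> - N)" if \<epsilon>: "\<epsilon> > 0" for \<epsilon>
  proof -
    define c where "c = \<epsilon> powr (- a / (1 - a))"
    have c: "c > 0" using \<epsilon> by (simp add: c_def)
    \<comment> \<open>\<open>\<epsilon> / c\<close> anticipates the factor \<open>c\<close> from
      Young's inequality.\<close>
    obtain K where K: "K > 0" "\<And>z. z \<ge> 0 \<Longrightarrow> z powr Q0 \<le> \<epsilon> / c + \<epsilon> / c * z powr Q + K * z"
      using powr_three_terms[OF Q0 Q(1), of "\<epsilon> / c"] \<epsilon> c by auto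
    have "D powr q / d powr (N + t * q) \<le> \<epsilon> * (D powr p / d powr (N + s * p)) +
      (\<epsilon> + \<epsilon> * D powr Q + c * K * D) * d powr (\<eta> - N)" if D: "D \<ge> 0" and d: "d > 0" for D d
    proof (cases "D = 0")
      case True
      then show ?thesis using \<epsilon> assms by simp
    next
      case False
      then have D: "D > 0" using D by simp
      define X where "X = D powr p * d powr (- (s * p))"
      define Y where "Y = D powr Q0 * d powr \<eta>"
      have XY: "X > 0" "Y > 0" using D d by (auto simp: X_def Y_def)
      have e1: "p * a + Q0 * (1 - a) = q" using a by (simp add: Q0_def)
      have e2: "- (s * p) * a + \<eta> * (1 - a) = - (t * q)" using a by (simp add: \<eta>_def)
      have "X powr a * Y powr (1 - a) =
          (D powr (p * a) * D powr (Q0 * (1 - a))) * (d powr (- (s * p) * a) * d powr (\<eta> * (1 - a)))"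
        using D d by (simp add: X_def Y_def powr_mult powr_powr)
      also have "\<dots> = D powr q * d powr (- (t * q))"
        unfolding powr_add[symmetric] e1 e2 ..
      finally have "D powr q * d powr (- (t * q)) \<le> \<epsilon> * X + c * Y"
        using weighted_young[OF XY a(1,2) \<epsilon>] by (simp add: c_def)
      also have "c * Y \<le> c * ((\<epsilon> / c + \<epsilon> / c * D powr Q + K * D) * d powr \<eta>)"
        unfolding Y_def using c D K(2)[of D] by (intro mult_left_mono mult_right_mono) auto
      also have "\<dots> = (\<epsilon> + \<epsilon> * D powr Q + c * K * D) * d powr \<eta>"
        using c by (simp add: field_simps)
      finally have "D powr q * d powr (- (t * q)) * d powr (- N) \<le>
        (\<epsilon> * X + (\<epsilon> + \<epsilon> * D powr Q + c * K * D) * d powr \<eta>) * d powr (- N)"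
        by (intro mult_right_mono) auto
      moreover have "D powr q * d powr (- (t * q)) * d powr (- N) = D powr q / d powr (N + t * q)"
        by (simp add: powr_add powr_minus divide_inverse)
      moreover have "X * d powr (- N) = D powr p / d powr (N + s * p)"
        by (simp add: X_def powr_add powr_minus divide_inverse)
      moreover have "d powr \<eta> * d powr (- N) = d powr (\<eta> - N)"
        by (simp flip: powr_add)
      ultimately show ?thesis by (simp add: distrib_right mult.assoc)
    qed
    then show ?thesis using c K by (intro exI[of _ "c * K"]) auto
  qed
  then show ?thesis using \<eta> Q0 Q unfolding P_def by (intro exI[of _ \<eta>] exI[of _ Q]) auto
qed

text \<open>K may blow up as \<epsilon> shrinks, but for each fixed \<epsilon> its term vanishes in
  the limit.\<close>

lemma tendsto_0_if_ehrling:
  fixes X Y :: "nat \<Rightarrow> ennreal"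
  assumes "\<And>\<epsilon>. 0 < \<epsilon> \<Longrightarrow> \<exists>K::real. \<forall>n. X n \<le> ennreal \<epsilon> + ennreal K * Y n" and Y: "Y \<longlonglongrightarrow> 0"
  shows "X \<longlonglongrightarrow> 0"
proof (rule order_tendstoI)
  fix a :: ennreal assume "0 < a"
  then obtain b where b: "0 < b" "b < a" using dense by blast
  then obtain \<epsilon> where e: "b = ennreal \<epsilon>" by (cases b) auto
  with b have \<epsilon>: "\<epsilon> > 0" "ennreal \<epsilon> < a" by auto
  obtain K where K: "\<And>n. X n \<le> ennreal \<epsilon> + ennreal K * Y n" using assms(1)[OF \<epsilon>(1)] by blast
  have "(\<lambda>n. ennreal K * Y n) \<longlonglongrightarrow> ennreal K * 0"
    using Y by (intro ennreal_tendsto_cmult) auto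
  then have "(\<lambda>n. ennreal \<epsilon> + ennreal K * Y n) \<longlonglongrightarrow> ennreal \<epsilon> + ennreal K * 0"
    by (intro tendsto_add tendsto_const)
  then have "eventually (\<lambda>n. ennreal \<epsilon> + ennreal K * Y n < a) sequentially"
    using \<epsilon> by (intro order_tendstoD(2)) auto
  then show "eventually (\<lambda>n. X n < a) sequentially"
    by eventually_elim (use K le_less_trans in blast)
qed simp

context regular_measure
begin

text \<open>Integrate \<open>gagliardo_kernel_young\<close> with
  \<open>D = \<bar>u x - u y\<bar>\<close>. The leftover powers of D split into terms in u x and in
  u y, each integrated against a kernel of uniformly bounded integral. Since Q and K0 precede
  \<epsilon>, a bound on \<open>mass Q u\<close> makes the first term small.\<close>

lemma gagliardo_ehrling:
  assumes "0 < s" "0 < p" "s * p < real DIM('a)" "0 \<le> t" "t < s" "0 < q"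
    "real DIM('a) / p - s < real DIM('a) / q - t"
  shows "\<exists>Q K0. 0 < Q \<and> Q < real DIM('a) * p / (real DIM('a) - s * p) \<and> 0 \<le> K0 \<and>
    (\<forall>\<epsilon>>0. \<exists>K\<ge>0. \<forall>u\<in>borel_measurable M. gagliardo t q u \<le>
       ennreal \<epsilon> * (gagliardo s p u + ennreal K0 * (1 + mass Q u)) + ennreal K * mass 1 u)"
proof -
  define N where "N = real DIM('a)"
  have N: "0 < N" by (simp add: N_def)
  interpret MM: pair_sigma_finite M M ..
  obtain \<eta> Q where \<eta>: "0 < \<eta>" and Q: "0 < Q" "Q < N * p / (N - s * p)"
    and Y: "\<And>\<epsilon>. \<epsilon> > 0 \<Longrightarrow> \<exists>K\<ge>0. \<forall>D\<ge>0. \<forall>d>0.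
    D powr q / d powr (N + t * q) \<le> \<epsilon> * (D powr p / d powr (N + s * p)) +
      (\<epsilon> + \<epsilon> * D powr Q + K * D) * d powr (\<eta> - N)"
    using gagliardo_kernel_young[OF N assms[folded N_def]] by blast
  obtain R where R: "R \<ge> 0" "\<And>x. x \<in> space M \<Longrightarrow> (\<integral>\<^sup>+y. ennreal (norm (x - y) powr (\<eta> - N)) \<partial>M) \<le> ennreal R"
    using radial_bound[OF \<eta>] unfolding N_def by blast
  define \<mu> where "\<mu> = measure M (space M)"
  \<comment> \<open>\<open>R * \<mu>\<close> bounds the double integral of the bare kernel; in the
    other summand \<open>2 powr Q\<close> splits the difference and 2 counts the two
    variables.\<close>
  define K0 where "K0 = R * \<mu> + 2 powr Q * 2 * R"
  have K0: "0 \<le> K0" using R by (simp add: K0_def \<mu>_def)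
  have "\<exists>K\<ge>0. \<forall>u\<in>borel_measurable M. gagliardo t q u \<le>
       ennreal \<epsilon> * (gagliardo s p u + ennreal K0 * (1 + mass Q u)) + ennreal K * mass 1 u" if \<epsilon>: "\<epsilon> > 0" for \<epsilon>
  proof -
    obtain K where K: "K \<ge> 0" "\<And>D d. D \<ge> 0 \<Longrightarrow> d > 0 \<Longrightarrow>
      D powr q / d powr (N + t * q) \<le> \<epsilon> * (D powr p / d powr (N + s * p)) +
      (\<epsilon> + \<epsilon> * D powr Q + K * D) * d powr (\<eta> - N)"
      using Y[OF \<epsilon>] by blast
    have "gagliardo t q u \<le> ennreal \<epsilon> * (gagliardo s p u + ennreal K0 * (1 + mass Q u)) + ennreal (2 * K * R) * mass 1 u"
      if u[measurable]: "u \<in> borel_measurable M" for u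
    proof -
      define A where "A x = ennreal \<epsilon> * ennreal (2 powr Q) * ennreal (\<bar>u x\<bar> powr Q) + ennreal K * ennreal \<bar>u x\<bar>" for x
      define J where "J x y = ennreal (norm (x - y) powr (\<eta> - N))" for x y :: 'a
      define k where "k x y = ennreal (\<bar>u x - u y\<bar> powr p / norm (x - y) powr (N + s * p))" for x y
      have Am[measurable]: "A \<in> borel_measurable M" unfolding A_def by measurable
      have Jm: "(\<lambda>y. J x y) \<in> borel_measurable M" for x unfolding J_def by measurable
      have Jmm[measurable]: "(\<lambda>(x, y). J x y) \<in> borel_measurable (M \<Otimes>\<^sub>M M)" unfolding J_def by measurable
      have km: "(\<lambda>y. k x y) \<in> borel_measurable M" for x unfolding k_def by measurable
      have kI: "(\<lambda>x. \<integral>\<^sup>+y. k x y \<partial>M) \<in> borel_measurable M"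
        unfolding k_def by (rule gagliardo_inner_measurable[OF u])
      have pw: "ennreal (\<bar>u x - u y\<bar> powr q / norm (x - y) powr (N + t * q)) \<le>
         ennreal \<epsilon> * k x y + (ennreal \<epsilon> * J x y + (A x * J x y + A y * J x y))" for x y
      proof (cases "x = y")
        case True
        then show ?thesis by simp
      next
        case False
        define D where "D = \<bar>u x - u y\<bar>"
        define d where "d = norm (x - y)"
        have D: "D \<ge> 0" "d > 0" using False by (auto simp: D_def d_def)
        have DQ: "D powr Q \<le> 2 powr Q * (\<bar>u x\<bar> powr Q + \<bar>u y\<bar> powr Q)"
          unfolding D_def using Q by (intro abs_diff_powr_le)
        have D1: "D \<le> \<bar>u x\<bar> + \<bar>u y\<bar>" by (simp add: D_def)
        have "D powr q / d powr (N + t * q) \<le> \<epsilon> * (D powr p / d powr (N + s * p)) +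
            (\<epsilon> + \<epsilon> * D powr Q + K * D) * d powr (\<eta> - N)" using K(2)[OF D] .
        also have "\<dots> \<le> \<epsilon> * (D powr p / d powr (N + s * p)) +
            (\<epsilon> + \<epsilon> * (2 powr Q * (\<bar>u x\<bar> powr Q + \<bar>u y\<bar> powr Q)) + K * (\<bar>u x\<bar> + \<bar>u y\<bar>)) * d powr (\<eta> - N)"
          using \<epsilon> K(1) by (intro add_left_mono mult_right_mono add_mono mult_left_mono DQ D1) auto
        also have "\<dots> = \<epsilon> * (D powr p / d powr (N + s * p)) + (\<epsilon> * d powr (\<eta> - N) +
            ((\<epsilon> * 2 powr Q * \<bar>u x\<bar> powr Q + K * \<bar>u x\<bar>) * d powr (\<eta> - N) +
             (\<epsilon> * 2 powr Q * \<bar>u y\<bar> powr Q + K * \<bar>u y\<bar>) * d powr (\<eta> - N)))"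
          by (simp add: algebra_simps)
        finally have le: "D powr q / d powr (N + t * q) \<le> \<dots>" .
        define z where "z = D powr p / d powr (N + s * p)"
        have z: "z \<ge> 0" by (simp add: z_def)
        have "ennreal (\<epsilon> * z + (\<epsilon> * d powr (\<eta> - N) +
            ((\<epsilon> * 2 powr Q * \<bar>u x\<bar> powr Q + K * \<bar>u x\<bar>) * d powr (\<eta> - N) +
             (\<epsilon> * 2 powr Q * \<bar>u y\<bar> powr Q + K * \<bar>u y\<bar>) * d powr (\<eta> - N)))) =
           ennreal \<epsilon> * ennreal z + (ennreal \<epsilon> * J x y + (A x * J x y + A y * J x y))"
          unfolding A_def J_def d_def[symmetric] using \<epsilon> K(1) z
          by (simp add: ennreal_plus ennreal_mult)
        with ennreal_leI[OF le] show ?thesis unfolding k_def by (simp add: D_def d_def z_def)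
      qed
      have JA: "(\<integral>\<^sup>+y. A x * J x y \<partial>M) \<le> A x * ennreal R" if "x \<in> space M" for x
        using R(2)[OF that] Jm unfolding J_def by (simp add: nn_integral_cmult mult_left_mono)
      \<comment> \<open>The kernel is symmetric, so the part carrying \<open>u y\<close> equals the
        part carrying \<open>u x\<close>.\<close>
      have swap: "(\<integral>\<^sup>+x. (\<integral>\<^sup>+y. A y * J x y \<partial>M) \<partial>M) = (\<integral>\<^sup>+x. (\<integral>\<^sup>+y. A x * J x y \<partial>M) \<partial>M)"
      proof -
        have "(\<integral>\<^sup>+x. (\<integral>\<^sup>+y. A y * J x y \<partial>M) \<partial>M) = (\<integral>\<^sup>+y. (\<integral>\<^sup>+x. A y * J x y \<partial>M) \<partial>M)"
          by (rule MM.Fubini'[symmetric]) measurable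
        also have "\<dots> = (\<integral>\<^sup>+x. (\<integral>\<^sup>+y. A x * J x y \<partial>M) \<partial>M)"
          by (simp add: J_def norm_minus_commute)
        finally show ?thesis .
      qed
      have IA: "(\<integral>\<^sup>+x. A x \<partial>M) = ennreal \<epsilon> * ennreal (2 powr Q) * mass Q u + ennreal K * mass 1 u"
        unfolding A_def mass_def by (simp add: nn_integral_add nn_integral_cmult)
      have "gagliardo t q u \<le> (\<integral>\<^sup>+x. (\<integral>\<^sup>+y. ennreal \<epsilon> * k x y + (ennreal \<epsilon> * J x y + (A x * J x y + A y * J x y)) \<partial>M) \<partial>M)"
        unfolding gagliardo_def N_def[symmetric] by (intro nn_integral_mono pw)
      also have "\<dots> = (\<integral>\<^sup>+x. ennreal \<epsilon> * (\<integral>\<^sup>+y. k x y \<partial>M) + (ennreal \<epsilon> * (\<integral>\<^sup>+y. J x y \<partial>M) +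
           ((\<integral>\<^sup>+y. A x * J x y \<partial>M) + (\<integral>\<^sup>+y. A y * J x y \<partial>M))) \<partial>M)"
        using Jm km by (simp add: nn_integral_add nn_integral_cmult)
      also have "\<dots> = ennreal \<epsilon> * (\<integral>\<^sup>+x. (\<integral>\<^sup>+y. k x y \<partial>M) \<partial>M) + (ennreal \<epsilon> * (\<integral>\<^sup>+x. (\<integral>\<^sup>+y. J x y \<partial>M) \<partial>M) +
           ((\<integral>\<^sup>+x. (\<integral>\<^sup>+y. A x * J x y \<partial>M) \<partial>M) + (\<integral>\<^sup>+x. (\<integral>\<^sup>+y. A y * J x y \<partial>M) \<partial>M)))"
        using kI by (simp add: nn_integral_add nn_integral_cmult)
      also have "\<dots> \<le> ennreal \<epsilon> * gagliardo s p u + (ennreal \<epsilon> * (ennreal R * ennreal \<mu>) +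
           ((\<integral>\<^sup>+x. A x \<partial>M) * ennreal R + (\<integral>\<^sup>+x. A x \<partial>M) * ennreal R))"
      proof (intro add_mono mult_left_mono)
        show "(\<integral>\<^sup>+x. (\<integral>\<^sup>+y. k x y \<partial>M) \<partial>M) \<le> gagliardo s p u" by (simp add: gagliardo_def k_def N_def)
        have "(\<integral>\<^sup>+x. (\<integral>\<^sup>+y. J x y \<partial>M) \<partial>M) \<le> (\<integral>\<^sup>+x. ennreal R \<partial>M)"
          using R(2) unfolding J_def by (rule nn_integral_mono)
        then show "(\<integral>\<^sup>+x. (\<integral>\<^sup>+y. J x y \<partial>M) \<partial>M) \<le> ennreal R * ennreal \<mu>"
          by (simp add: \<mu>_def emeasure_eq_measure)
        have "(\<integral>\<^sup>+x. (\<integral>\<^sup>+y. A x * J x y \<partial>M) \<partial>M) \<le> (\<integral>\<^sup>+x. A x * ennreal R \<partial>M)"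
          using JA by (rule nn_integral_mono)
        then show "(\<integral>\<^sup>+x. (\<integral>\<^sup>+y. A x * J x y \<partial>M) \<partial>M) \<le> (\<integral>\<^sup>+x. A x \<partial>M) * ennreal R"
          by (simp add: nn_integral_multc)
        then show "(\<integral>\<^sup>+x. (\<integral>\<^sup>+y. A y * J x y \<partial>M) \<partial>M) \<le> (\<integral>\<^sup>+x. A x \<partial>M) * ennreal R"
          unfolding swap .
      qed auto
      also have "\<dots> = ennreal \<epsilon> * (gagliardo s p u + (ennreal (R * \<mu>) + ennreal (2 powr Q * 2 * R) * mass Q u)) + ennreal (2 * K * R) * mass 1 u"
      proof -
        have 1: "ennreal (2 powr Q * 2 * R) = ennreal (2 powr Q) * ennreal R + ennreal (2 powr Q) * ennreal R"
        proof -
          have "2 powr Q * 2 * R = 2 powr Q * R + 2 powr Q * R" by simp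
          then show ?thesis by (simp only: ennreal_plus ennreal_mult R(1) powr_ge_zero mult_nonneg_nonneg)
        qed
        have 2: "ennreal (2 * K * R) = ennreal K * ennreal R + ennreal K * ennreal R"
        proof -
          have "2 * K * R = K * R + K * R" by simp
          then show ?thesis by (simp only: ennreal_plus ennreal_mult R(1) K(1) mult_nonneg_nonneg)
        qed
        have 3: "ennreal (R * \<mu>) = ennreal R * ennreal \<mu>" using R by (intro ennreal_mult) (auto simp: \<mu>_def)
        show ?thesis unfolding IA 1 2 3 by (simp add: algebra_simps)
      qed
      also have "\<dots> \<le> ennreal \<epsilon> * (gagliardo s p u + ennreal K0 * (1 + mass Q u)) + ennreal (2 * K * R) * mass 1 u"
      proof (intro add_right_mono mult_left_mono add_left_mono)
        have "ennreal (R * \<mu>) + ennreal (2 powr Q * 2 * R) * mass Q u \<le> ennreal K0 + ennreal K0 * mass Q u"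
          using R by (intro add_mono mult_right_mono ennreal_leI) (auto simp: K0_def \<mu>_def)
        then show "ennreal (R * \<mu>) + ennreal (2 powr Q * 2 * R) * mass Q u \<le> ennreal K0 * (1 + mass Q u)"
          by (simp add: distrib_left)
      qed simp
      finally show ?thesis .
    qed
    then show ?thesis using K R by (intro exI[of _ "2 * K * R"]) auto
  qed
  then show ?thesis using Q K0 unfolding N_def by blast
qed

lemma mass_ehrling:
  assumes q: "0 < q" "q < Q" and \<epsilon>: "0 < \<epsilon>"
  shows "\<exists>K\<ge>0. \<forall>u\<in>borel_measurable M. mass q u \<le>
       ennreal \<epsilon> * (ennreal (measure M (space M)) + mass Q u) + ennreal K * mass 1 u"
proof -
  obtain K where K: "K > 0" "\<And>z. z \<ge> 0 \<Longrightarrow> z powr q \<le> \<epsilon> + \<epsilon> * z powr Q + K * z"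
    using powr_three_terms[OF q \<epsilon>] by blast
  have "mass q u \<le> ennreal \<epsilon> * (ennreal (measure M (space M)) + mass Q u) + ennreal K * mass 1 u"
    if [measurable]: "u \<in> borel_measurable M" for u
  proof -
    have "mass q u \<le> (\<integral>\<^sup>+x. ennreal \<epsilon> + ennreal \<epsilon> * ennreal (\<bar>u x\<bar> powr Q) + ennreal K * ennreal (\<bar>u x\<bar> powr 1) \<partial>M)"
      unfolding mass_def
    proof (rule nn_integral_mono)
      fix x
      show "ennreal (\<bar>u x\<bar> powr q) \<le> ennreal \<epsilon> + ennreal \<epsilon> * ennreal (\<bar>u x\<bar> powr Q) + ennreal K * ennreal (\<bar>u x\<bar> powr 1)"
        using ennreal_leI[OF K(2)[of "\<bar>u x\<bar>"]] K(1) \<epsilon> by (simp add: ennreal_plus ennreal_mult)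
    qed
    also have "\<dots> = ennreal \<epsilon> * (ennreal (measure M (space M)) + mass Q u) + ennreal K * mass 1 u"
      unfolding mass_def by (simp add: nn_integral_add nn_integral_cmult emeasure_eq_measure distrib_left)
    finally show ?thesis .
  qed
  with K show ?thesis by (intro exI[of _ K]) auto
qed

section \<open>Lower semicontinuity and subcritical bounds\<close>

lemma mass_le_liminf:
  assumes [measurable]: "\<And>n. u n \<in> borel_measurable M" "v \<in> borel_measurable M"
    and "AE x in M. (\<lambda>n. u n x) \<longlonglongrightarrow> v x" and "0 < q"
  shows "mass q v \<le> liminf (\<lambda>n. mass q (u n))"
  unfolding mass_def
proof (rule nn_integral_le_liminf_AE)
  show "AE x in M. (\<lambda>n. ennreal (\<bar>u n x\<bar> powr q)) \<longlonglongrightarrow> ennreal (\<bar>v x\<bar> powr q)"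
    using assms(3) by eventually_elim (intro tendsto_ennrealI tendsto_powr' tendsto_rabs tendsto_const; use assms(4) in auto)
qed simp

text \<open>Fatou's lemma in y at almost every x, then in x; thanks to the iterated form, almost
  everywhere convergence on the single space is enough.\<close>

lemma gagliardo_le_liminf:
  assumes um[measurable]: "\<And>n. u n \<in> borel_measurable M" "v \<in> borel_measurable M"
    and AE: "AE x in M. (\<lambda>n. u n x) \<longlonglongrightarrow> v x" and "0 < p"
  shows "gagliardo s p v \<le> liminf (\<lambda>n. gagliardo s p (u n))"
proof -
  define \<beta> where "\<beta> = real DIM('a) + s * p"
  have "(\<integral>\<^sup>+x. (\<integral>\<^sup>+y. ennreal (\<bar>v x - v y\<bar> powr p / norm (x - y) powr \<beta>) \<partial>M) \<partial>M) \<le>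
     (\<integral>\<^sup>+x. liminf (\<lambda>n. \<integral>\<^sup>+y. ennreal (\<bar>u n x - u n y\<bar> powr p / norm (x - y) powr \<beta>) \<partial>M) \<partial>M)"
  proof (rule nn_integral_mono_AE)
    show "AE x in M. (\<integral>\<^sup>+y. ennreal (\<bar>v x - v y\<bar> powr p / norm (x - y) powr \<beta>) \<partial>M) \<le>
      liminf (\<lambda>n. \<integral>\<^sup>+y. ennreal (\<bar>u n x - u n y\<bar> powr p / norm (x - y) powr \<beta>) \<partial>M)"
      using AE
    proof eventually_elim
      fix x assume x: "(\<lambda>n. u n x) \<longlonglongrightarrow> v x"
      show "(\<integral>\<^sup>+y. ennreal (\<bar>v x - v y\<bar> powr p / norm (x - y) powr \<beta>) \<partial>M) \<le>
        liminf (\<lambda>n. \<integral>\<^sup>+y. ennreal (\<bar>u n x - u n y\<bar> powr p / norm (x - y) powr \<beta>) \<partial>M)"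
      proof (rule nn_integral_le_liminf_AE)
        show "AE y in M. (\<lambda>n. ennreal (\<bar>u n x - u n y\<bar> powr p / norm (x - y) powr \<beta>)) \<longlonglongrightarrow>
            ennreal (\<bar>v x - v y\<bar> powr p / norm (x - y) powr \<beta>)"
          using AE
        proof eventually_elim
          fix y assume y: "(\<lambda>n. u n y) \<longlonglongrightarrow> v y"
          have "(\<lambda>n. \<bar>u n x - u n y\<bar> powr p) \<longlonglongrightarrow> \<bar>v x - v y\<bar> powr p"
            using x y assms(4) by (intro tendsto_powr' tendsto_rabs tendsto_diff tendsto_const) auto
          then show "(\<lambda>n. ennreal (\<bar>u n x - u n y\<bar> powr p / norm (x - y) powr \<beta>)) \<longlonglongrightarrow>
            ennreal (\<bar>v x - v y\<bar> powr p / norm (x - y) powr \<beta>)"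
            unfolding divide_inverse by (intro tendsto_ennrealI tendsto_mult_right)
        qed
      qed measurable
    qed
  qed
  also have "\<dots> \<le> liminf (\<lambda>n. \<integral>\<^sup>+x. (\<integral>\<^sup>+y. ennreal (\<bar>u n x - u n y\<bar> powr p / norm (x - y) powr \<beta>) \<partial>M) \<partial>M)"
    by (rule nn_integral_liminf) (rule gagliardo_inner_measurable[OF um(1)])
  finally show ?thesis by (simp add: gagliardo_def \<beta>_def)
qed

lemma subcritical_exponent:
  assumes "0 < p" "s * p < real DIM('a)" "0 \<le> t" "0 < q"
    "real DIM('a) / p - s < real DIM('a) / q - t"
  shows "q < real DIM('a) * p / (real DIM('a) - s * p)"
proof -
  define N where "N = real DIM('a)"
  have "N / p - s < N / q" using assms unfolding N_def by linarith
  then have "(N / p - s) * (p * q) < N / q * (p * q)" using assms by (intro mult_strict_right_mono) auto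
  moreover have "(N / p - s) * (p * q) = q * (N - s * p)" "N / q * (p * q) = N * p"
    using assms by (auto simp: field_simps)
  ultimately have "q * (N - s * p) < N * p" by simp
  then show ?thesis using assms by (simp add: N_def pos_less_divide_eq)
qed

text \<open>The Ehrling inequality at \<epsilon> = 1 combined with the gain of integrability. It
  takes bounds to bounds instead of comparing norms, because p, q and Q scale differently.\<close>

lemma subcritical_bound:
  assumes H: "0 < s" "1 \<le> p" "s * p < real DIM('a)" "0 \<le> t" "t < s" "0 < q"
    "real DIM('a) / p - s < real DIM('a) / q - t"
  shows "\<exists>C\<ge>0. \<forall>u\<in>borel_measurable M. mass p u \<le> ennreal B \<and> gagliardo s p u \<le> ennreal B \<longrightarrow>
    mass q u \<le> ennreal C \<and> gagliardo t q u \<le> ennreal C"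
proof -
  have p: "0 < p" using H by simp
  obtain Q K0 where Q: "0 < Q" "Q < real DIM('a) * p / (real DIM('a) - s * p)" and K0: "0 \<le> K0"
    and E: "\<And>\<epsilon>. \<epsilon> > 0 \<Longrightarrow> \<exists>K\<ge>0. \<forall>u\<in>borel_measurable M. gagliardo t q u \<le>
       ennreal \<epsilon> * (gagliardo s p u + ennreal K0 * (1 + mass Q u)) + ennreal K * mass 1 u"
    using gagliardo_ehrling[OF H(1) p H(3-7)] by blast
  obtain K where K: "K \<ge> 0" "\<And>u. u \<in> borel_measurable M \<Longrightarrow> gagliardo t q u \<le>
       ennreal 1 * (gagliardo s p u + ennreal K0 * (1 + mass Q u)) + ennreal K * mass 1 u"
    using E[of 1] by auto
  obtain C1 where C1: "\<And>u. u \<in> borel_measurable M \<Longrightarrow> mass p u \<le> ennreal B \<Longrightarrow> gagliardo s p u \<le> ennreal B \<Longrightarrow> mass Q u \<le> ennreal C1"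
    using subcritical_mass_bound[OF H(1) p H(3) Q, of B] by blast
  obtain C2 where C2: "\<And>u. u \<in> borel_measurable M \<Longrightarrow> mass p u \<le> ennreal B \<Longrightarrow> gagliardo s p u \<le> ennreal B \<Longrightarrow> mass q u \<le> ennreal C2"
    using subcritical_mass_bound[OF H(1) p H(3,6) subcritical_exponent[OF p H(3,4,6,7)], of B] by blast
  define \<mu> where "\<mu> = measure M (space M)"
  \<comment> \<open>Absolute values, because the given real bounds may be negative, where
    \<open>ennreal\<close> cuts them off at 0.\<close>
  define C where "C = max \<bar>C2\<bar> (1 * (\<bar>B\<bar> + K0 * (1 + \<bar>C1\<bar>)) + K * (\<bar>B\<bar> + \<mu>))"
  have "mass q u \<le> ennreal C \<and> gagliardo t q u \<le> ennreal C"
    if u: "u \<in> borel_measurable M" "mass p u \<le> ennreal B" "gagliardo s p u \<le> ennreal B" for u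
  proof
    have "ennreal C2 \<le> ennreal C" by (rule ennreal_leI) (simp add: C_def)
    with C2[OF u] show "mass q u \<le> ennreal C" by (rule order_trans)
    have B: "ennreal B \<le> ennreal \<bar>B\<bar>" "ennreal C1 \<le> ennreal \<bar>C1\<bar>" by (auto intro: ennreal_leI)
    have "mass 1 u \<le> mass p u + emeasure M (space M)" using u H by (intro mass_le_mass) auto
    also have "\<dots> \<le> ennreal \<bar>B\<bar> + ennreal \<mu>"
      using order_trans[OF u(2) B(1)] by (intro add_mono) (auto simp: \<mu>_def emeasure_eq_measure)
    finally have m1: "mass 1 u \<le> ennreal \<bar>B\<bar> + ennreal \<mu>" .
    have "gagliardo t q u \<le> ennreal 1 * (gagliardo s p u + ennreal K0 * (1 + mass Q u)) + ennreal K * mass 1 u"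
      by (rule K(2)[OF u(1)])
    also have "\<dots> \<le> ennreal 1 * (ennreal \<bar>B\<bar> + ennreal K0 * (ennreal 1 + ennreal \<bar>C1\<bar>)) + ennreal K * (ennreal \<bar>B\<bar> + ennreal \<mu>)"
      using order_trans[OF u(3) B(1)] order_trans[OF C1[OF u] B(2)] m1
      by (intro add_mono mult_left_mono) auto
    also have "\<dots> = ennreal (1 * (\<bar>B\<bar> + K0 * (1 + \<bar>C1\<bar>)) + K * (\<bar>B\<bar> + \<mu>))"
      using K0 K(1) by (simp only: ennreal_plus ennreal_mult \<mu>_def measure_nonneg abs_ge_zero
        mult_nonneg_nonneg add_nonneg_nonneg zero_le_one)
    also have "\<dots> \<le> ennreal C" by (rule ennreal_leI) (simp add: C_def)
    finally show "gagliardo t q u \<le> ennreal C" .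
  qed
  then show ?thesis by (intro exI[of _ C]) (auto simp: C_def)
qed

text \<open>The L^1 limit inherits the energy bound by lower semicontinuity, so the differences stay
  bounded in the source while tending to 0 in L^1; the Ehrling inequalities turn this into
  convergence in the target.\<close>

lemma subcritical_compactness:
  fixes u :: "nat \<Rightarrow> 'a \<Rightarrow> real"
  assumes H: "0 < s" "1 \<le> p" "s * p < real DIM('a)" "0 \<le> t" "t < s" "0 < q"
    "real DIM('a) / p - s < real DIM('a) / q - t"
    and B: "0 \<le> B" and um[measurable]: "\<And>n. u n \<in> borel_measurable M"
    and ub: "\<And>n. mass p (u n) \<le> ennreal B" "\<And>n. gagliardo s p (u n) \<le> ennreal B"
  shows "\<exists>v\<in>borel_measurable M. \<exists>r. strict_mono r \<and> mass p v \<le> ennreal B \<and> gagliardo s p v \<le> ennreal B \<and>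
    (\<lambda>n. mass q (\<lambda>x. u (r n) x - v x)) \<longlonglongrightarrow> 0 \<and> (\<lambda>n. gagliardo t q (\<lambda>x. u (r n) x - v x)) \<longlonglongrightarrow> 0"
proof -
  have p: "0 < p" using H by simp
  from L1_compactness[where u = u, OF H(1,2) B um ub]
  obtain v r where vm[measurable]: "v \<in> borel_measurable M" and r: "strict_mono r"
    and AE: "AE x in M. (\<lambda>n. u (r n) x) \<longlonglongrightarrow> v x"
    and L1: "(\<lambda>n. \<integral>\<^sup>+x. ennreal \<bar>u (r n) x - v x\<bar> \<partial>M) \<longlonglongrightarrow> 0"
    by (elim bexE exE conjE) (rule that)
  have mv: "mass p v \<le> ennreal B"
  proof -
    have "mass p v \<le> liminf (\<lambda>n. mass p (u (r n)))" using AE p by (intro mass_le_liminf) auto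
    also have "\<dots> \<le> ennreal B" using ub by (intro liminf_le_const) auto
    finally show ?thesis .
  qed
  have gv: "gagliardo s p v \<le> ennreal B"
  proof -
    have "gagliardo s p v \<le> liminf (\<lambda>n. gagliardo s p (u (r n)))" using AE p by (intro gagliardo_le_liminf) auto
    also have "\<dots> \<le> ennreal B" using ub by (intro liminf_le_const) auto
    finally show ?thesis .
  qed
  define w where "w n x = u (r n) x - v x" for n x
  have wm[measurable]: "w n \<in> borel_measurable M" for n unfolding w_def by measurable
  define B2 where "B2 = 2 powr p * (B + B)"
  have B2e: "ennreal B2 = ennreal (2 powr p) * (ennreal B + ennreal B)"
    unfolding B2_def by (simp only: ennreal_mult ennreal_plus B powr_ge_zero add_nonneg_nonneg)
  have B20: "0 \<le> B2" using B by (simp add: B2_def)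
  have wb: "mass p (w n) \<le> ennreal B2" "gagliardo s p (w n) \<le> ennreal B2" for n
  proof -
    have "mass p (w n) \<le> ennreal (2 powr p) * (mass p (u (r n)) + mass p v)"
      unfolding w_def using p by (intro mass_diff_le) auto
    also have "\<dots> \<le> ennreal (2 powr p) * (ennreal B + ennreal B)"
      by (intro mult_left_mono add_mono ub mv) auto
    finally show "mass p (w n) \<le> ennreal B2" unfolding B2e .
    have "gagliardo s p (w n) \<le> ennreal (2 powr p) * (gagliardo s p (u (r n)) + gagliardo s p v)"
      unfolding w_def using p by (intro gagliardo_diff_le) auto
    also have "\<dots> \<le> ennreal (2 powr p) * (ennreal B + ennreal B)"
      by (intro mult_left_mono add_mono ub gv) auto
    finally show "gagliardo s p (w n) \<le> ennreal B2" unfolding B2e .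
  qed
  have L1': "(\<lambda>n. mass 1 (w n)) \<longlonglongrightarrow> 0" using L1 by (simp add: mass_def w_def)
  have mq: "(\<lambda>n. mass q (w n)) \<longlonglongrightarrow> 0"
  proof (rule tendsto_0_if_ehrling[OF _ L1'])
    fix \<epsilon> :: real assume \<epsilon>: "0 < \<epsilon>"
    obtain Q where Q: "q < Q" "Q < real DIM('a) * p / (real DIM('a) - s * p)"
      using dense[OF subcritical_exponent[OF p H(3,4,6,7)]] by blast
    obtain C where C: "\<And>u. u \<in> borel_measurable M \<Longrightarrow> mass p u \<le> ennreal B2 \<Longrightarrow> gagliardo s p u \<le> ennreal B2 \<Longrightarrow> mass Q u \<le> ennreal C"
      using subcritical_mass_bound[OF H(1) p H(3) _ Q(2), of B2] Q(1) H(6) by fastforce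
    \<comment> \<open>\<open>Z\<close> bounds the bracket that the small factor multiplies, so the
      choice \<open>\<epsilon> / Z\<close> leaves at most \<open>\<epsilon>\<close>.\<close>
    define Z where "Z = measure M (space M) + \<bar>C\<bar> + 1"
    have Z: "Z > 0" by (simp add: Z_def add_nonneg_pos)
    obtain K where K: "\<And>u. u \<in> borel_measurable M \<Longrightarrow> mass q u \<le>
       ennreal (\<epsilon> / Z) * (ennreal (measure M (space M)) + mass Q u) + ennreal K * mass 1 u"
      using mass_ehrling[OF H(6) Q(1), of "\<epsilon> / Z"] \<epsilon> Z by auto
    have "mass q (w n) \<le> ennreal \<epsilon> + ennreal K * mass 1 (w n)" for n
    proof -
      have "ennreal (measure M (space M)) + mass Q (w n) \<le> ennreal (measure M (space M)) + ennreal C"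
        by (intro add_left_mono C wm wb)
      also have "\<dots> \<le> ennreal (measure M (space M)) + ennreal (\<bar>C\<bar> + 1)"
        by (intro add_left_mono ennreal_leI) simp
      also have "\<dots> = ennreal Z" by (subst ennreal_plus[symmetric]) (auto simp: Z_def)
      finally have "ennreal (\<epsilon> / Z) * (ennreal (measure M (space M)) + mass Q (w n)) \<le> ennreal (\<epsilon> / Z) * ennreal Z"
        by (rule mult_left_mono) simp
      also have "\<dots> = ennreal \<epsilon>" using Z \<epsilon> by (subst ennreal_mult[symmetric]) auto
      finally show ?thesis using K[OF wm, of n] by (meson add_right_mono order_trans)
    qed
    then show "\<exists>K. \<forall>n. mass q (w n) \<le> ennreal \<epsilon> + ennreal K * mass 1 (w n)" by blast
  qed
  have gq: "(\<lambda>n. gagliardo t q (w n)) \<longlonglongrightarrow> 0"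
  proof (rule tendsto_0_if_ehrling[OF _ L1'])
    fix \<epsilon> :: real assume \<epsilon>: "0 < \<epsilon>"
    obtain Q K0 where Q: "0 < Q" "Q < real DIM('a) * p / (real DIM('a) - s * p)" and K0: "0 \<le> K0"
      and E: "\<And>\<epsilon>. \<epsilon> > 0 \<Longrightarrow> \<exists>K\<ge>0. \<forall>u\<in>borel_measurable M. gagliardo t q u \<le>
         ennreal \<epsilon> * (gagliardo s p u + ennreal K0 * (1 + mass Q u)) + ennreal K * mass 1 u"
      using gagliardo_ehrling[OF H(1) p H(3-7)] by blast
    obtain C where C: "\<And>u. u \<in> borel_measurable M \<Longrightarrow> mass p u \<le> ennreal B2 \<Longrightarrow> gagliardo s p u \<le> ennreal B2 \<Longrightarrow> mass Q u \<le> ennreal C"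
      using subcritical_mass_bound[OF H(1) p H(3) Q, of B2] by blast
    define Z where "Z = B2 + K0 * (1 + \<bar>C\<bar>) + 1"
    have Z: "Z > 0" using B20 K0 by (simp add: Z_def add_nonneg_pos)
    obtain K where K: "\<And>u. u \<in> borel_measurable M \<Longrightarrow> gagliardo t q u \<le>
         ennreal (\<epsilon> / Z) * (gagliardo s p u + ennreal K0 * (1 + mass Q u)) + ennreal K * mass 1 u"
      using E[of "\<epsilon> / Z"] \<epsilon> Z by auto
    have "gagliardo t q (w n) \<le> ennreal \<epsilon> + ennreal K * mass 1 (w n)" for n
    proof -
      have "mass Q (w n) \<le> ennreal \<bar>C\<bar>"
        using C[OF wm wb] by (rule order_trans) (simp add: ennreal_leI)
      then have "gagliardo s p (w n) + ennreal K0 * (1 + mass Q (w n)) \<le> ennreal B2 + ennreal K0 * (ennreal 1 + ennreal \<bar>C\<bar>)"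
        by (intro add_mono mult_left_mono wb) auto
      also have "\<dots> = ennreal (B2 + K0 * (1 + \<bar>C\<bar>))"
        using B20 K0 by (simp add: ennreal_plus ennreal_mult del: ennreal_1)
      also have "\<dots> \<le> ennreal Z" by (rule ennreal_leI) (simp add: Z_def)
      finally have "ennreal (\<epsilon> / Z) * (gagliardo s p (w n) + ennreal K0 * (1 + mass Q (w n))) \<le> ennreal (\<epsilon> / Z) * ennreal Z"
        by (rule mult_left_mono) simp
      also have "\<dots> = ennreal \<epsilon>" using Z \<epsilon> by (subst ennreal_mult[symmetric]) auto
      finally show ?thesis using K[OF wm, of n] by (meson add_right_mono order_trans)
    qed
    then show "\<exists>K. \<forall>n. gagliardo t q (w n) \<le> ennreal \<epsilon> + ennreal K * mass 1 (w n)" by blast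
  qed
  show ?thesis
    using vm r mv gv mq gq unfolding w_def by blast
qed

end

section \<open>The embedding for orders below 1\<close>

lemma ennreal_powr_ennreal: "0 \<le> x \<Longrightarrow> ennreal_powr (ennreal x) a = ennreal (x powr a)"
  by (simp add: ennreal_powr_def)

lemma ennreal_powr_inverse:
  assumes "0 < a" "a * b = 1"
  shows "ennreal_powr (ennreal_powr x a) b = x"
proof (cases x)
  case (real r)
  then show ?thesis using assms by (simp add: ennreal_powr_ennreal powr_powr)
qed (simp add: ennreal_powr_def)

lemma ennreal_powr_mono:
  assumes "0 < a" "x \<le> y"
  shows "ennreal_powr x a \<le> ennreal_powr y a"
proof (cases y)
  case (real r)
  then obtain z where "x = ennreal z" "0 \<le> z" using assms(2) by (cases x) (auto simp: top_unique)
  then show ?thesis using real assms by (simp add: ennreal_powr_ennreal ennreal_leI powr_mono2)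
qed (simp add: ennreal_powr_def)

lemma ennreal_powr_less_top_iff: "ennreal_powr x a < \<infinity> \<longleftrightarrow> x < \<infinity>"
  by (cases x) (auto simp: ennreal_powr_def)

lemma ennreal_powr_mult:
  assumes "0 < c"
  shows "ennreal_powr (ennreal c * x) a = ennreal (c powr a) * ennreal_powr x a"
proof (cases x)
  case (real r)
  then show ?thesis using assms by (simp add: ennreal_powr_ennreal powr_mult flip: ennreal_mult)
next
  case top
  then show ?thesis using assms by (simp add: ennreal_powr_def ennreal_mult_top)
qed

lemma ennreal_powr_tendsto_0:
  fixes X :: "nat \<Rightarrow> ennreal"
  assumes "0 < a" "X \<longlonglongrightarrow> 0"
  shows "(\<lambda>n. ennreal_powr (X n) a) \<longlonglongrightarrow> 0"
proof (rule order_tendstoI)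
  fix e :: ennreal assume "0 < e"
  then obtain b where b: "0 < b" "b < e" using dense by blast
  then obtain \<epsilon> where e: "b = ennreal \<epsilon>" "0 \<le> \<epsilon>" by (cases b) auto
  with b have \<epsilon>: "0 < \<epsilon>" "ennreal \<epsilon> < e" by auto
  have "0 < ennreal (\<epsilon> powr (1 / a))" using \<epsilon> by simp
  with assms(2) have "eventually (\<lambda>n. X n < ennreal (\<epsilon> powr (1 / a))) sequentially"
    by (rule order_tendstoD)
  then show "eventually (\<lambda>n. ennreal_powr (X n) a < e) sequentially"
  proof eventually_elim
    fix n assume "X n < ennreal (\<epsilon> powr (1 / a))"
    then have "ennreal_powr (X n) a \<le> ennreal_powr (ennreal (\<epsilon> powr (1 / a))) a"
      using assms(1) by (intro ennreal_powr_mono) auto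
    also have "\<dots> = ennreal \<epsilon>" using \<epsilon> assms(1) by (simp add: ennreal_powr_ennreal powr_powr)
    finally show "ennreal_powr (X n) a < e" using \<epsilon>(2) by (rule le_less_trans)
  qed
qed simp

text \<open>Both Gamma arguments are positive; the first is half of
  \<open>p * s + (p - 1) + (N - 1)\<close>. Positivity allows the seminorm to be recovered from the
  energy.\<close>

lemma sobolev_const_pos:
  assumes "0 < s" "s < 1" "1 \<le> p" "1 \<le> N"
  shows "0 < sobolev_const N s p"
proof -
  have "0 < p * s" using assms by simp
  moreover have "0 \<le> p - 1" "0 \<le> real N - 1" using assms by auto
  ultimately have "0 < p * s + ((p - 1) + (real N - 1))" by (intro add_pos_nonneg add_nonneg_nonneg)
  then have "0 < (p * s + p + real N - 2) / 2" by simp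
  then have "0 < Gamma ((p * s + p + real N - 2) / 2)" by (rule Gamma_real_pos)
  moreover have "0 < Gamma (1 - s)" using assms by (intro Gamma_real_pos) simp
  ultimately show ?thesis using assms by (simp add: sobolev_const_def)
qed

lemma nn_integral_lebesgue_on:
  assumes "open \<Omega>"
  shows "(\<integral>\<^sup>+x. f x \<partial>lebesgue_on \<Omega>) = (\<integral>\<^sup>+x. f x * indicator \<Omega> x \<partial>lborel)"
proof -
  have "\<Omega> \<in> sets lebesgue" using assms by (simp add: borel_open sets_completionI_sets)
  then have "(\<integral>\<^sup>+x. f x \<partial>lebesgue_on \<Omega>) = (\<integral>\<^sup>+x. f x * indicator \<Omega> x \<partial>lebesgue)"
    by (intro nn_integral_restrict_space) simp
  then show ?thesis by (simp add: nn_integral_completion)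
qed

text \<open>The lower bound on balls comes from the cone. For the potentials, centring at x moves
  \<Omega> into a ball of radius \<open>2 * R\<close>, whose radial integral is finite and
  independent of x.\<close>

lemma regular_measure_lebesgue_on:
  fixes \<Omega> :: "'a::euclidean_space set"
  assumes "open \<Omega>" "bounded \<Omega>" "uniform_cone \<Omega> \<rho> \<epsilon> F"
  shows "\<exists>\<kappa>. regular_measure (lebesgue_on \<Omega>) \<kappa>"
proof -
  obtain \<kappa> where \<kappa>: "\<kappa> > 0" "\<And>x r. x \<in> \<Omega> \<Longrightarrow> 0 < r \<Longrightarrow> r \<le> 1 \<Longrightarrow>
     ennreal (\<kappa> * r ^ DIM('a)) \<le> emeasure lborel (\<Omega> \<inter> ball x r)"
    using uniform_cone_measure_density[OF assms(3,1)] by blast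
  have lm: "\<Omega> \<in> lmeasurable" using assms by (intro lmeasurable_open)
  interpret finite_measure "lebesgue_on \<Omega>" using lm by (rule finite_measure_lebesgue_on)
  have "regular_measure (lebesgue_on \<Omega>) \<kappa>"
  proof
    show "(\<lambda>x. x) \<in> borel_measurable (lebesgue_on \<Omega>)"
      by (intro measurable_restrict_space1 measurable_completion) simp
    show "bounded (space (lebesgue_on \<Omega>))" using assms by simp
    show "0 < \<kappa>" by (rule \<kappa>)
  next
    fix x :: 'a and r :: real
    assume x: "x \<in> space (lebesgue_on \<Omega>)" and r: "0 < r" "r \<le> 1"
    have b: "\<Omega> \<inter> ball x r \<in> sets borel" using assms by (intro sets.Int borel_open) auto
    have o: "open (\<Omega> \<inter> ball x r)" using assms by (intro open_Int) auto
    have "emeasure (lebesgue_on \<Omega>) (\<Omega> \<inter> ball x r) = (\<integral>\<^sup>+y. indicator (\<Omega> \<inter> ball x r) y \<partial>lebesgue_on \<Omega>)"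
      using b lm by (intro nn_integral_indicator[symmetric]) (auto simp: sets_restrict_space_iff fmeasurableD sets_completionI_sets)
    also have "\<dots> = (\<integral>\<^sup>+y. indicator (\<Omega> \<inter> ball x r) y * indicator \<Omega> y \<partial>lborel)"
      by (rule nn_integral_lebesgue_on[OF assms(1)])
    also have "\<dots> = (\<integral>\<^sup>+y. indicator (\<Omega> \<inter> ball x r) y \<partial>lborel)"
      by (intro nn_integral_cong) (auto simp: indicator_def)
    also have "\<dots> = emeasure lborel (\<Omega> \<inter> ball x r)" using b by simp
    finally show "ennreal (\<kappa> * r ^ DIM('a)) \<le> emeasure (lebesgue_on \<Omega>) (space (lebesgue_on \<Omega>) \<inter> ball x r)"
      using \<kappa>(2)[of x r] x r by simp
  next
    fix \<eta> :: real assume \<eta>: "0 < \<eta>"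
    obtain R where R: "\<And>x. x \<in> \<Omega> \<Longrightarrow> norm x < R"
      using assms(2) unfolding bounded_pos_less by blast
    define I where "I = (\<integral>\<^sup>+h. ennreal (norm (h::'a) powr (\<eta> - real DIM('a))) * indicator (ball 0 (2 * R)) h \<partial>lborel)"
    have I: "I < \<infinity>" unfolding I_def using \<eta> by (intro radial_integral_finite) simp
    have "(\<integral>\<^sup>+y. ennreal (norm (x - y) powr (\<eta> - real DIM('a))) \<partial>lebesgue_on \<Omega>) \<le> ennreal (enn2real I)"
      if x: "x \<in> space (lebesgue_on \<Omega>)" for x
    proof -
      have "(\<integral>\<^sup>+y. ennreal (norm (x - y) powr (\<eta> - real DIM('a))) \<partial>lebesgue_on \<Omega>) =
         (\<integral>\<^sup>+y. ennreal (norm (x - y) powr (\<eta> - real DIM('a))) * indicator \<Omega> y \<partial>lborel)"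
        by (rule nn_integral_lebesgue_on[OF assms(1)])
      also have "\<dots> \<le> (\<integral>\<^sup>+y. ennreal (norm (y + - x) powr (\<eta> - real DIM('a))) * indicator (ball 0 (2 * R)) (y + - x) \<partial>lborel)"
      proof (rule nn_integral_mono)
        fix y
        have "norm (y - x) < 2 * R" if "y \<in> \<Omega>"
          using norm_triangle_ineq4[of y x] R[OF that] R[of x] x by simp
        then show "ennreal (norm (x - y) powr (\<eta> - real DIM('a))) * indicator \<Omega> y \<le>
          ennreal (norm (y + - x) powr (\<eta> - real DIM('a))) * indicator (ball 0 (2 * R)) (y + - x)"
          by (auto simp: indicator_def norm_minus_commute)
      qed
      also have "\<dots> = I" unfolding I_def
      proof (rule nn_integral_lborel_translate)
        show "(\<lambda>h::'a. ennreal (norm h powr (\<eta> - real DIM('a))) * indicator (ball 0 (2 * R)) h) \<in> borel_measurable borel"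
          by (intro borel_measurable_times_ennreal borel_measurable_indicator) auto
      qed
      finally show ?thesis using I by simp
    qed
    then show "\<exists>K\<ge>0. \<forall>x\<in>space (lebesgue_on \<Omega>).
        (\<integral>\<^sup>+y. ennreal (norm (x - y) powr (\<eta> - real DIM('a))) \<partial>lebesgue_on \<Omega>) \<le> ennreal K"
      by (intro exI[of _ "enn2real I"]) auto
  qed
  then show ?thesis by blast
qed

locale regular_domain = regular_measure "lebesgue_on \<Omega>" \<kappa>
  for \<Omega> :: "'a::euclidean_space set" and \<kappa> :: real
begin

text \<open>The \<open>p\<close>-th power of \<open>sobolev_norm s p\<close>, for \<open>0 \<le> s < 1\<close>.\<close>

definition energy :: "real \<Rightarrow> real \<Rightarrow> ('a \<Rightarrow> real) \<Rightarrow> ennreal" where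
  "energy s p u = (if s = 0 then mass p u
     else ennreal (sobolev_const DIM('a) s p) * gagliardo s p u + mass p u)"

lemma Lp_norm_eq: "Lp_norm p \<Omega> u = ennreal_powr (mass p u) (1 / p)"
  by (simp add: Lp_norm_def mass_def)

text \<open>Tonelli: the seminorm is defined over the product measure, \<open>gagliardo\<close> as
  an iterated integral.\<close>

lemma gagliardo_seminorm_eq:
  assumes "u \<in> borel_measurable (lebesgue_on \<Omega>)"
  shows "gagliardo_seminorm s p \<Omega> u =
    ennreal_powr (ennreal (sobolev_const DIM('a) s p) * gagliardo s p u) (1 / p)"
  unfolding gagliardo_seminorm_def gagliardo_def
  using nn_integral_fst[OF gagliardo_kernel_measurable[OF assms, of p "real DIM('a) + s * p"]]
  by simp

lemma sobolev_norm_eq: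
  assumes "0 \<le> s" "s < 1" "1 \<le> p" "u \<in> borel_measurable (lebesgue_on \<Omega>)"
  shows "sobolev_norm s p \<Omega> u = ennreal_powr (energy s p u) (1 / p)"
  using assms
  by (auto simp: sobolev_norm_def energy_def sobolev_seminorm_def Lp_norm_eq gagliardo_seminorm_eq ennreal_powr_inverse)

lemma sobolev_space_eq:
  assumes "0 \<le> s" "s < 1" "1 \<le> p"
  shows "sobolev_space s p \<Omega> = {u \<in> borel_measurable (lebesgue_on \<Omega>). energy s p u < \<infinity>}"
proof -
  have "u \<in> sobolev_space s p \<Omega> \<longleftrightarrow> energy s p u < \<infinity>" if u: "u \<in> borel_measurable (lebesgue_on \<Omega>)" for u
    using u assms ennreal_powr_less_top_iff[of _ "1 / p"]
    by (auto simp: sobolev_space_def Lp_space_def sobolev_seminorm_def Lp_norm_eq gagliardo_seminorm_eq energy_def)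
  then show ?thesis by (auto simp: sobolev_space_def Lp_space_def)
qed

lemma energy_scale:
  assumes u[measurable]: "u \<in> borel_measurable (lebesgue_on \<Omega>)" and c: "0 < c"
  shows "energy s p (\<lambda>x. c * u x) = ennreal (c powr p) * energy s p u"
proof -
  have m: "mass p (\<lambda>x. c * u x) = ennreal (c powr p) * mass p u"
    unfolding mass_def using c
    by (subst nn_integral_cmult[symmetric]) (auto simp: abs_mult powr_mult ennreal_mult)
  have "gagliardo s p (\<lambda>x. c * u x) = (\<integral>\<^sup>+x. (\<integral>\<^sup>+y. ennreal (c powr p) *
     ennreal (\<bar>u x - u y\<bar> powr p / norm (x - y) powr (real DIM('a) + s * p)) \<partial>lebesgue_on \<Omega>) \<partial>lebesgue_on \<Omega>)"
    unfolding gagliardo_def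
  proof (intro nn_integral_cong)
    fix x y
    have "\<bar>c * u x - c * u y\<bar> = c * \<bar>u x - u y\<bar>" using c by (simp add: abs_mult flip: right_diff_distrib)
    then have "\<bar>c * u x - c * u y\<bar> powr p / norm (x - y) powr (real DIM('a) + s * p) =
       c powr p * (\<bar>u x - u y\<bar> powr p / norm (x - y) powr (real DIM('a) + s * p))"
      using c by (simp add: powr_mult)
    then show "ennreal (\<bar>c * u x - c * u y\<bar> powr p / norm (x - y) powr (real DIM('a) + s * p)) =
       ennreal (c powr p) * ennreal (\<bar>u x - u y\<bar> powr p / norm (x - y) powr (real DIM('a) + s * p))"
      by (simp only:) (rule ennreal_mult, auto)
  qed
  also have "\<dots> = (\<integral>\<^sup>+x. ennreal (c powr p) * (\<integral>\<^sup>+y.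
     ennreal (\<bar>u x - u y\<bar> powr p / norm (x - y) powr (real DIM('a) + s * p)) \<partial>lebesgue_on \<Omega>) \<partial>lebesgue_on \<Omega>)"
    by (intro nn_integral_cong nn_integral_cmult) measurable
  also have "\<dots> = ennreal (c powr p) * gagliardo s p u"
    unfolding gagliardo_def by (rule nn_integral_cmult) (rule gagliardo_inner_measurable[OF u])
  finally show ?thesis using m by (simp add: energy_def distrib_left mult.left_commute)
qed

text \<open>Inclusion and compactness follow from the energy bounds. For continuity these lack
  homogeneity; it is recovered from the case of energy at most 1 by scaling, as
  \<open>energy s p\<close> has degree p and \<open>energy t q\<close> degree q.\<close>

lemma compactly_embedded_subcritical:
  assumes H: "0 < s" "1 \<le> p" "s * p < real DIM('a)" "0 \<le> t" "t < s"
    "real DIM('a) / p - s < real DIM('a) / q - t" and s1: "s < 1" and q: "1 \<le> q"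
  shows "compactly_embedded (sobolev_space s p \<Omega>) (sobolev_norm s p \<Omega>) (sobolev_space t q \<Omega>) (sobolev_norm t q \<Omega>)"
proof -
  have q0: "0 < q" using q by simp
  note H' = H(1-5) q0 H(6)
  have st: "0 \<le> s" "t < 1" using H s1 by auto
  define c where "c = sobolev_const DIM('a) s p"
  have c: "0 < c" unfolding c_def using H s1 by (intro sobolev_const_pos) (auto simp: Suc_leI)
  \<comment> \<open>With the absolute value one estimate serves both \<open>t = 0\<close>, where
    \<open>energy\<close> has no seminorm term, and \<open>t > 0\<close>.\<close>
  define c' where "c' = \<bar>sobolev_const DIM('a) t q\<bar>"
  \<comment> \<open>One number bounds both parts; freeing the seminorm of its constant costs the
    factor \<open>1 / c\<close>.\<close>
  have dom: "mass p u \<le> ennreal (B + B / c)" "gagliardo s p u \<le> ennreal (B + B / c)"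
    if "energy s p u \<le> ennreal B" "0 \<le> B" for u B
  proof -
    have e: "ennreal c * gagliardo s p u + mass p u \<le> ennreal B"
      using that H by (simp add: energy_def c_def)
    have "mass p u \<le> ennreal c * gagliardo s p u + mass p u" by (simp add: add_increasing)
    also have "\<dots> \<le> ennreal (B + B / c)"
      using that c by (intro order_trans[OF e] ennreal_leI) simp
    finally show "mass p u \<le> ennreal (B + B / c)" .
    have "ennreal c * gagliardo s p u \<le> ennreal c * gagliardo s p u + mass p u" by (simp add: add_increasing2)
    also have "\<dots> \<le> ennreal B" by (rule e)
    finally have "ennreal (1 / c) * (ennreal c * gagliardo s p u) \<le> ennreal (1 / c) * ennreal B"
      by (rule mult_left_mono) simp
    moreover have "ennreal (1 / c) * (ennreal c * gagliardo s p u) = gagliardo s p u"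
      using c by (simp flip: mult.assoc ennreal_mult)
    moreover have "ennreal (1 / c) * ennreal B = ennreal (B / c)"
      using c that by (simp flip: ennreal_mult)
    moreover have "ennreal (B / c) \<le> ennreal (B + B / c)" using that by (intro ennreal_leI) simp
    ultimately show "gagliardo s p u \<le> ennreal (B + B / c)" by simp
  qed
  have le_energy: "energy t q u \<le> ennreal c' * gagliardo t q u + mass q u" for u
    by (auto simp: energy_def c'_def intro!: add_right_mono mult_right_mono ennreal_leI)
  have bound: "\<exists>C\<ge>0. \<forall>u\<in>borel_measurable (lebesgue_on \<Omega>). energy s p u \<le> ennreal B \<longrightarrow> energy t q u \<le> ennreal C"
    if B: "0 \<le> B" for B
  proof -
    obtain C where C: "C \<ge> 0" "\<And>u. u \<in> borel_measurable (lebesgue_on \<Omega>) \<Longrightarrow> mass p u \<le> ennreal (B + B / c) \<Longrightarrow>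
        gagliardo s p u \<le> ennreal (B + B / c) \<Longrightarrow> mass q u \<le> ennreal C \<and> gagliardo t q u \<le> ennreal C"
      using subcritical_bound[OF H', of "B + B / c"] by blast
    have "energy t q u \<le> ennreal (c' * C + C)" if u: "u \<in> borel_measurable (lebesgue_on \<Omega>)" "energy s p u \<le> ennreal B" for u
    proof -
      have "energy t q u \<le> ennreal c' * ennreal C + ennreal C"
        using C(2)[OF u(1) dom[OF u(2) B]]
        by (intro order_trans[OF le_energy] add_mono mult_left_mono) auto
      also have "\<dots> = ennreal (c' * C + C)"
        using C(1) by (simp add: c'_def ennreal_mult ennreal_plus)
      finally show ?thesis .
    qed
    then show ?thesis using C(1) by (intro exI[of _ "c' * C + C"]) (auto simp: c'_def)
  qed
  note XY = sobolev_space_eq[OF st(1) s1 H(2)] sobolev_space_eq[OF H(4) st(2) q]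
  have sub: "sobolev_space s p \<Omega> \<subseteq> sobolev_space t q \<Omega>"
  proof
    fix u assume "u \<in> sobolev_space s p \<Omega>"
    then have u: "u \<in> borel_measurable (lebesgue_on \<Omega>)" "energy s p u < \<infinity>" by (auto simp: XY)
    then obtain B where B: "energy s p u = ennreal B" "0 \<le> B" by (cases "energy s p u") auto
    obtain C where "energy t q u \<le> ennreal C" using bound[OF B(2)] u B(1) by auto
    then have "energy t q u < \<infinity>" using le_less_trans by fastforce
    then show "u \<in> sobolev_space t q \<Omega>" using u by (simp add: XY)
  qed
  have cont: "\<exists>C::real. \<forall>u\<in>sobolev_space s p \<Omega>. sobolev_norm t q \<Omega> u \<le> ennreal C * sobolev_norm s p \<Omega> u"
  proof -
    obtain C where C: "C \<ge> 0" "\<And>u. u \<in> borel_measurable (lebesgue_on \<Omega>) \<Longrightarrow> energy s p u \<le> ennreal 1 \<Longrightarrow> energy t q u \<le> ennreal C"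
      using bound[of 1] by auto
    have "sobolev_norm t q \<Omega> u \<le> ennreal (C powr (1 / q)) * sobolev_norm s p \<Omega> u" if "u \<in> sobolev_space s p \<Omega>" for u
    proof -
      have u: "u \<in> borel_measurable (lebesgue_on \<Omega>)" "energy s p u < \<infinity>" using that by (auto simp: XY)
      obtain e where e: "energy s p u = ennreal e" "0 \<le> e" using u(2) by (cases "energy s p u") auto
      have "energy t q u < \<infinity>" using subsetD[OF sub that] by (simp add: XY)
      then obtain e' where e': "energy t q u = ennreal e'" "0 \<le> e'" by (cases "energy t q u") auto
      have scaled: "l powr q * e' \<le> C" if l: "0 < l" "l powr p * e \<le> 1" for l
      proof -
        have "energy s p (\<lambda>x. l * u x) \<le> ennreal 1"
          using l e by (subst energy_scale[OF u(1) l(1)]) (simp add: ennreal_leI flip: ennreal_mult ennreal_1)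
        then have "energy t q (\<lambda>x. l * u x) \<le> ennreal C" using u(1) by (intro C(2)) auto
        then have "ennreal (l powr q * e') \<le> ennreal C"
          using energy_scale[OF u(1) l(1), of t q] e' by (simp add: ennreal_mult)
        then show ?thesis using C(1) by simp
      qed
      have "e' \<le> C * (e powr (1 / p)) powr q"
      proof (cases "e = 0")
        case False
        \<comment> \<open>This factor normalises the source energy of \<open>u\<close> to 1.\<close>
        define l where "l = e powr (- (1 / p))"
        have e0: "0 < e" using False e by simp
        have "l powr p = e powr (- 1)" using H by (simp add: l_def powr_powr)
        then have l1: "l powr p * e \<le> 1" using e0 by (simp add: powr_minus)
        have "l powr q * (e powr (1 / p)) powr q = e powr (- (1 / p) * q + 1 / p * q)"
          unfolding powr_add by (simp add: l_def powr_powr)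
        then have l3: "l powr q * (e powr (1 / p)) powr q = 1" using e0 by simp
        have l0: "0 < l" using e0 by (simp add: l_def)
        note l = l0 l1 l3
        have "e' = (l powr q * e') * (e powr (1 / p)) powr q" using l(3) by (simp add: mult_ac)
        also have "\<dots> \<le> C * (e powr (1 / p)) powr q"
          using scaled[OF l(1,2)] by (intro mult_right_mono) auto
        finally show ?thesis .
      next
        case True
        \<comment> \<open>With zero source energy every positive multiple of \<open>u\<close> obeys
          the bound \<open>C\<close>, so a positive target energy could be scaled beyond it;
          \<open>l\<close> is chosen to reach \<open>C + 1\<close>.\<close>
        have "e' \<le> 0"
        proof (rule ccontr)
          assume "\<not> e' \<le> 0"
          then have "e' > 0" by simp
          define l where "l = ((C + 1) / e') powr (1 / q)"
          have "0 < l" using C(1) \<open>e' > 0\<close> by (simp add: l_def)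
          moreover have "l powr q * e' = C + 1" using C(1) \<open>e' > 0\<close> q0 by (simp add: l_def powr_powr)
          ultimately show False using scaled[of l] True by simp
        qed
        then show ?thesis using True by simp
      qed
      then have "e' powr (1 / q) \<le> (C * (e powr (1 / p)) powr q) powr (1 / q)"
        using e' q0 by (intro powr_mono2) auto
      also have "\<dots> = C powr (1 / q) * e powr (1 / p)"
        using C(1) q0 by (simp add: powr_mult powr_powr)
      finally have "ennreal (e' powr (1 / q)) \<le> ennreal (C powr (1 / q)) * ennreal (e powr (1 / p))"
        by (simp add: ennreal_leI flip: ennreal_mult)
      then show ?thesis
        using e e' by (simp add: sobolev_norm_eq[OF st(1) s1 H(2) u(1)] sobolev_norm_eq[OF H(4) st(2) q u(1)] ennreal_powr_ennreal)
    qed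
    then show ?thesis by blast
  qed
  have cpt: "\<exists>v\<in>sobolev_space t q \<Omega>. \<exists>r :: nat \<Rightarrow> nat. strict_mono r \<and>
        (\<lambda>n. sobolev_norm t q \<Omega> (\<lambda>x. u (r n) x - v x)) \<longlonglongrightarrow> 0"
    if uX: "\<And>n. u n \<in> sobolev_space s p \<Omega>" and uB: "\<And>n. sobolev_norm s p \<Omega> (u n) \<le> ennreal B"
    for u :: "nat \<Rightarrow> 'a \<Rightarrow> real" and B :: real
  proof -
    have um: "u n \<in> borel_measurable (lebesgue_on \<Omega>)" for n using uX by (simp add: XY)
    define B' where "B' = max B 0 powr p"
    have B': "0 \<le> B'" by (simp add: B'_def)
    have "energy s p (u n) \<le> ennreal B'" for n
    proof -
      have "ennreal_powr (energy s p (u n)) (1 / p) \<le> ennreal (max B 0)"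
        using uB[of n] by (simp add: sobolev_norm_eq[OF st(1) s1 H(2) um] order_trans[OF _ ennreal_leI])
      then have "ennreal_powr (ennreal_powr (energy s p (u n)) (1 / p)) p \<le> ennreal_powr (ennreal (max B 0)) p"
        using H by (intro ennreal_powr_mono) auto
      then show ?thesis using H by (simp add: ennreal_powr_inverse ennreal_powr_ennreal B'_def)
    qed
    from dom[OF this B'] have ub: "mass p (u n) \<le> ennreal (B' + B' / c)" "gagliardo s p (u n) \<le> ennreal (B' + B' / c)" for n
      by auto
    have B'': "0 \<le> B' + B' / c" using B' c by simp
    from subcritical_compactness[where u = u, OF H' B'' um ub]
    obtain v r where v: "v \<in> borel_measurable (lebesgue_on \<Omega>)" and r: "strict_mono r"
      and vb: "mass p v \<le> ennreal (B' + B' / c)" "gagliardo s p v \<le> ennreal (B' + B' / c)"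
      and lim: "(\<lambda>n. mass q (\<lambda>x. u (r n) x - v x)) \<longlonglongrightarrow> 0"
        "(\<lambda>n. gagliardo t q (\<lambda>x. u (r n) x - v x)) \<longlonglongrightarrow> 0"
      by (elim bexE exE conjE) (rule that)
    have "v \<in> sobolev_space s p \<Omega>"
    proof -
      have "mass p v < \<infinity>" "gagliardo s p v < \<infinity>" using vb le_less_trans by fastforce+
      then show ?thesis using v by (auto simp: XY energy_def ennreal_mult_less_top less_top)
    qed
    then have vY: "v \<in> sobolev_space t q \<Omega>" using sub by blast
    have "(\<lambda>n. energy t q (\<lambda>x. u (r n) x - v x)) \<longlonglongrightarrow> 0"
    proof (rule tendsto_sandwich[OF _ _ tendsto_const])
      have "(\<lambda>n. ennreal c' * gagliardo t q (\<lambda>x. u (r n) x - v x) + mass q (\<lambda>x. u (r n) x - v x)) \<longlonglongrightarrow> ennreal c' * 0 + 0"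
        by (intro tendsto_add ennreal_tendsto_cmult lim) simp
      then show "(\<lambda>n. ennreal c' * gagliardo t q (\<lambda>x. u (r n) x - v x) + mass q (\<lambda>x. u (r n) x - v x)) \<longlonglongrightarrow> 0" by simp
    qed (auto intro!: always_eventually le_energy)
    then have "(\<lambda>n. ennreal_powr (energy t q (\<lambda>x. u (r n) x - v x)) (1 / q)) \<longlonglongrightarrow> 0"
      using q0 by (intro ennreal_powr_tendsto_0) auto
    then have "(\<lambda>n. sobolev_norm t q \<Omega> (\<lambda>x. u (r n) x - v x)) \<longlonglongrightarrow> 0"
      using um v by (subst sobolev_norm_eq[OF H(4) st(2) q]) auto
    with vY r show ?thesis by blast
  qed
  show ?thesis unfolding compactly_embedded_def using sub cont cpt by blast
qed

end

section \<open>The embedding for order 1\<close>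

text \<open>A weak gradient is by definition only locally integrable. An exhaustion by compact sets
  makes its extension by 0 a pointwise limit of measurable functions.\<close>

lemma locally_integrable_imp_measurable:
  fixes g :: "'a::euclidean_space \<Rightarrow> 'b::{banach, second_countable_topology}"
  assumes "open \<Omega>" "locally_integrable \<Omega> g"
  shows "(\<lambda>x. indicator \<Omega> x *\<^sub>R g x) \<in> borel_measurable lebesgue"
proof -
  obtain C where C: "\<And>n. compact (C n)" "\<And>n. C n \<subseteq> \<Omega>" "\<And>n. C n \<subseteq> interior (C (Suc n))" "\<Union>(range C) = \<Omega>"
    using open_Union_compact_subsets[OF assms(1)] by metis
  show ?thesis
  proof (rule borel_measurable_LIMSEQ_metric)
    fix n
    have "C n \<inter> space lebesgue \<in> sets lebesgue"
      using C(1)[of n] by (simp add: borel_compact sets_completionI_sets)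
    moreover have "g \<in> borel_measurable (lebesgue_on (C n))"
      using assms(2) C unfolding locally_integrable_def by (meson borel_measurable_integrable)
    ultimately show "(\<lambda>x. indicator (C n) x *\<^sub>R g x) \<in> borel_measurable lebesgue"
      by (simp only: borel_measurable_restrict_space_iff)
  next
    fix x
    have mono: "C m \<subseteq> C n" if "m \<le> n" for m n
    proof (rule lift_Suc_mono_le[OF _ that])
      show "C n \<subseteq> C (Suc n)" for n using C(3)[of n] interior_subset by blast
    qed
    have "eventually (\<lambda>n. indicator (C n) x *\<^sub>R g x = indicator \<Omega> x *\<^sub>R g x) sequentially"
    proof (cases "x \<in> \<Omega>")
      case True
      then obtain m where xm: "x \<in> C m" using C(4) by blast
      show ?thesis
      proof (rule eventually_sequentiallyI[of m])
        fix n assume "m \<le> n"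
        then have "x \<in> C n" using mono xm by blast
        then show "indicator (C n) x *\<^sub>R g x = indicator \<Omega> x *\<^sub>R g x" using True by simp
      qed
    next
      case False
      then show ?thesis using C(2) by (intro always_eventually) (auto simp: indicator_def subset_iff)
    qed
    then show "(\<lambda>n. indicator (C n) x *\<^sub>R g x) \<longlonglongrightarrow> indicator \<Omega> x *\<^sub>R g x"
      by (rule tendsto_eventually)
  qed
qed

lemma lebesgue_ex_borel_representative:
  fixes g :: "'a::euclidean_space \<Rightarrow> 'b::euclidean_space"
  assumes "g \<in> borel_measurable lebesgue"
  shows "\<exists>g'\<in>borel_measurable borel. AE x in lborel. g x = g' x"
proof -
  have "\<exists>h\<in>borel_measurable lborel. AE x in lborel. g x \<bullet> i = h x" for i
    using assms by (intro completion_ex_borel_measurable_real) simp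
  then obtain h where h: "\<And>i. h i \<in> borel_measurable lborel" "\<And>i. AE x in lborel. g x \<bullet> i = h i x"
    by metis
  have m[measurable]: "h i \<in> borel_measurable borel" for i using h(1)[of i] by simp
  have "AE x in lborel. \<forall>i\<in>Basis. g x \<bullet> i = h i x"
    using h(2) by (simp add: AE_finite_all)
  then have "AE x in lborel. g x = (\<Sum>i\<in>Basis. h i x *\<^sub>R i)"
    by eventually_elim (metis (no_types, lifting) euclidean_representation sum.cong)
  then show ?thesis by (intro bexI[of _ "\<lambda>x. \<Sum>i\<in>Basis. h i x *\<^sub>R i"]) measurable
qed

lemma (in finite_measure) integrable_if_powr_integral_finite:
  fixes f :: "'a \<Rightarrow> 'b::{banach, second_countable_topology}"
  assumes [measurable]: "f \<in> borel_measurable M" and "1 \<le> p" and fin: "(\<integral>\<^sup>+x. ennreal (norm (f x) powr p) \<partial>M) < \<infinity>"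
  shows "integrable M f"
proof (rule integrableI_bounded)
  have "(\<integral>\<^sup>+x. ennreal (norm (f x)) \<partial>M) \<le> (\<integral>\<^sup>+x. ennreal (norm (f x) powr p) + 1 \<partial>M)"
  proof (rule nn_integral_mono)
    fix x
    have "norm (f x) \<le> norm (f x) powr p + 1"
    proof (cases "norm (f x) \<le> 1")
      case True
      then show ?thesis using powr_ge_zero[of "norm (f x)" p] by linarith
    next
      case False
      then have "norm (f x) powr 1 \<le> norm (f x) powr p" using assms(2) by (intro powr_mono) auto
      then show ?thesis using False by simp
    qed
    from ennreal_leI[OF this] show "ennreal (norm (f x)) \<le> ennreal (norm (f x) powr p) + 1"
      by (simp add: ennreal_plus)
  qed
  also have "\<dots> = (\<integral>\<^sup>+x. ennreal (norm (f x) powr p) \<partial>M) + emeasure M (space M)"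
    by (subst nn_integral_add) auto
  also have "\<dots> < \<infinity>" using fin by (simp add: less_top emeasure_eq_measure)
  finally show "(\<integral>\<^sup>+x. ennreal (norm (f x)) \<partial>M) < \<infinity>" .
qed measurable

lemma borel_representative_on:
  fixes f :: "'a::euclidean_space \<Rightarrow> 'b::euclidean_space"
  assumes \<Omega>: "open \<Omega>" "bounded \<Omega>" and p: "1 \<le> p"
    and m: "(\<lambda>x. indicator \<Omega> x *\<^sub>R f x) \<in> borel_measurable lebesgue"
    and fin: "(\<integral>\<^sup>+x. ennreal (norm (f x) powr p) \<partial>lebesgue_on \<Omega>) < \<infinity>"
  obtains f' where "integrable lborel f'" "AE x in lborel. indicator \<Omega> x *\<^sub>R f x = f' x"
proof -
  have s: "\<Omega> \<inter> space lebesgue \<in> sets lebesgue" using \<Omega> by (simp add: borel_open sets_completionI_sets)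
  interpret finite_measure "lebesgue_on \<Omega>"
    using lmeasurable_open[OF \<Omega>(2,1)] by (rule finite_measure_lebesgue_on)
  have "f \<in> borel_measurable (lebesgue_on \<Omega>)" using m by (simp only: borel_measurable_restrict_space_iff[OF s])
  then have "integrable (lebesgue_on \<Omega>) f" using p fin by (rule integrable_if_powr_integral_finite)
  then have i: "integrable lebesgue (\<lambda>x. indicator \<Omega> x *\<^sub>R f x)" by (simp only: integrable_restrict_space[OF s])
  obtain f' where f': "f' \<in> borel_measurable borel" "AE x in lborel. indicator \<Omega> x *\<^sub>R f x = f' x"
    using lebesgue_ex_borel_representative[OF m] by blast
  have "integrable lebesgue f'"
    using i by (rule integrable_cong_AE_imp) (use f' in \<open>auto intro: AE_completion measurable_completion\<close>)
  then have "integrable lborel f'" using f'(1) by (simp add: integrable_completion)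
  then show thesis using f'(2) by (rule that)
qed

text \<open>The line-integral argument uses products and translations over \<open>lborel\<close>,
  hence Borel functions on the whole space. On \<Omega> the functions change only on a null set,
  which integrals against bumps do not see.\<close>

lemma has_weak_gradient_borel_representatives:
  fixes u :: "'a::euclidean_space \<Rightarrow> real"
  assumes \<Omega>: "open \<Omega>" "bounded \<Omega>" and p: "1 \<le> p" and wg: "has_weak_gradient \<Omega> u g"
    and fin: "(\<integral>\<^sup>+x. ennreal (\<bar>u x\<bar> powr p) \<partial>lebesgue_on \<Omega>) < \<infinity>"
      "(\<integral>\<^sup>+x. ennreal (norm (g x) powr p) \<partial>lebesgue_on \<Omega>) < \<infinity>"
  obtains u' g' where "weak_gradient_on \<Omega> u' g'" "AE x in lborel. x \<in> \<Omega> \<longrightarrow> u' x = u x"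
    "(\<integral>\<^sup>+x. ennreal (norm (g' x) powr p) \<partial>lborel) = (\<integral>\<^sup>+x. ennreal (norm (g x) powr p) \<partial>lebesgue_on \<Omega>)"
proof -
  have s: "\<Omega> \<inter> space lebesgue \<in> sets lebesgue" using \<Omega> by (simp add: borel_open sets_completionI_sets)
  have mu: "(\<lambda>x. indicator \<Omega> x *\<^sub>R u x) \<in> borel_measurable lebesgue"
    and mg: "(\<lambda>x. indicator \<Omega> x *\<^sub>R g x) \<in> borel_measurable lebesgue"
    using wg \<Omega>(1) by (auto simp: has_weak_gradient_def intro!: locally_integrable_imp_measurable simp del: scaleR_conv_of_real real_scaleR_def)
  obtain u' where u': "integrable lborel u'" "AE x in lborel. indicator \<Omega> x *\<^sub>R u x = u' x"
    using borel_representative_on[OF \<Omega> p mu] fin(1) by auto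
  obtain g' where g': "integrable lborel g'" "AE x in lborel. indicator \<Omega> x *\<^sub>R g x = g' x"
    using borel_representative_on[OF \<Omega> p mg fin(2)] by blast
  have [measurable]: "u' \<in> borel_measurable borel" "g' \<in> borel_measurable borel"
    using borel_measurable_integrable[OF u'(1)] borel_measurable_integrable[OF g'(1)] by simp_all
  have transfer: "(\<integral>x. F x \<partial>lebesgue_on \<Omega>) = (\<integral>x. F' x \<partial>lborel)"
    if F: "(\<lambda>x. indicator \<Omega> x *\<^sub>R F x) \<in> borel_measurable lebesgue" "F' \<in> borel_measurable borel"
      "AE x in lborel. indicator \<Omega> x *\<^sub>R F x = F' x" for F F' :: "'a \<Rightarrow> real"
  proof -
    have "(\<integral>x. F x \<partial>lebesgue_on \<Omega>) = (\<integral>x. indicator \<Omega> x *\<^sub>R F x \<partial>lebesgue)"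
      by (rule integral_restrict_space[OF s])
    also have "\<dots> = (\<integral>x. F' x \<partial>lebesgue)"
      using F by (intro integral_cong_AE) (auto intro: AE_completion measurable_completion)
    also have "\<dots> = (\<integral>x. F' x \<partial>lborel)" using F(2) by (intro integral_completion) simp
    finally show ?thesis .
  qed
  have "weak_gradient_on \<Omega> u' g'"
    unfolding weak_gradient_on_def
  proof (intro conjI allI ballI impI u' g')
    fix a b :: 'a and n :: nat and i :: 'a
    assume i: "i \<in> Basis" and ab: "cbox a b \<subseteq> \<Omega>"
    define D where "D x = frechet_derivative (box_bump n a b) (at x) i" for x
    have Dm[measurable]: "D \<in> borel_measurable borel"
      unfolding D_def by (intro borel_measurable_continuous_onI box_bump_derivative_continuous)
    have DL: "D \<in> borel_measurable lebesgue" "box_bump n a b \<in> borel_measurable lebesgue"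
      by (intro measurable_completion; simp)+
    have "(\<integral>x. u x * D x \<partial>lebesgue_on \<Omega>) = - (\<integral>x. (g x \<bullet> i) * box_bump n a b x \<partial>lebesgue_on \<Omega>)"
      using wg box_bump_test_function[OF ab, of n] i unfolding has_weak_gradient_def D_def by blast
    moreover have "(\<integral>x. u x * D x \<partial>lebesgue_on \<Omega>) = (\<integral>x. u' x * D x \<partial>lborel)"
    proof (rule transfer)
      have "(\<lambda>x. (indicator \<Omega> x *\<^sub>R u x) * D x) \<in> borel_measurable lebesgue"
        using mu DL(1) by (rule borel_measurable_times)
      then show "(\<lambda>x. indicator \<Omega> x *\<^sub>R (u x * D x)) \<in> borel_measurable lebesgue" by (simp add: mult.assoc)
      show "AE x in lborel. indicator \<Omega> x *\<^sub>R (u x * D x) = u' x * D x"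
        using u'(2) by eventually_elim (metis mult_scaleR_left)
    qed measurable
    moreover have "(\<integral>x. (g x \<bullet> i) * box_bump n a b x \<partial>lebesgue_on \<Omega>) = (\<integral>x. (g' x \<bullet> i) * box_bump n a b x \<partial>lborel)"
    proof (rule transfer)
      have "(\<lambda>x. ((indicator \<Omega> x *\<^sub>R g x) \<bullet> i) * box_bump n a b x) \<in> borel_measurable lebesgue"
        using mg DL(2) by (intro borel_measurable_times borel_measurable_inner) auto
      then show "(\<lambda>x. indicator \<Omega> x *\<^sub>R ((g x \<bullet> i) * box_bump n a b x)) \<in> borel_measurable lebesgue"
        by (simp add: mult.assoc)
      show "AE x in lborel. indicator \<Omega> x *\<^sub>R ((g x \<bullet> i) * box_bump n a b x) = (g' x \<bullet> i) * box_bump n a b x"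
        using g'(2) by eventually_elim (metis inner_scaleR_left mult_scaleR_left real_scaleR_def)
    qed measurable
    ultimately show "(\<integral>x. u' x * frechet_derivative (box_bump n a b) (at x) i \<partial>lborel) =
      - (\<integral>x. (g' x \<bullet> i) * box_bump n a b x \<partial>lborel)" by (simp add: D_def)
  qed
  moreover have "AE x in lborel. x \<in> \<Omega> \<longrightarrow> u' x = u x"
    using u'(2) by eventually_elim auto
  moreover have "(\<integral>\<^sup>+x. ennreal (norm (g' x) powr p) \<partial>lborel) = (\<integral>\<^sup>+x. ennreal (norm (g x) powr p) \<partial>lebesgue_on \<Omega>)"
    unfolding nn_integral_lebesgue_on[OF \<Omega>(1)]
  proof (rule nn_integral_cong_AE)
    show "AE x in lborel. ennreal (norm (g' x) powr p) = ennreal (norm (g x) powr p) * indicator \<Omega> x"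
      using g'(2) by eventually_elim (auto simp: indicator_def split: if_splits)
  qed
  ultimately show thesis by (rule that)
qed

context regular_domain
begin

text \<open>Makes \<open>gradient_bounds_gagliardo\<close> usable for the spaces: u and its chosen
  weak gradient are replaced by Borel representatives, which changes neither the masses nor the
  double integral.\<close>

lemma energy_le_gradient:
  assumes \<Omega>: "open \<Omega>" "bounded \<Omega>" and cone: "uniform_cone \<Omega> \<rho> \<epsilon> F"
    and p: "1 \<le> p" and \<tau>: "0 < \<tau>" "\<tau> < 1"
  shows "\<exists>K>0. \<forall>u\<in>sobolev_space 1 p \<Omega>. u \<in> borel_measurable (lebesgue_on \<Omega>) \<and>
    sobolev_norm 1 p \<Omega> u < \<infinity> \<and> energy \<tau> p u \<le> ennreal K * ennreal_powr (sobolev_norm 1 p \<Omega> u) p"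
proof -
  obtain K where K: "\<And>u g. weak_gradient_on \<Omega> u g \<Longrightarrow>
    (\<integral>\<^sup>+x. (\<integral>\<^sup>+y. ennreal (\<bar>u x - u y\<bar> powr p / norm (x - y) powr (real DIM('a) + \<tau> * p)) *
       (indicator \<Omega> x * indicator \<Omega> y) \<partial>lborel) \<partial>lborel)
    \<le> ennreal K * ((\<integral>\<^sup>+x. ennreal (norm (g x) powr p) \<partial>lborel) +
         (\<integral>\<^sup>+x. ennreal (\<bar>u x\<bar> powr p) * indicator \<Omega> x \<partial>lborel))"
    using gradient_bounds_gagliardo[OF \<Omega> cone p \<tau>] by blast
  define c where "c = sobolev_const DIM('a) \<tau> p"
  have c: "0 < c" unfolding c_def using \<tau> p by (intro sobolev_const_pos) (auto simp: Suc_leI)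
  \<comment> \<open>\<open>c * \<bar>K\<bar>\<close> is for the seminorm term, and 1 for
    \<open>mass p u\<close>, which is at most \<open>G + mass p u\<close>.\<close>
  define K' where "K' = c * \<bar>K\<bar> + 1"
  have "u \<in> borel_measurable (lebesgue_on \<Omega>) \<and>
    sobolev_norm 1 p \<Omega> u < \<infinity> \<and> energy \<tau> p u \<le> ennreal K' * ennreal_powr (sobolev_norm 1 p \<Omega> u) p"
    if u: "u \<in> sobolev_space 1 p \<Omega>" for u
  proof -
    have um: "u \<in> borel_measurable (lebesgue_on \<Omega>)" and Lp: "Lp_norm p \<Omega> u < \<infinity>"
      and semi: "sobolev_seminorm 1 p \<Omega> u < \<infinity>"
      using u by (auto simp: sobolev_space_def Lp_space_def)
    have ex: "\<exists>g. has_weak_gradient \<Omega> u g" using semi by (auto simp: sobolev_seminorm_def split: if_splits)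
    define g where "g = weak_gradient \<Omega> u"
    have wg: "has_weak_gradient \<Omega> u g" unfolding g_def weak_gradient_def using ex by (rule someI_ex)
    define G where "G = (\<integral>\<^sup>+x. ennreal (norm (g x) powr p) \<partial>lebesgue_on \<Omega>)"
    have semi_eq: "sobolev_seminorm 1 p \<Omega> u = ennreal_powr G (1 / p)"
      using ex by (simp add: sobolev_seminorm_def Lp_norm_def G_def g_def)
    have fin: "mass p u < \<infinity>" "G < \<infinity>"
      using Lp semi unfolding Lp_norm_eq semi_eq by (simp_all only: ennreal_powr_less_top_iff)
    have norm: "sobolev_norm 1 p \<Omega> u = ennreal_powr (G + mass p u) (1 / p)"
      using p by (simp add: sobolev_norm_def semi_eq Lp_norm_eq ennreal_powr_inverse)
    have pow: "ennreal_powr (sobolev_norm 1 p \<Omega> u) p = G + mass p u"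
      unfolding norm using p by (intro ennreal_powr_inverse) auto
    obtain u' g' where w: "weak_gradient_on \<Omega> u' g'" and AE: "AE x in lborel. x \<in> \<Omega> \<longrightarrow> u' x = u x"
      and G': "(\<integral>\<^sup>+x. ennreal (norm (g' x) powr p) \<partial>lborel) = G"
      using has_weak_gradient_borel_representatives[OF \<Omega> p wg] fin unfolding mass_def G_def by blast
    have M': "(\<integral>\<^sup>+x. ennreal (\<bar>u' x\<bar> powr p) * indicator \<Omega> x \<partial>lborel) = mass p u"
      unfolding mass_def nn_integral_lebesgue_on[OF \<Omega>(1)]
    proof (rule nn_integral_cong_AE)
      show "AE x in lborel. ennreal (\<bar>u' x\<bar> powr p) * indicator \<Omega> x = ennreal (\<bar>u x\<bar> powr p) * indicator \<Omega> x"
        using AE by eventually_elim (auto simp: indicator_def)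
    qed
    have "gagliardo \<tau> p u = (\<integral>\<^sup>+x. (\<integral>\<^sup>+y. ennreal (\<bar>u' x - u' y\<bar> powr p / norm (x - y) powr (real DIM('a) + \<tau> * p)) *
       (indicator \<Omega> x * indicator \<Omega> y) \<partial>lborel) \<partial>lborel)"
      unfolding gagliardo_def nn_integral_lebesgue_on[OF \<Omega>(1)]
    proof (rule nn_integral_cong_AE)
      show "AE x in lborel. (\<integral>\<^sup>+y. ennreal (\<bar>u x - u y\<bar> powr p / norm (x - y) powr (real DIM('a) + \<tau> * p)) * indicator \<Omega> y \<partial>lborel) * indicator \<Omega> x =
        (\<integral>\<^sup>+y. ennreal (\<bar>u' x - u' y\<bar> powr p / norm (x - y) powr (real DIM('a) + \<tau> * p)) * (indicator \<Omega> x * indicator \<Omega> y) \<partial>lborel)"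
        using AE
      proof eventually_elim
        fix x assume x: "x \<in> \<Omega> \<longrightarrow> u' x = u x"
        show "(\<integral>\<^sup>+y. ennreal (\<bar>u x - u y\<bar> powr p / norm (x - y) powr (real DIM('a) + \<tau> * p)) * indicator \<Omega> y \<partial>lborel) * indicator \<Omega> x =
          (\<integral>\<^sup>+y. ennreal (\<bar>u' x - u' y\<bar> powr p / norm (x - y) powr (real DIM('a) + \<tau> * p)) * (indicator \<Omega> x * indicator \<Omega> y) \<partial>lborel)"
        proof (cases "x \<in> \<Omega>")
          case True
          have "(\<integral>\<^sup>+y. ennreal (\<bar>u x - u y\<bar> powr p / norm (x - y) powr (real DIM('a) + \<tau> * p)) * indicator \<Omega> y \<partial>lborel) =
            (\<integral>\<^sup>+y. ennreal (\<bar>u' x - u' y\<bar> powr p / norm (x - y) powr (real DIM('a) + \<tau> * p)) * indicator \<Omega> y \<partial>lborel)"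
          proof (rule nn_integral_cong_AE)
            show "AE y in lborel. ennreal (\<bar>u x - u y\<bar> powr p / norm (x - y) powr (real DIM('a) + \<tau> * p)) * indicator \<Omega> y =
              ennreal (\<bar>u' x - u' y\<bar> powr p / norm (x - y) powr (real DIM('a) + \<tau> * p)) * indicator \<Omega> y"
              using AE by eventually_elim (use x True in \<open>auto simp: indicator_def\<close>)
          qed
          then show ?thesis using True by simp
        qed simp
      qed
    qed
    also have "\<dots> \<le> ennreal K * (G + mass p u)" using K[OF w] unfolding G' M' .
    also have "\<dots> \<le> ennreal \<bar>K\<bar> * (G + mass p u)" by (intro mult_right_mono ennreal_leI) auto
    finally have "ennreal c * gagliardo \<tau> p u + mass p u \<le> ennreal c * (ennreal \<bar>K\<bar> * (G + mass p u)) + 1 * (G + mass p u)"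
      by (intro add_mono mult_left_mono) (auto simp: add_increasing)
    also have "\<dots> = ennreal K' * (G + mass p u)"
      using c by (simp add: K'_def ennreal_plus ennreal_mult distrib_right mult.assoc)
    finally have "energy \<tau> p u \<le> ennreal K' * (G + mass p u)" using \<tau> by (simp add: energy_def c_def)
    moreover have "sobolev_norm 1 p \<Omega> u < \<infinity>"
      unfolding norm using fin by (simp only: ennreal_powr_less_top_iff) (simp add: less_top)
    ultimately show ?thesis using um unfolding pow by blast
  qed
  moreover have "K' > 0" using c by (simp add: K'_def add_nonneg_pos)
  ultimately show ?thesis by blast
qed

text \<open>Composition of a bounded embedding, from order 1 to order \<tau> at the same p, with a
  compact one from \<tau> to the target.\<close>

lemma compactly_embedded_subcritical_1:
  assumes \<Omega>: "open \<Omega>" "bounded \<Omega>" and cone: "uniform_cone \<Omega> \<rho> \<epsilon> F"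
    and p: "1 \<le> p" "p < real DIM('a)" and t: "0 \<le> t" "t < 1" and q: "1 \<le> q"
    and sub: "real DIM('a) / p - 1 < real DIM('a) / q - t"
  shows "compactly_embedded (sobolev_space 1 p \<Omega>) (sobolev_norm 1 p \<Omega>) (sobolev_space t q \<Omega>) (sobolev_norm t q \<Omega>)"
proof -
  \<comment> \<open>The two lower limits for \<open>\<tau>\<close>: above \<open>t\<close> the order
    drops, above the other the pair remains strictly subcritical. Assumption \<open>sub\<close> puts
    the second below 1.\<close>
  have "max t (real DIM('a) / p - real DIM('a) / q + t) < 1" using t sub by simp
  then obtain \<tau> where "max t (real DIM('a) / p - real DIM('a) / q + t) < \<tau>" "\<tau> < 1" using dense by blast
  then have \<tau>: "t < \<tau>" "0 < \<tau>" "\<tau> < 1" "real DIM('a) / p - \<tau> < real DIM('a) / q - t" using t by auto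
  have "\<tau> * p \<le> 1 * p" using \<tau> p by (intro mult_right_mono) auto
  then have "\<tau> * p < real DIM('a)" using p(2) by linarith
  from compactly_embedded_subcritical[OF \<tau>(2) p(1) this t(1) \<tau>(1,4,3) q]
  have CE: "compactly_embedded (sobolev_space \<tau> p \<Omega>) (sobolev_norm \<tau> p \<Omega>) (sobolev_space t q \<Omega>) (sobolev_norm t q \<Omega>)" .
  obtain K where K: "K > 0" "\<And>u. u \<in> sobolev_space 1 p \<Omega> \<Longrightarrow> u \<in> borel_measurable (lebesgue_on \<Omega>) \<and>
    sobolev_norm 1 p \<Omega> u < \<infinity> \<and> energy \<tau> p u \<le> ennreal K * ennreal_powr (sobolev_norm 1 p \<Omega> u) p"
    using energy_le_gradient[OF \<Omega> cone p(1) \<tau>(2,3)] by blast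
  have \<tau>0: "0 \<le> \<tau>" using \<tau> by simp
  have X: "u \<in> sobolev_space \<tau> p \<Omega>" if "u \<in> sobolev_space 1 p \<Omega>" for u
  proof -
    have "energy \<tau> p u < \<infinity>"
      using K(2)[OF that] by (auto intro!: le_less_trans[of "energy \<tau> p u"] simp: ennreal_mult_less_top ennreal_powr_less_top_iff[simplified])
    then show ?thesis using K(2)[OF that] by (simp add: sobolev_space_eq[OF \<tau>0 \<tau>(3) p(1)])
  qed
  have nX: "sobolev_norm \<tau> p \<Omega> u \<le> ennreal (K powr (1 / p)) * sobolev_norm 1 p \<Omega> u" if "u \<in> sobolev_space 1 p \<Omega>" for u
  proof -
    have "sobolev_norm \<tau> p \<Omega> u = ennreal_powr (energy \<tau> p u) (1 / p)"
      using K(2)[OF that] by (intro sobolev_norm_eq \<tau>0 \<tau> p) auto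
    also have "\<dots> \<le> ennreal_powr (ennreal K * ennreal_powr (sobolev_norm 1 p \<Omega> u) p) (1 / p)"
      using K(2)[OF that] p by (intro ennreal_powr_mono) auto
    also have "\<dots> = ennreal (K powr (1 / p)) * sobolev_norm 1 p \<Omega> u"
      using K(1) p by (simp add: ennreal_powr_mult ennreal_powr_inverse)
    finally show ?thesis .
  qed
  show ?thesis
    unfolding compactly_embedded_def
  proof (intro conjI allI impI)
    show "sobolev_space 1 p \<Omega> \<subseteq> sobolev_space t q \<Omega>" using CE X unfolding compactly_embedded_def by blast
    obtain C where C: "\<And>u. u \<in> sobolev_space \<tau> p \<Omega> \<Longrightarrow> sobolev_norm t q \<Omega> u \<le> ennreal C * sobolev_norm \<tau> p \<Omega> u"
      using CE unfolding compactly_embedded_def by blast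
    have "sobolev_norm t q \<Omega> u \<le> ennreal (\<bar>C\<bar> * K powr (1 / p)) * sobolev_norm 1 p \<Omega> u" if u: "u \<in> sobolev_space 1 p \<Omega>" for u
    proof -
      have "sobolev_norm t q \<Omega> u \<le> ennreal C * sobolev_norm \<tau> p \<Omega> u" by (rule C[OF X[OF u]])
      also have "\<dots> \<le> ennreal \<bar>C\<bar> * (ennreal (K powr (1 / p)) * sobolev_norm 1 p \<Omega> u)"
        by (intro mult_mono nX u ennreal_leI) auto
      finally show ?thesis by (simp add: ennreal_mult mult.assoc)
    qed
    then show "\<exists>C. \<forall>u\<in>sobolev_space 1 p \<Omega>. sobolev_norm t q \<Omega> u \<le> ennreal C * sobolev_norm 1 p \<Omega> u" by blast
  next
    fix u :: "nat \<Rightarrow> 'a \<Rightarrow> real"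
    assume u: "(\<forall>n. u n \<in> sobolev_space 1 p \<Omega>) \<and> (\<exists>B::real. \<forall>n. sobolev_norm 1 p \<Omega> (u n) \<le> ennreal B)"
    then obtain B :: real where B: "\<And>n. sobolev_norm 1 p \<Omega> (u n) \<le> ennreal B" by blast
    have "sobolev_norm \<tau> p \<Omega> (u n) \<le> ennreal (K powr (1 / p) * \<bar>B\<bar>)" for n
    proof -
      have "sobolev_norm \<tau> p \<Omega> (u n) \<le> ennreal (K powr (1 / p)) * sobolev_norm 1 p \<Omega> (u n)" using u by (intro nX) blast
      also have "\<dots> \<le> ennreal (K powr (1 / p)) * ennreal \<bar>B\<bar>"
        by (intro mult_left_mono order_trans[OF B] ennreal_leI) auto
      finally show ?thesis by (simp add: ennreal_mult)
    qed
    then have "\<exists>B::real. \<forall>n. sobolev_norm \<tau> p \<Omega> (u n) \<le> ennreal B" by blast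
    moreover have "\<forall>n. u n \<in> sobolev_space \<tau> p \<Omega>" using u X by blast
    ultimately show "\<exists>v\<in>sobolev_space t q \<Omega>. \<exists>r :: nat \<Rightarrow> nat. strict_mono r \<and>
        (\<lambda>n. sobolev_norm t q \<Omega> (\<lambda>x. u (r n) x - v x)) \<longlonglongrightarrow> 0"
      using CE unfolding compactly_embedded_def by blast
  qed
qed

end

section \<open>The interpolation curve\<close>

text \<open>The denominator \<open>p' + \<theta> * (p - p')\<close> is
  \<open>\<theta> * p + (1 - \<theta>) * p'\<close>; divided by \<open>p * p'\<close> it is the
  convex combination of \<open>1 / p'\<close> and \<open>1 / p\<close>, so the reciprocal exponent
  is affine in \<theta>.\<close>

lemma interpolation_curve_reciprocal:
  assumes "(s\<theta>, p\<theta>) = interpolation_curve s p s' p' \<theta>" "1 \<le> p" "1 \<le> p'" "0 \<le> \<theta>" "\<theta> \<le> 1"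
  shows "s\<theta> = \<theta> * s' + (1 - \<theta>) * s" "1 \<le> p\<theta>" "N / p\<theta> = \<theta> * (N / p') + (1 - \<theta>) * (N / p)"
proof -
  have p\<theta>: "p\<theta> = p * p' / (p' + \<theta> * (p - p'))" and s\<theta>: "s\<theta> = \<theta> * s' + (1 - \<theta>) * s"
    using assms(1) by (auto simp: interpolation_curve_def)
  have D: "p' + \<theta> * (p - p') = \<theta> * p + (1 - \<theta>) * p'" by (simp add: algebra_simps)
  have le: "\<theta> * p + (1 - \<theta>) * p' \<le> \<theta> * (p * p') + (1 - \<theta>) * (p * p')"
    using assms by (intro add_mono mult_left_mono) auto
  have "\<theta> * 1 + (1 - \<theta>) * 1 \<le> \<theta> * p + (1 - \<theta>) * p'"
    using assms by (intro add_mono mult_left_mono) auto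
  then have pos: "0 < \<theta> * p + (1 - \<theta>) * p'" by simp
  show "s\<theta> = \<theta> * s' + (1 - \<theta>) * s" by (rule s\<theta>)
  have "\<theta> * (p * p') + (1 - \<theta>) * (p * p') = p * p'" by (simp add: algebra_simps)
  then show "1 \<le> p\<theta>" using le pos unfolding p\<theta> D by simp
  have "N / p\<theta> = N * (\<theta> * p + (1 - \<theta>) * p') / (p * p')" unfolding p\<theta> D by simp
  also have "\<dots> = \<theta> * (N / p') + (1 - \<theta>) * (N / p)"
    using assms by (simp add: field_simps)
  finally show "N / p\<theta> = \<theta> * (N / p') + (1 - \<theta>) * (N / p)" .
qed

theorem theorem1p3:
  fixes s p s' p' :: real and \<Omega> :: "(real ^ 'n) set"
  assumes "0 < s" and "s \<le> 1" and "1 \<le> p"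
    and "s * p < real CARD('n)" and "s \<noteq> p"
    and "open \<Omega>" and "connected \<Omega>" and "\<Omega> \<noteq> {}" and "bounded \<Omega>"
    and "lipschitz_boundary \<Omega>"
    and "0 \<le> s'" and "s' < s"
    and "s * p / (s * p - (p - 1) * s') \<le> p'"
    and "p' < real CARD('n) * p / (real CARD('n) - (s - s') * p)"
  shows "compactly_embedded (sobolev_space s p \<Omega>) (sobolev_norm s p \<Omega>)
           (sobolev_space s' p' \<Omega>) (sobolev_norm s' p' \<Omega>) \<and>
         (\<forall>\<theta>1 \<theta>2 s1 p1 s2 p2. 0 < \<theta>1 \<and> \<theta>1 < \<theta>2 \<and> \<theta>2 \<le> 1 \<and>
            (s1, p1) = interpolation_curve s p s' p' \<theta>1 \<and>
            (s2, p2) = interpolation_curve s p s' p' \<theta>2 \<longrightarrow>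
            compactly_embedded (sobolev_space s1 p1 \<Omega>) (sobolev_norm s1 p1 \<Omega>)
              (sobolev_space s2 p2 \<Omega>) (sobolev_norm s2 p2 \<Omega>))"
proof -
  define N where "N = real DIM(real ^ 'n)"
  have N: "N = real CARD('n)" "0 < N" by (auto simp: N_def)
  obtain \<rho> \<epsilon> F where cone: "uniform_cone \<Omega> \<rho> \<epsilon> F"
    using lipschitz_boundary_imp_uniform_cone[OF assms(6,9,10)] by blast
  obtain \<kappa> where "regular_measure (lebesgue_on \<Omega>) \<kappa>"
    using regular_measure_lebesgue_on[OF assms(6,9) cone] by blast
  then interpret regular_domain \<Omega> \<kappa> unfolding regular_domain_def .
  \<comment> \<open>The lower bound on \<open>p'\<close> is at least 1, because its denominator lies
    between \<open>s\<close> and \<open>s * p\<close>.\<close>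
  have p': "1 \<le> p'"
  proof -
    have le: "(p - 1) * s' \<le> (p - 1) * s" using assms by (intro mult_left_mono) auto
    then have pos: "0 < s * p - (p - 1) * s'" using assms(1) by (simp add: algebra_simps)
    have "0 \<le> (p - 1) * s'" using assms by (intro mult_nonneg_nonneg) auto
    then have "1 \<le> s * p / (s * p - (p - 1) * s')" using pos by simp
    then show ?thesis using assms(13) by linarith
  qed
  \<comment> \<open>The upper bound on \<open>p'\<close> is strict subcriticality: clear the
    denominator and divide by \<open>p * p'\<close>.\<close>
  have key: "N / p - s < N / p' - s'"
  proof -
    have "(s - s') * p \<le> s * p" using assms by (intro mult_right_mono) auto
    then have "0 < N - (s - s') * p" using assms(4) N by simp
    then have "p' * (N - (s - s') * p) < N * p" using assms(14) N by (simp add: pos_less_divide_eq)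
    then have "p' * (N - (s - s') * p) / (p * p') < N * p / (p * p')"
      using assms(3) p' by (intro divide_strict_right_mono) auto
    moreover have "p' * (N - (s - s') * p) / (p * p') = N / p - s + s'" "N * p / (p * p') = N / p'"
      using assms(3) p' by (auto simp: field_simps)
    ultimately show ?thesis by simp
  qed
  \<comment> \<open>Together with \<open>key\<close> this makes order and exponent subcritical at
    both ends of the curve, hence by affinity all along it.\<close>
  have pos: "0 < N / p - s" using assms N by (simp add: pos_less_divide_eq)
  have "compactly_embedded (sobolev_space s p \<Omega>) (sobolev_norm s p \<Omega>)
           (sobolev_space s' p' \<Omega>) (sobolev_norm s' p' \<Omega>)"
  proof (cases "s = 1")
    case True
    then show ?thesis
      using compactly_embedded_subcritical_1[OF assms(6,9) cone assms(3) _ assms(11) _ p'] assms(4,12) key N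
      unfolding N_def by simp
  next
    case False
    then show ?thesis
      using compactly_embedded_subcritical[OF assms(1,3) _ assms(11,12) _ _ p'] assms(2,4) key N
      unfolding N_def by simp
  qed
  moreover have "compactly_embedded (sobolev_space s1 p1 \<Omega>) (sobolev_norm s1 p1 \<Omega>)
              (sobolev_space s2 p2 \<Omega>) (sobolev_norm s2 p2 \<Omega>)"
    if \<theta>: "0 < \<theta>1" "\<theta>1 < \<theta>2" "\<theta>2 \<le> 1"
      and c: "(s1, p1) = interpolation_curve s p s' p' \<theta>1" "(s2, p2) = interpolation_curve s p s' p' \<theta>2"
    for \<theta>1 \<theta>2 s1 p1 s2 p2
  proof -
    note 1 = interpolation_curve_reciprocal[OF c(1) assms(3) p']
    note 2 = interpolation_curve_reciprocal[OF c(2) assms(3) p']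
    have s1: "s1 = \<theta>1 * s' + (1 - \<theta>1) * s" "1 \<le> p1" "N / p1 = \<theta>1 * (N / p') + (1 - \<theta>1) * (N / p)"
      using 1(1,2) 1(3)[of N] \<theta> by auto
    have s2: "s2 = \<theta>2 * s' + (1 - \<theta>2) * s" "1 \<le> p2" "N / p2 = \<theta>2 * (N / p') + (1 - \<theta>2) * (N / p)"
      using 2(1,2) 2(3)[of N] \<theta> by auto
    have "0 < \<theta>1 * (s - s')" "0 < (\<theta>2 - \<theta>1) * (s - s')" using \<theta> assms by auto
    \<comment> \<open>A positive \<open>\<theta>1\<close> brings the source order below
      \<open>s \<le> 1\<close>, so on the curve the embedding for orders below 1 applies even when
      \<open>s = 1\<close>.\<close>
    then have "s1 < s" "s2 < s1" by (auto simp: s1(1) s2(1) algebra_simps)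
    moreover have "0 \<le> s2" unfolding s2(1) using \<theta> assms by (intro add_nonneg_nonneg mult_nonneg_nonneg) auto
    moreover have "s1 * p1 < N"
    proof -
      have "N / p1 - s1 = \<theta>1 * (N / p' - s') + (1 - \<theta>1) * (N / p - s)"
        unfolding s1(1,3) by (simp add: algebra_simps)
      moreover have "0 < \<theta>1 * (N / p' - s') + (1 - \<theta>1) * (N / p - s)"
        using \<theta> key pos by (intro add_pos_pos mult_pos_pos) auto
      ultimately have "s1 < N / p1" by simp
      then show ?thesis using s1(2) by (simp add: pos_less_divide_eq)
    qed
    moreover have "N / p1 - s1 < N / p2 - s2"
    proof -
      have "\<theta>2 * A + (1 - \<theta>2) * B - (\<theta>2 * s' + (1 - \<theta>2) * s) - (\<theta>1 * A + (1 - \<theta>1) * B - (\<theta>1 * s' + (1 - \<theta>1) * s))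
          = (\<theta>2 - \<theta>1) * ((A - s') - (B - s))" for A B
        by (simp add: algebra_simps)
      then have "(N / p2 - s2) - (N / p1 - s1) = (\<theta>2 - \<theta>1) * ((N / p' - s') - (N / p - s))"
        unfolding s1(1,3) s2(1,3) .
      moreover have "0 < (\<theta>2 - \<theta>1) * ((N / p' - s') - (N / p - s))"
        using \<theta> key by (intro mult_pos_pos) auto
      ultimately show ?thesis by simp
    qed
    ultimately show ?thesis
      using compactly_embedded_subcritical[OF _ s1(2) _ _ _ _ _ s2(2), of s1 s2] assms(2)
      unfolding N_def by simp
  qed
  ultimately show ?thesis by blast
qed

end
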